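(* Let $M$ be a monoid and $\tau$ any topology on the underlying set of $M$. Then the category $\mathrm{Cont}(M,\tau)$ is a supercompactly generated, two-valued Grothendieck topos with enough points.
   Context: The topology $\tau$ is not assumed to make multiplication continuous. An $(M,\tau)$-set is a right $M$-set $X$ whose action $X\times M\to X$ is continuous when $X$ is given the discrete topology; $\mathrm{Cont}(M,\tau)$ is the category of $(M,\tau)$-sets and $M$-equivariant maps. An object $C$ of a category is supercompact if every jointly epic family $\{A_i\to C\}$ contains an epimorphism. A topos is supercompactly generated if its supercompact objects form a separating class. A topos is two-valued if its terminal object has exactly two subobjects. *)

theory Defs
  imports "HOL-Analysis.Analysis" "HOL-Library.Equipollence"
begin

section \<open>Small sets\<close>

text \<open>
  HOL has no type of all sets, so the category of sets is taken relative to a collection \<open>U\<close> of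
  subsets of some type \<open>'u\<close>, whose members (and the sets equipollent to them) are called small.
\<close>

definition small :: "'u set set \<Rightarrow> 'a set \<Rightarrow> bool" where
  "small U A \<longleftrightarrow> (\<exists>B\<in>U. A \<approx> B)"

definition regular_universe :: "'u set set \<Rightarrow> bool" where
  "regular_universe U \<longleftrightarrow>
     (\<forall>A B. B \<in> U \<and> A \<lesssim> B \<longrightarrow> A \<in> U) \<and>
     (\<exists>B\<in>U. infinite B) \<and>
     (\<forall>I X. I \<in> U \<and> (\<forall>i\<in>I. X i \<in> U) \<longrightarrow> small U (SIGMA i:I. X i))"

definition closed_under_exponent :: "'u set set \<Rightarrow> 'm set \<Rightarrow> bool" where
  "closed_under_exponent U S \<longleftrightarrow> (\<forall>A\<in>U. small U (S \<rightarrow>\<^sub>E A))"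

text \<open>
  The Grothendieck universes (up to equipollence) are the regular universes closed under
  powersets. Below, only closure under exponentiation by the underlying set of the monoid is
  required. This covers every Grothendieck universe in which the monoid is small
  (\<open>grothendieck_universe_closed_under_exponent\<close>), but is also satisfied in plain HOL for
  every monoid (\<open>regular_universe_example\<close>, e.g. with \<open>'k = 'm + nat\<close>).
\<close>

definition grothendieck_universe :: "'u set set \<Rightarrow> bool" where
  "grothendieck_universe U \<longleftrightarrow> regular_universe U \<and> (\<forall>A\<in>U. small U (Pow A))"


section \<open>Categories\<close>

text \<open>\<open>Comp C g f\<close> is the composite of \<open>g\<close> after \<open>f\<close>; it is only meaningful if
  \<open>Dom C g = Cod C f\<close>.\<close>

record ('o, 'a) category =
  Obj :: "'o set"
  Arr :: "'a set"
  Dom :: "'a \<Rightarrow> 'o"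
  Cod :: "'a \<Rightarrow> 'o"
  Id :: "'o \<Rightarrow> 'a"
  Comp :: "'a \<Rightarrow> 'a \<Rightarrow> 'a"

definition hom :: "('o, 'a) category \<Rightarrow> 'o \<Rightarrow> 'o \<Rightarrow> 'a set" where
  "hom C x y = {f \<in> Arr C. Dom C f = x \<and> Cod C f = y}"

definition is_category :: "('o, 'a) category \<Rightarrow> bool" where
  "is_category C \<longleftrightarrow>
     (\<forall>f\<in>Arr C. Dom C f \<in> Obj C \<and> Cod C f \<in> Obj C) \<and>
     (\<forall>x\<in>Obj C. Id C x \<in> hom C x x) \<and>
     (\<forall>f\<in>Arr C. \<forall>g\<in>Arr C. Dom C g = Cod C f \<longrightarrow> Comp C g f \<in> hom C (Dom C f) (Cod C g)) \<and>
     (\<forall>f\<in>Arr C. Comp C f (Id C (Dom C f)) = f \<and> Comp C (Id C (Cod C f)) f = f) \<and>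
     (\<forall>f\<in>Arr C. \<forall>g\<in>Arr C. \<forall>h\<in>Arr C. Dom C g = Cod C f \<and> Dom C h = Cod C g \<longrightarrow>
        Comp C h (Comp C g f) = Comp C (Comp C h g) f)"

definition op_cat :: "('o, 'a) category \<Rightarrow> ('o, 'a) category" where
  "op_cat C = \<lparr>Obj = Obj C, Arr = Arr C, Dom = Cod C, Cod = Dom C, Id = Id C,
     Comp = (\<lambda>g f. Comp C f g)\<rparr>"

definition full_subcat :: "('o, 'a) category \<Rightarrow> 'o set \<Rightarrow> ('o, 'a) category" where
  "full_subcat C P = C\<lparr>Obj := Obj C \<inter> P, Arr := {f \<in> Arr C. Dom C f \<in> P \<and> Cod C f \<in> P}\<rparr>"

definition iso :: "('o, 'a) category \<Rightarrow> 'a \<Rightarrow> bool" where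
  "iso C f \<longleftrightarrow> f \<in> Arr C \<and>
     (\<exists>g\<in>hom C (Cod C f) (Dom C f). Comp C g f = Id C (Dom C f) \<and> Comp C f g = Id C (Cod C f))"

definition mono_arr :: "('o, 'a) category \<Rightarrow> 'a \<Rightarrow> bool" where
  "mono_arr C f \<longleftrightarrow> f \<in> Arr C \<and>
     (\<forall>g\<in>Arr C. \<forall>h\<in>Arr C. Cod C g = Dom C f \<and> Cod C h = Dom C f \<and> Dom C g = Dom C h \<and>
        Comp C f g = Comp C f h \<longrightarrow> g = h)"

definition jointly_epic :: "('o, 'a) category \<Rightarrow> 'o \<Rightarrow> 'a set \<Rightarrow> bool" where
  "jointly_epic C x S \<longleftrightarrow> S \<subseteq> {f \<in> Arr C. Cod C f = x} \<and>
     (\<forall>g\<in>Arr C. \<forall>h\<in>Arr C. Dom C g = x \<and> Dom C h = x \<and> Cod C g = Cod C h \<and>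
        (\<forall>f\<in>S. Comp C g f = Comp C h f) \<longrightarrow> g = h)"

definition epi_arr :: "('o, 'a) category \<Rightarrow> 'a \<Rightarrow> bool" where
  "epi_arr C f \<longleftrightarrow> f \<in> Arr C \<and>
     (\<forall>g\<in>Arr C. \<forall>h\<in>Arr C. Dom C g = Cod C f \<and> Dom C h = Cod C f \<and> Cod C g = Cod C h \<and>
        Comp C g f = Comp C h f \<longrightarrow> g = h)"

definition terminal :: "('o, 'a) category \<Rightarrow> 'o \<Rightarrow> bool" where
  "terminal C t \<longleftrightarrow> t \<in> Obj C \<and> (\<forall>x\<in>Obj C. \<exists>!f. f \<in> hom C x t)"

definition subobject_equiv :: "('o, 'a) category \<Rightarrow> 'o \<Rightarrow> ('a \<times> 'a) set" where
  "subobject_equiv C x = {(m, n). mono_arr C m \<and> mono_arr C n \<and> Cod C m = x \<and> Cod C n = x \<and>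
     (\<exists>i\<in>hom C (Dom C m) (Dom C n). iso C i \<and> m = Comp C n i)}"

definition subobjects :: "('o, 'a) category \<Rightarrow> 'o \<Rightarrow> 'a set set" where
  "subobjects C x = {m. mono_arr C m \<and> Cod C m = x} // subobject_equiv C x"

definition separating :: "('o, 'a) category \<Rightarrow> 'o set \<Rightarrow> bool" where
  "separating C G \<longleftrightarrow> G \<subseteq> Obj C \<and>
     (\<forall>f\<in>Arr C. \<forall>g\<in>Arr C. Dom C f = Dom C g \<and> Cod C f = Cod C g \<and> f \<noteq> g \<longrightarrow>
        (\<exists>x\<in>G. \<exists>h\<in>hom C x (Dom C f). Comp C f h \<noteq> Comp C g h))"


section \<open>Functors and natural transformations\<close>

record ('o, 'a, 'p, 'b) cfunctor =
  ob_map :: "'o \<Rightarrow> 'p"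
  arr_map :: "'a \<Rightarrow> 'b"

definition is_functor ::
    "('o, 'a) category \<Rightarrow> ('p, 'b) category \<Rightarrow> ('o, 'a, 'p, 'b) cfunctor \<Rightarrow> bool" where
  "is_functor C D F \<longleftrightarrow> is_category C \<and> is_category D \<and>
     (\<forall>x\<in>Obj C. ob_map F x \<in> Obj D) \<and>
     (\<forall>f\<in>Arr C. arr_map F f \<in> hom D (ob_map F (Dom C f)) (ob_map F (Cod C f))) \<and>
     (\<forall>x\<in>Obj C. arr_map F (Id C x) = Id D (ob_map F x)) \<and>
     (\<forall>f\<in>Arr C. \<forall>g\<in>Arr C. Dom C g = Cod C f \<longrightarrow>
        arr_map F (Comp C g f) = Comp D (arr_map F g) (arr_map F f))"

definition id_functor :: "('o, 'a, 'o, 'a) cfunctor" where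
  "id_functor = \<lparr>ob_map = (\<lambda>x. x), arr_map = (\<lambda>f. f)\<rparr>"

definition comp_functor ::
    "('p, 'b, 'q, 'c) cfunctor \<Rightarrow> ('o, 'a, 'p, 'b) cfunctor \<Rightarrow> ('o, 'a, 'q, 'c) cfunctor" where
  "comp_functor G F = \<lparr>ob_map = ob_map G \<circ> ob_map F, arr_map = arr_map G \<circ> arr_map F\<rparr>"

definition nat_trans :: "('o, 'a) category \<Rightarrow> ('p, 'b) category \<Rightarrow>
    ('o, 'a, 'p, 'b) cfunctor \<Rightarrow> ('o, 'a, 'p, 'b) cfunctor \<Rightarrow> ('o \<Rightarrow> 'b) \<Rightarrow> bool" where
  "nat_trans C D F G \<eta> \<longleftrightarrow> is_functor C D F \<and> is_functor C D G \<and>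
     (\<forall>x\<in>Obj C. \<eta> x \<in> hom D (ob_map F x) (ob_map G x)) \<and>
     (\<forall>f\<in>Arr C. Comp D (\<eta> (Cod C f)) (arr_map F f) = Comp D (arr_map G f) (\<eta> (Dom C f)))"

definition nat_iso :: "('o, 'a) category \<Rightarrow> ('p, 'b) category \<Rightarrow>
    ('o, 'a, 'p, 'b) cfunctor \<Rightarrow> ('o, 'a, 'p, 'b) cfunctor \<Rightarrow> ('o \<Rightarrow> 'b) \<Rightarrow> bool" where
  "nat_iso C D F G \<eta> \<longleftrightarrow> nat_trans C D F G \<eta> \<and> (\<forall>x\<in>Obj C. iso D (\<eta> x))"

definition equivalent :: "('o, 'a) category \<Rightarrow> ('p, 'b) category \<Rightarrow> bool" where
  "equivalent C D \<longleftrightarrow>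
     (\<exists>F G \<eta> \<epsilon>. is_functor C D F \<and> is_functor D C G \<and>
        nat_iso C C id_functor (comp_functor G F) \<eta> \<and>
        nat_iso D D (comp_functor F G) id_functor \<epsilon>)"

text \<open>The unit-counit form of \<open>L \<stileturn> R\<close>, for \<open>L\<close> from \<open>C\<close> to \<open>D\<close>.\<close>

definition adjoint :: "('o, 'a) category \<Rightarrow> ('p, 'b) category \<Rightarrow>
    ('o, 'a, 'p, 'b) cfunctor \<Rightarrow> ('p, 'b, 'o, 'a) cfunctor \<Rightarrow> bool" where
  "adjoint C D L R \<longleftrightarrow> is_functor C D L \<and> is_functor D C R \<and>
     (\<exists>\<eta> \<epsilon>. nat_trans C C id_functor (comp_functor R L) \<eta> \<and>
        nat_trans D D (comp_functor L R) id_functor \<epsilon> \<and>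
        (\<forall>x\<in>Obj C. Comp D (\<epsilon> (ob_map L x)) (arr_map L (\<eta> x)) = Id D (ob_map L x)) \<and>
        (\<forall>y\<in>Obj D. Comp C (arr_map R (\<epsilon> y)) (\<eta> (ob_map R y)) = Id C (ob_map R y)))"

definition cone :: "('i, 'j) category \<Rightarrow> ('o, 'a) category \<Rightarrow> ('i, 'j, 'o, 'a) cfunctor \<Rightarrow>
    'o \<Rightarrow> ('i \<Rightarrow> 'a) \<Rightarrow> bool" where
  "cone J C D x \<pi> \<longleftrightarrow> is_functor J C D \<and> x \<in> Obj C \<and>
     (\<forall>j\<in>Obj J. \<pi> j \<in> hom C x (ob_map D j)) \<and>
     (\<forall>u\<in>Arr J. Comp C (arr_map D u) (\<pi> (Dom J u)) = \<pi> (Cod J u))"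

definition limit_cone :: "('i, 'j) category \<Rightarrow> ('o, 'a) category \<Rightarrow> ('i, 'j, 'o, 'a) cfunctor \<Rightarrow>
    'o \<Rightarrow> ('i \<Rightarrow> 'a) \<Rightarrow> bool" where
  "limit_cone J C D l \<pi> \<longleftrightarrow> cone J C D l \<pi> \<and>
     (\<forall>x \<kappa>. cone J C D x \<kappa> \<longrightarrow>
        (\<exists>!u. u \<in> hom C x l \<and> (\<forall>j\<in>Obj J. Comp C (\<pi> j) u = \<kappa> j)))"

text \<open>Every finite category is isomorphic to one whose objects and arrows are natural numbers.\<close>

definition preserves_finite_limits :: "('o, 'a) category \<Rightarrow> ('p, 'b) category \<Rightarrow>
    ('o, 'a, 'p, 'b) cfunctor \<Rightarrow> bool" where
  "preserves_finite_limits C D F \<longleftrightarrow>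
     (\<forall>(J :: (nat, nat) category) T l \<pi>.
        is_category J \<and> finite (Obj J) \<and> finite (Arr J) \<and> limit_cone J C T l \<pi> \<longrightarrow>
        limit_cone J D (comp_functor F T) (ob_map F l) (\<lambda>j. arr_map F (\<pi> j)))"

text \<open>
  Functors and natural transformations that occur as objects and arrows of a functor category are
  required to be \<open>undefined\<close> off \<open>C\<close>, so that equal ones are equal in HOL.
\<close>

definition functor_cat :: "('o, 'a) category \<Rightarrow> ('p, 'b) category \<Rightarrow>
    (('o, 'a, 'p, 'b) cfunctor,
     ('o, 'a, 'p, 'b) cfunctor \<times> ('o \<Rightarrow> 'b) \<times> ('o, 'a, 'p, 'b) cfunctor) category" where
  "functor_cat C D =
     (let Ob = {F. is_functor C D F \<and> ob_map F \<in> extensional (Obj C) \<and>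
                   arr_map F \<in> extensional (Arr C)}
      in \<lparr>Obj = Ob,
          Arr = {(F, \<eta>, G). F \<in> Ob \<and> G \<in> Ob \<and> nat_trans C D F G \<eta> \<and> \<eta> \<in> extensional (Obj C)},
          Dom = (\<lambda>(F, \<eta>, G). F),
          Cod = (\<lambda>(F, \<eta>, G). G),
          Id = (\<lambda>F. (F, \<lambda>x\<in>Obj C. Id D (ob_map F x), F)),
          Comp = (\<lambda>(G, \<theta>, H) (F, \<eta>, G'). (F, \<lambda>x\<in>Obj C. Comp D (\<theta> x) (\<eta> x), H))\<rparr>)"


section \<open>Sets and sheaves\<close>

text \<open>
  The category with objects \<open>Ob\<close> whose arrows from \<open>A\<close> to \<open>B\<close> are functions in \<open>H A B\<close>
  between the underlying sets given by \<open>c\<close>.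
\<close>

definition concrete_cat :: "'o set \<Rightarrow> ('o \<Rightarrow> 'u set) \<Rightarrow> ('o \<Rightarrow> 'o \<Rightarrow> ('u \<Rightarrow> 'u) set) \<Rightarrow>
    ('o, 'o \<times> ('u \<Rightarrow> 'u) \<times> 'o) category" where
  "concrete_cat Ob c H =
     \<lparr>Obj = Ob,
      Arr = {(A, f, B). A \<in> Ob \<and> B \<in> Ob \<and> f \<in> c A \<rightarrow>\<^sub>E c B \<and> f \<in> H A B},
      Dom = (\<lambda>(A, f, B). A),
      Cod = (\<lambda>(A, f, B). B),
      Id = (\<lambda>A. (A, \<lambda>x\<in>c A. x, A)),
      Comp = (\<lambda>(B, g, C) (A, f, B'). (A, compose (c A) g f, C))\<rparr>"

type_synonym 'u set_arrow = "'u set \<times> ('u \<Rightarrow> 'u) \<times> 'u set"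

definition set_cat :: "'u set set \<Rightarrow> ('u set, 'u set_arrow) category" where
  "set_cat U = concrete_cat U (\<lambda>A. A) (\<lambda>A B. UNIV)"

definition fun_of :: "'o \<times> ('u \<Rightarrow> 'u) \<times> 'o \<Rightarrow> 'u \<Rightarrow> 'u" where
  "fun_of = (\<lambda>(A, f, B). f)"

definition sieve :: "('o, 'a) category \<Rightarrow> 'o \<Rightarrow> 'a set \<Rightarrow> bool" where
  "sieve C x S \<longleftrightarrow> S \<subseteq> {f \<in> Arr C. Cod C f = x} \<and>
     (\<forall>f\<in>S. \<forall>g\<in>Arr C. Cod C g = Dom C f \<longrightarrow> Comp C f g \<in> S)"

definition pullback_sieve :: "('o, 'a) category \<Rightarrow> 'a \<Rightarrow> 'a set \<Rightarrow> 'a set" where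
  "pullback_sieve C h S = {g \<in> Arr C. Cod C g = Dom C h \<and> Comp C h g \<in> S}"

definition grothendieck_topology :: "('o, 'a) category \<Rightarrow> ('o \<Rightarrow> 'a set set) \<Rightarrow> bool" where
  "grothendieck_topology C J \<longleftrightarrow>
     (\<forall>x\<in>Obj C. \<forall>S\<in>J x. sieve C x S) \<and>
     (\<forall>x\<in>Obj C. {f \<in> Arr C. Cod C f = x} \<in> J x) \<and>
     (\<forall>h\<in>Arr C. \<forall>S\<in>J (Cod C h). pullback_sieve C h S \<in> J (Dom C h)) \<and>
     (\<forall>x\<in>Obj C. \<forall>S\<in>J x. \<forall>R. sieve C x R \<and> (\<forall>h\<in>S. pullback_sieve C h R \<in> J (Dom C h)) \<longrightarrow> R \<in> J x)"

abbreviation presheaf_cat where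
  "presheaf_cat U C \<equiv> functor_cat (op_cat C) (set_cat U)"

definition matching_family :: "('o, 'a) category \<Rightarrow> ('o, 'a, 'u set, 'u set_arrow) cfunctor \<Rightarrow>
    'a set \<Rightarrow> ('a \<Rightarrow> 'u) \<Rightarrow> bool" where
  "matching_family C F S s \<longleftrightarrow>
     (\<forall>f\<in>S. s f \<in> ob_map F (Dom C f)) \<and>
     (\<forall>f\<in>S. \<forall>g\<in>Arr C. Cod C g = Dom C f \<longrightarrow> s (Comp C f g) = fun_of (arr_map F g) (s f))"

definition is_sheaf :: "('o, 'a) category \<Rightarrow> ('o \<Rightarrow> 'a set set) \<Rightarrow>
    ('o, 'a, 'u set, 'u set_arrow) cfunctor \<Rightarrow> bool" where
  "is_sheaf C J F \<longleftrightarrow>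
     (\<forall>x\<in>Obj C. \<forall>S\<in>J x. \<forall>s. matching_family C F S s \<longrightarrow>
        (\<exists>!a. a \<in> ob_map F x \<and> (\<forall>f\<in>S. fun_of (arr_map F f) a = s f)))"

definition sheaf_cat where
  "sheaf_cat U C J = full_subcat (presheaf_cat U C) {F. is_sheaf C J F}"


section \<open>Toposes\<close>

text \<open>Every small category is isomorphic to one whose sets of objects and arrows are members
  of \<open>U\<close>.\<close>

definition grothendieck_topos :: "'u set set \<Rightarrow> ('o, 'a) category \<Rightarrow> bool" where
  "grothendieck_topos U E \<longleftrightarrow> is_category E \<and>
     (\<exists>(C :: ('u, 'u) category) J. is_category C \<and> Obj C \<in> U \<and> Arr C \<in> U \<and>
        grothendieck_topology C J \<and> equivalent E (sheaf_cat U C J))"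

definition supercompact :: "('o, 'a) category \<Rightarrow> 'o \<Rightarrow> bool" where
  "supercompact E x \<longleftrightarrow> x \<in> Obj E \<and> (\<forall>S. jointly_epic E x S \<longrightarrow> (\<exists>f\<in>S. epi_arr E f))"

definition supercompactly_generated :: "('o, 'a) category \<Rightarrow> bool" where
  "supercompactly_generated E \<longleftrightarrow> separating E {x. supercompact E x}"

definition two_valued :: "('o, 'a) category \<Rightarrow> bool" where
  "two_valued E \<longleftrightarrow> (\<exists>t. terminal E t) \<and> (\<forall>t. terminal E t \<longrightarrow> card (subobjects E t) = 2)"

text \<open>A geometric morphism from \<open>F\<close> to \<open>E\<close> with direct image \<open>d\<close> and inverse image \<open>i\<close>.\<close>

definition geometric_morphism :: "('p, 'b) category \<Rightarrow> ('o, 'a) category \<Rightarrow>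
    ('p, 'b, 'o, 'a) cfunctor \<Rightarrow> ('o, 'a, 'p, 'b) cfunctor \<Rightarrow> bool" where
  "geometric_morphism F E d i \<longleftrightarrow> adjoint E F i d \<and> preserves_finite_limits E F i"

text \<open>The inverse images of the points, i.e. of the geometric morphisms from the category of sets,
  jointly reflect isomorphisms.\<close>

definition has_enough_points :: "'u set set \<Rightarrow> ('o, 'a) category \<Rightarrow> bool" where
  "has_enough_points U E \<longleftrightarrow>
     (\<forall>h\<in>Arr E. (\<forall>d i. geometric_morphism (set_cat U) E d i \<longrightarrow> iso (set_cat U) (arr_map i h)) \<longrightarrow>
        iso E h)"


section \<open>Continuous actions of a monoid\<close>

text \<open>An action is \<open>undefined\<close> off its underlying set, so that equal right \<open>M\<close>-sets are equal
  in HOL.\<close>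

type_synonym ('u, 'm) mset = "'u set \<times> ('u \<Rightarrow> 'm \<Rightarrow> 'u)"

definition right_mset :: "('u, 'm::monoid_mult) mset \<Rightarrow> bool" where
  "right_mset = (\<lambda>(X, act). act \<in> extensional X \<and>
     (\<forall>x\<in>X. \<forall>m. act x m \<in> X) \<and>
     (\<forall>x\<in>X. act x 1 = x) \<and>
     (\<forall>x\<in>X. \<forall>m n. act x (m * n) = act (act x m) n))"

definition continuous_mset :: "'m::monoid_mult topology \<Rightarrow> ('u, 'm) mset \<Rightarrow> bool" where
  "continuous_mset \<tau> = (\<lambda>(X, act). right_mset (X, act) \<and>
     continuous_map (prod_topology (discrete_topology X) \<tau>) (discrete_topology X)
       (\<lambda>(x, m). act x m))"

definition equivariant :: "('u, 'm::monoid_mult) mset \<Rightarrow> ('u, 'm) mset \<Rightarrow> ('u \<Rightarrow> 'u) \<Rightarrow> bool" where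
  "equivariant = (\<lambda>(X, a) (Y, b) f. \<forall>x\<in>X. \<forall>m. f (a x m) = b (f x) m)"

definition Cont :: "'u set set \<Rightarrow> 'm::monoid_mult topology \<Rightarrow>
    (('u, 'm) mset, ('u, 'm) mset \<times> ('u \<Rightarrow> 'u) \<times> ('u, 'm) mset) category" where
  "Cont U \<tau> = concrete_cat {A. fst A \<in> U \<and> continuous_mset \<tau> A} fst
     (\<lambda>A B. {f. equivariant A B f})"


section \<open>Existence of universes\<close>

lemma grothendieck_universe_closed_under_exponent:
  assumes U: "grothendieck_universe U" and S: "small U S"
  shows "closed_under_exponent U S"
proof -
  have sub: "\<And>A B. B \<in> U \<Longrightarrow> A \<lesssim> B \<Longrightarrow> A \<in> U"
    and sig: "\<And>I X. I \<in> U \<Longrightarrow> (\<forall>i\<in>I. X i \<in> U) \<Longrightarrow> small U (SIGMA i:I. X i)"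
    and pow: "\<And>A. A \<in> U \<Longrightarrow> small U (Pow A)"
    using U unfolding grothendieck_universe_def regular_universe_def by blast+
  have small_le: "small U A" if "A \<lesssim> B" "B \<in> U" for A :: "'x set" and B
  proof -
    obtain f where f: "inj_on f A" "f ` A \<subseteq> B"
      using \<open>A \<lesssim> B\<close> unfolding lepoll_def by blast
    then have "f ` A \<in> U" using sub[OF \<open>B \<in> U\<close>] subset_imp_lepoll by blast
    moreover have "A \<approx> f ` A" using f(1) inj_on_image_eqpoll_self eqpoll_sym by blast
    ultimately show ?thesis unfolding small_def by blast
  qed
  obtain T where T: "T \<in> U" "S \<approx> T" using S unfolding small_def by blast
  have "small U (S \<rightarrow>\<^sub>E A)" if "A \<in> U" for A
  proof -
    obtain P where P: "P \<in> U" "T \<times> A \<approx> P"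
      using sig[of T "\<lambda>_. A"] T(1) \<open>A \<in> U\<close> unfolding small_def by blast
    obtain Q where Q: "Q \<in> U" "Pow P \<approx> Q" using pow[OF P(1)] unfolding small_def by blast
    have "S \<times> A \<approx> P"
      using T(2) P(2) times_eqpoll_cong[of S T A A] eqpoll_refl eqpoll_trans by blast
    then obtain k where k: "bij_betw k (S \<times> A) P" unfolding eqpoll_def by blast
    have "inj_on (\<lambda>f. k ` ((\<lambda>s. (s, f s)) ` S)) (S \<rightarrow>\<^sub>E A)"
    proof (rule inj_onI)
      fix f g assume fg: "f \<in> S \<rightarrow>\<^sub>E A" "g \<in> S \<rightarrow>\<^sub>E A"
        and eq: "k ` ((\<lambda>s. (s, f s)) ` S) = k ` ((\<lambda>s. (s, g s)) ` S)"
      have "(\<lambda>s. (s, f s)) ` S = (\<lambda>s. (s, g s)) ` S"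
        using eq bij_betw_imp_inj_on[OF k] fg
        by (subst (asm) inj_on_image_eq_iff[of k "S \<times> A"]) auto
      then have "\<And>s. s \<in> S \<Longrightarrow> f s = g s" by auto
      then show "f = g" using fg by (intro PiE_ext) auto
    qed
    moreover have "(\<lambda>f. k ` ((\<lambda>s. (s, f s)) ` S)) ` (S \<rightarrow>\<^sub>E A) \<subseteq> Pow P"
      using bij_betw_imp_surj_on[OF k] by fastforce
    ultimately have "(S \<rightarrow>\<^sub>E A) \<lesssim> Pow P" unfolding lepoll_def by blast
    then have "(S \<rightarrow>\<^sub>E A) \<lesssim> Q" using Q(2) lepoll_trans2 by blast
    then show ?thesis using small_le Q(1) by blast
  qed
  then show ?thesis unfolding closed_under_exponent_def by blast
qed

lemma regular_universe_example:
  fixes i :: "'m \<Rightarrow> 'k"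
  defines "U \<equiv> UNIV :: ('k \<Rightarrow> bool) set set"
  assumes i: "inj i" and inf: "infinite (UNIV :: 'k set)"
  shows "regular_universe U" and "closed_under_exponent U (UNIV :: 'm set)"
proof -
  have smallI: "small U A" if "A \<lesssim> (UNIV :: ('k \<Rightarrow> bool) set)" for A :: "'x set"
  proof -
    obtain f :: "'x \<Rightarrow> 'k \<Rightarrow> bool" where "inj_on f A"
      using \<open>A \<lesssim> _\<close> unfolding lepoll_def by blast
    then have "A \<approx> f ` A" using inj_on_image_eqpoll_self eqpoll_sym by blast
    then show ?thesis unfolding small_def U_def by blast
  qed
  have sq: "\<exists>e :: 'x \<times> 'x \<Rightarrow> 'x. inj e" if "infinite (UNIV :: 'x set)"
  proof -
    have "(UNIV :: 'x set) \<times> (UNIV :: 'x set) \<approx> (UNIV :: 'x set)"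
      unfolding eqpoll_iff_card_of_ordIso by (rule card_of_Times_same_infinite[OF that])
    then show ?thesis unfolding eqpoll_def bij_betw_def UNIV_Times_UNIV by blast
  qed
  obtain e :: "'k \<times> 'k \<Rightarrow> 'k" where e: "inj e" using sq[OF inf] by blast
  have "inj (\<lambda>k x. x = (k :: 'k))"
    by (rule injI) metis
  then have inf': "infinite (UNIV :: ('k \<Rightarrow> bool) set)"
    using inf finite_imageD[of "\<lambda>k x. x = (k :: 'k)" UNIV] finite_subset[OF subset_UNIV] by blast
  have pair: "(UNIV :: (('k \<Rightarrow> bool) \<times> ('k \<Rightarrow> bool)) set) \<lesssim> (UNIV :: ('k \<Rightarrow> bool) set)"
    using sq[OF inf'] unfolding lepoll_def by blast
  have "small U (SIGMA i:I. X i)" for I :: "('k \<Rightarrow> bool) set" and X :: "_ \<Rightarrow> ('k \<Rightarrow> bool) set"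
    by (rule smallI[OF lepoll_trans[OF subset_imp_lepoll[OF subset_UNIV] pair]])
  then show "regular_universe U"
    using inf' unfolding regular_universe_def U_def by blast
  define h where "h = (\<lambda>(f :: 'm \<Rightarrow> 'k \<Rightarrow> bool) z. \<exists>m k. z = e (i m, k) \<and> f m k)"
  have h: "h f (e (i m, k)) \<longleftrightarrow> f m k" for f m k
    using injD[OF e] injD[OF i] unfolding h_def by blast
  have "inj h"
    by (rule injI, intro ext) (simp flip: h)
  then have fn: "(UNIV :: ('m \<Rightarrow> 'k \<Rightarrow> bool) set) \<lesssim> (UNIV :: ('k \<Rightarrow> bool) set)"
    unfolding lepoll_def by blast
  have "small U ((UNIV :: 'm set) \<rightarrow>\<^sub>E A)" for A :: "('k \<Rightarrow> bool) set"
    by (rule smallI[OF lepoll_trans[OF subset_imp_lepoll[OF subset_UNIV] fn]])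
  then show "closed_under_exponent U (UNIV :: 'm set)"
    unfolding closed_under_exponent_def by blast
qed

end

theory Submission
  imports Defs
begin

text \<open>
  An open right congruence on \<open>M\<close> is one whose quotient is a continuous \<open>M\<close>-set; the kernel
  \<open>{(m, n). x m = x n}\<close> of any point \<open>x\<close> of a continuous \<open>M\<close>-set \<open>X\<close> is one, and the maps from the
  quotient by \<open>r\<close> to \<open>X\<close> are the points of \<open>X\<close> whose kernel contains \<open>r\<close>. Hence the principal
  \<open>M\<close>-sets separate, and they are supercompact because a jointly epic family covers the generator.

  There is only a small set of principal \<open>M\<close>-sets. With the topology in which a sieve covers if it
  contains a surjection, the functor sending \<open>X\<close> to the sheaf of its points with kernel containing
  \<open>r\<close> is fully faithful, and a sheaf \<open>P\<close> is recovered from the colimit of the \<open>P r\<close> along the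
  filtered system of quotient maps between the principal \<open>M\<close>-sets.

  A single point suffices: the forgetful functor to sets reflects isomorphisms, preserves finite
  limits (a compatible family of points has an open common kernel), and has as right adjoint the
  continuous part of the coinduced action on functions from \<open>M\<close>.
\<close>

section \<open>Categories, adjunctions and equivalences\<close>

text \<open>Translations of \<open>M\<close> need not be continuous, so open classes alone do not
  make the quotient by a right congruence a continuous action: for every \<open>k\<close> the set of
  \<open>n\<close> with \<open>k * n\<close> in a given class has to be open. In this strong form
  openness survives finite intersections and pulling back along left multiplication by an element.
  These two facts produce the common kernels, the common refinements and the squares that stand in
  for pullbacks. \<open>M\<close> itself need not be a continuous action, so no single object takes
  the part of a free generator and the site needs one object for each open congruence. Size is the
  other constraint. A congruence is stored as a function from \<open>M\<close> to \<open>M\<close>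
  that chooses representatives, hence closure under exponentiation by \<open>M\<close> bounds the
  number of congruences; it also bounds the coinduced action. Quotients and function sets do not
  live on the type \<open>'u\<close> of small carriers, so each construction is carried out on its
  natural carrier and then moved into \<open>U\<close> along an injection.\<close>

lemma homD:
  assumes "f \<in> hom C x y"
  shows "f \<in> Arr C" "Dom C f = x" "Cod C f = y"
  using assms by (auto simp: hom_def)

lemma hom_Obj:
  assumes "is_category C" "f \<in> hom C x y"
  shows "x \<in> Obj C" "y \<in> Obj C"
  using assms by (auto simp: hom_def is_category_def)

lemma Arr_hom: "f \<in> Arr C \<Longrightarrow> f \<in> hom C (Dom C f) (Cod C f)"
  by (simp add: hom_def)

lemma Id_hom: "is_category C \<Longrightarrow> x \<in> Obj C \<Longrightarrow> Id C x \<in> hom C x x"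
  by (simp add: is_category_def)

lemma Comp_hom:
  assumes "is_category C" "f \<in> hom C x y" "g \<in> hom C y z"
  shows "Comp C g f \<in> hom C x z"
  using assms unfolding is_category_def hom_def by blast

lemma Comp_Id:
  assumes "is_category C" "f \<in> hom C x y"
  shows "Comp C f (Id C x) = f" "Comp C (Id C y) f = f"
  using assms unfolding is_category_def hom_def by blast+

lemma Comp_assoc:
  assumes "is_category C" "f \<in> hom C x y" "g \<in> hom C y z" "h \<in> hom C z w"
  shows "Comp C h (Comp C g f) = Comp C (Comp C h g) f"
  using assms unfolding is_category_def hom_def by blast

lemma is_categoryI:
  assumes "\<And>f. f \<in> Arr C \<Longrightarrow> Dom C f \<in> Obj C \<and> Cod C f \<in> Obj C"
    and "\<And>x. x \<in> Obj C \<Longrightarrow> Id C x \<in> hom C x x"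
    and "\<And>f g x y z. f \<in> hom C x y \<Longrightarrow> g \<in> hom C y z \<Longrightarrow> Comp C g f \<in> hom C x z"
    and "\<And>f x y. f \<in> hom C x y \<Longrightarrow> Comp C f (Id C x) = f \<and> Comp C (Id C y) f = f"
    and "\<And>f g h x y z w. f \<in> hom C x y \<Longrightarrow> g \<in> hom C y z \<Longrightarrow> h \<in> hom C z w \<Longrightarrow>
      Comp C h (Comp C g f) = Comp C (Comp C h g) f"
  shows "is_category C"
  unfolding is_category_def
proof (intro conjI ballI impI)
  fix f g assume "f \<in> Arr C" "g \<in> Arr C" "Dom C g = Cod C f"
  then show "Comp C g f \<in> hom C (Dom C f) (Cod C g)"
    by (intro assms(3)) (auto simp: hom_def)
next
  fix f g h assume "f \<in> Arr C" "g \<in> Arr C" "h \<in> Arr C" "Dom C g = Cod C f \<and> Dom C h = Cod C g"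
  then show "Comp C h (Comp C g f) = Comp C (Comp C h g) f"
    by (intro assms(5)) (auto simp: hom_def)
next
  fix f assume "f \<in> Arr C"
  then show "Comp C f (Id C (Dom C f)) = f" "Comp C (Id C (Cod C f)) f = f"
    using assms(4)[OF Arr_hom] by auto
qed (use assms(1,2) in auto)

lemma is_functorD:
  assumes "is_functor C D F"
  shows "is_category C" "is_category D"
    and "x \<in> Obj C \<Longrightarrow> ob_map F x \<in> Obj D"
    and "f \<in> hom C x y \<Longrightarrow> arr_map F f \<in> hom D (ob_map F x) (ob_map F y)"
    and "x \<in> Obj C \<Longrightarrow> arr_map F (Id C x) = Id D (ob_map F x)"
    and "f \<in> hom C x y \<Longrightarrow> g \<in> hom C y z \<Longrightarrow>
      arr_map F (Comp C g f) = Comp D (arr_map F g) (arr_map F f)"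
  using assms unfolding is_functor_def by (auto simp: hom_def)

lemma is_functorI:
  assumes "is_category C" "is_category D"
    and "\<And>x. x \<in> Obj C \<Longrightarrow> ob_map F x \<in> Obj D"
    and "\<And>f x y. f \<in> hom C x y \<Longrightarrow> arr_map F f \<in> hom D (ob_map F x) (ob_map F y)"
    and "\<And>x. x \<in> Obj C \<Longrightarrow> arr_map F (Id C x) = Id D (ob_map F x)"
    and "\<And>f g x y z. f \<in> hom C x y \<Longrightarrow> g \<in> hom C y z \<Longrightarrow>
      arr_map F (Comp C g f) = Comp D (arr_map F g) (arr_map F f)"
  shows "is_functor C D F"
  unfolding is_functor_def
proof (intro conjI ballI impI)
  fix f g assume "f \<in> Arr C" "g \<in> Arr C" "Dom C g = Cod C f"
  then show "arr_map F (Comp C g f) = Comp D (arr_map F g) (arr_map F f)"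
    by (intro assms(6)) (auto simp: hom_def)
next
  fix f assume "f \<in> Arr C"
  then show "arr_map F f \<in> hom D (ob_map F (Dom C f)) (ob_map F (Cod C f))"
    by (intro assms(4)) (auto simp: hom_def)
qed (rule assms; assumption)+

lemma is_functor_id: "is_category C \<Longrightarrow> is_functor C C id_functor"
  by (auto intro!: is_functorI simp: id_functor_def)

lemma is_functor_comp:
  assumes F: "is_functor C D F" and G: "is_functor D E G"
  shows "is_functor C E (comp_functor G F)"
proof (rule is_functorI[OF is_functorD(1)[OF F] is_functorD(2)[OF G]])
  fix f g x y z assume f: "f \<in> hom C x y" and g: "g \<in> hom C y z"
  show "arr_map (comp_functor G F) (Comp C g f) =
      Comp E (arr_map (comp_functor G F) g) (arr_map (comp_functor G F) f)"
    using is_functorD(6)[OF F f g] is_functorD(6)[OF G is_functorD(4)[OF F f] is_functorD(4)[OF F g]]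
    by (simp add: comp_functor_def)
qed (simp_all add: comp_functor_def is_functorD(3-5)[OF F] is_functorD(3-5)[OF G])

lemma nat_transI:
  assumes "is_functor C D F" "is_functor C D G"
    and "\<And>x. x \<in> Obj C \<Longrightarrow> \<eta> x \<in> hom D (ob_map F x) (ob_map G x)"
    and "\<And>f x y. f \<in> hom C x y \<Longrightarrow> Comp D (\<eta> y) (arr_map F f) = Comp D (arr_map G f) (\<eta> x)"
  shows "nat_trans C D F G \<eta>"
  unfolding nat_trans_def using assms(1-3) by (auto intro: assms(4)[OF Arr_hom])

lemma nat_transD:
  assumes "nat_trans C D F G \<eta>"
  shows "is_functor C D F" "is_functor C D G"
    and "x \<in> Obj C \<Longrightarrow> \<eta> x \<in> hom D (ob_map F x) (ob_map G x)"
    and "f \<in> hom C x y \<Longrightarrow> Comp D (\<eta> y) (arr_map F f) = Comp D (arr_map G f) (\<eta> x)"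
  using assms unfolding nat_trans_def hom_def by auto

section \<open>Isomorphisms, adjunctions from universal arrows, and equivalences\<close>

lemma isoI:
  assumes "f \<in> hom C x y" "g \<in> hom C y x" "Comp C g f = Id C x" "Comp C f g = Id C y"
  shows "iso C f"
  using assms unfolding iso_def hom_def by auto

lemma isoE:
  assumes "iso C f" "f \<in> hom C x y"
  obtains g where "g \<in> hom C y x" "Comp C g f = Id C x" "Comp C f g = Id C y"
  using assms unfolding iso_def hom_def by auto

text \<open>A right adjoint needs only a universal arrow from \<open>L\<close> to each object: it
  sends \<open>f\<close> to the unique transpose of \<open>f\<close> after
  \<open>\<epsilon>\<close>. Every equation between arrows into \<open>R y\<close> is proved by
  applying \<open>L\<close> and composing with \<open>\<epsilon> y\<close>, an operation that is
  injective by uniqueness. Both the inverse of an equivalence and the coinduced action are obtained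
  this way.\<close>

lemma universal_arrows_adjunction:
  assumes L: "is_functor C D L"
    and R: "\<And>y. y \<in> Obj D \<Longrightarrow> R y \<in> Obj C"
    and eps: "\<And>y. y \<in> Obj D \<Longrightarrow> \<epsilon> y \<in> hom D (ob_map L (R y)) y"
    and univ: "\<And>x y f. x \<in> Obj C \<Longrightarrow> y \<in> Obj D \<Longrightarrow> f \<in> hom D (ob_map L x) y \<Longrightarrow>
      \<exists>!g. g \<in> hom C x (R y) \<and> Comp D (\<epsilon> y) (arr_map L g) = f"
  obtains G \<eta> where "is_functor D C G" "nat_trans C C id_functor (comp_functor G L) \<eta>"
    "nat_trans D D (comp_functor L G) id_functor \<epsilon>"
    "\<And>x. x \<in> Obj C \<Longrightarrow> Comp D (\<epsilon> (ob_map L x)) (arr_map L (\<eta> x)) = Id D (ob_map L x)"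
    "\<And>y. y \<in> Obj D \<Longrightarrow> Comp C (arr_map G (\<epsilon> y)) (\<eta> (ob_map G y)) = Id C (ob_map G y)"
proof -
  note C = is_functorD(1)[OF L] and D = is_functorD(2)[OF L]
  note LO = is_functorD(3)[OF L] and LA = is_functorD(4)[OF L]
    and LI = is_functorD(5)[OF L] and LC = is_functorD(6)[OF L]
  \<comment> \<open>The adjoint transpose of \<open>f\<close>.\<close>
  define tr where "tr x y f = (THE g. g \<in> hom C x (R y) \<and> Comp D (\<epsilon> y) (arr_map L g) = f)" for x y f
  have tr: "tr x y f \<in> hom C x (R y)" "Comp D (\<epsilon> y) (arr_map L (tr x y f)) = f"
    if "x \<in> Obj C" "y \<in> Obj D" "f \<in> hom D (ob_map L x) y" for x y f
    using theI'[OF univ[OF that]] unfolding tr_def by auto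
  have uniq: "g = h" if "g \<in> hom C x (R y)" "h \<in> hom C x (R y)"
    "Comp D (\<epsilon> y) (arr_map L g) = Comp D (\<epsilon> y) (arr_map L h)" "y \<in> Obj D" for g h x y
  proof -
    have x: "x \<in> Obj C" using hom_Obj[OF C that(1)] by blast
    have "Comp D (\<epsilon> y) (arr_map L g) \<in> hom D (ob_map L x) y"
      by (rule Comp_hom[OF D LA[OF that(1)] eps[OF that(4)]])
    from univ[OF x that(4) this] that show ?thesis by metis
  qed
  define G where "G = \<lparr>ob_map = R, arr_map = (\<lambda>f. tr (R (Dom D f)) (Cod D f) (Comp D f (\<epsilon> (Dom D f))))\<rparr>"
  have Gob: "ob_map G = R" by (simp add: G_def)
  have Garr: "arr_map G f \<in> hom C (R y) (R z)"
      "Comp D (\<epsilon> z) (arr_map L (arr_map G f)) = Comp D f (\<epsilon> y)"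
    if f: "f \<in> hom D y z" for f y z
  proof -
    note yz = hom_Obj[OF D f]
    have e: "arr_map G f = tr (R y) z (Comp D f (\<epsilon> y))" using f by (simp add: G_def hom_def)
    show "arr_map G f \<in> hom C (R y) (R z)"
      "Comp D (\<epsilon> z) (arr_map L (arr_map G f)) = Comp D f (\<epsilon> y)"
      unfolding e using tr[OF R[OF yz(1)] yz(2) Comp_hom[OF D eps[OF yz(1)] f]] by auto
  qed
  have G: "is_functor D C G"
  proof (rule is_functorI[OF D C])
    fix x assume x: "x \<in> Obj D"
    show "ob_map G x \<in> Obj C" using R[OF x] by (simp add: Gob)
    note i = Id_hom[OF D x]
    show "arr_map G (Id D x) = Id C (ob_map G x)"
      unfolding Gob
      by (rule uniq[OF Garr(1)[OF i] Id_hom[OF C R[OF x]] _ x])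
        (simp add: Garr(2)[OF i] LI[OF R[OF x]] Comp_Id[OF D eps[OF x]])
  next
    fix f x y assume "f \<in> hom D x y"
    then show "arr_map G f \<in> hom C (ob_map G x) (ob_map G y)" by (simp add: Gob Garr)
  next
    fix f g x y z assume f: "f \<in> hom D x y" and g: "g \<in> hom D y z"
    note x = hom_Obj(1)[OF D f] and y = hom_Obj[OF D g]
    note gf = Comp_hom[OF D f g]
    note fG = Garr(1)[OF f] and gG = Garr(1)[OF g]
    have "Comp D (\<epsilon> z) (arr_map L (Comp C (arr_map G g) (arr_map G f)))
      = Comp D (Comp D (\<epsilon> z) (arr_map L (arr_map G g))) (arr_map L (arr_map G f))"
      unfolding LC[OF fG gG] by (rule Comp_assoc[OF D LA[OF fG] LA[OF gG] eps[OF y(2)]])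
    also have "\<dots> = Comp D g (Comp D (\<epsilon> y) (arr_map L (arr_map G f)))"
      unfolding Garr(2)[OF g] by (rule Comp_assoc[OF D LA[OF fG] eps[OF y(1)] g, symmetric])
    also have "\<dots> = Comp D (Comp D g f) (\<epsilon> x)"
      unfolding Garr(2)[OF f] by (rule Comp_assoc[OF D eps[OF x] f g])
    finally show "arr_map G (Comp D g f) = Comp C (arr_map G g) (arr_map G f)"
      by (intro uniq[OF Garr(1)[OF gf] Comp_hom[OF C fG gG] _ y(2)]) (simp add: Garr(2)[OF gf])
  qed
  define \<eta> where "\<eta> x = tr x (ob_map L x) (Id D (ob_map L x))" for x
  have eta: "\<eta> x \<in> hom C x (R (ob_map L x))"
      "Comp D (\<epsilon> (ob_map L x)) (arr_map L (\<eta> x)) = Id D (ob_map L x)" if x: "x \<in> Obj C" for x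
    unfolding \<eta>_def using tr[OF x LO[OF x] Id_hom[OF D LO[OF x]]] by auto
  have "nat_trans C C id_functor (comp_functor G L) \<eta>"
  proof (rule nat_transI[OF is_functor_id[OF C] is_functor_comp[OF L G]])
    fix x assume "x \<in> Obj C"
    then show "\<eta> x \<in> hom C (ob_map id_functor x) (ob_map (comp_functor G L) x)"
      using eta by (simp add: id_functor_def comp_functor_def Gob)
  next
    fix f x y assume f: "f \<in> hom C x y"
    note x = hom_Obj(1)[OF C f] and y = hom_Obj(2)[OF C f]
    note Lf = LA[OF f]
    note GLf = Garr[OF Lf]
    have "Comp D (\<epsilon> (ob_map L y)) (arr_map L (Comp C (\<eta> y) f))
      = Comp D (Comp D (\<epsilon> (ob_map L y)) (arr_map L (\<eta> y))) (arr_map L f)"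
      unfolding LC[OF f eta(1)[OF y]]
      by (rule Comp_assoc[OF D Lf LA[OF eta(1)[OF y]] eps[OF LO[OF y]]])
    also have "\<dots> = arr_map L f" unfolding eta(2)[OF y] by (rule Comp_Id(2)[OF D Lf])
    also have "\<dots> = Comp D (arr_map L f) (Comp D (\<epsilon> (ob_map L x)) (arr_map L (\<eta> x)))"
      unfolding eta(2)[OF x] by (rule Comp_Id(1)[OF D Lf, symmetric])
    also have "\<dots> = Comp D (Comp D (\<epsilon> (ob_map L y)) (arr_map L (arr_map G (arr_map L f)))) (arr_map L (\<eta> x))"
      unfolding GLf(2) by (rule Comp_assoc[OF D LA[OF eta(1)[OF x]] eps[OF LO[OF x]] Lf])
    also have "\<dots> = Comp D (\<epsilon> (ob_map L y)) (arr_map L (Comp C (arr_map G (arr_map L f)) (\<eta> x)))"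
      unfolding LC[OF eta(1)[OF x] GLf(1)]
      by (rule Comp_assoc[OF D LA[OF eta(1)[OF x]] LA[OF GLf(1)] eps[OF LO[OF y]], symmetric])
    finally have "Comp C (\<eta> y) f = Comp C (arr_map G (arr_map L f)) (\<eta> x)"
      by (rule uniq[OF Comp_hom[OF C f eta(1)[OF y]] Comp_hom[OF C eta(1)[OF x] GLf(1)] _ LO[OF y]])
    then show "Comp C (\<eta> y) (arr_map id_functor f) = Comp C (arr_map (comp_functor G L) f) (\<eta> x)"
      by (simp add: id_functor_def comp_functor_def)
  qed
  moreover have "nat_trans D D (comp_functor L G) id_functor \<epsilon>"
    by (rule nat_transI[OF is_functor_comp[OF G L] is_functor_id[OF D]])
      (use eps Garr(2) in \<open>auto simp: id_functor_def comp_functor_def Gob\<close>)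
  moreover have "Comp C (arr_map G (\<epsilon> y)) (\<eta> (ob_map G y)) = Id C (ob_map G y)"
    if y: "y \<in> Obj D" for y
  proof -
    note e = eps[OF y] and r = R[OF y]
    note n = eta[OF r] and Ge = Garr[OF e]
    have "Comp D (\<epsilon> y) (arr_map L (Comp C (arr_map G (\<epsilon> y)) (\<eta> (R y))))
      = Comp D (Comp D (\<epsilon> y) (arr_map L (arr_map G (\<epsilon> y)))) (arr_map L (\<eta> (R y)))"
      unfolding LC[OF n(1) Ge(1)] by (rule Comp_assoc[OF D LA[OF n(1)] LA[OF Ge(1)] e])
    also have "\<dots> = Comp D (\<epsilon> y) (Comp D (\<epsilon> (ob_map L (R y))) (arr_map L (\<eta> (R y))))"
      unfolding Ge(2) by (rule Comp_assoc[OF D LA[OF n(1)] eps[OF LO[OF r]] e, symmetric])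
    also have "\<dots> = Comp D (\<epsilon> y) (arr_map L (Id C (R y)))"
      unfolding n(2) LI[OF r] ..
    finally show ?thesis unfolding Gob
      by (rule uniq[OF Comp_hom[OF C n(1) Ge(1)] Id_hom[OF C r] _ y])
  qed
  ultimately show ?thesis using that G eta(2) by blast
qed

text \<open>An isomorphism \<open>\<epsilon> z\<close> onto \<open>z\<close> from the image of some
  \<open>R z\<close> is a universal arrow when \<open>F\<close> is fully faithful, so
  \<open>universal_arrows_adjunction\<close> gives a right adjoint whose counit is invertible by
  construction. Only the unit remains: \<open>F\<close> sends it to the inverse of the counit, and
  full faithfulness lifts this back to \<open>C\<close>.\<close>

lemma equivalentI:
  assumes F: "is_functor C D F"
    and ff: "\<And>x y g. x \<in> Obj C \<Longrightarrow> y \<in> Obj C \<Longrightarrow> g \<in> hom D (ob_map F x) (ob_map F y) \<Longrightarrow>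
      \<exists>!f. f \<in> hom C x y \<and> arr_map F f = g"
    and es: "\<And>z. z \<in> Obj D \<Longrightarrow> \<exists>x\<in>Obj C. \<exists>i\<in>hom D (ob_map F x) z. iso D i"
  shows "equivalent C D"
proof -
  note C = is_functorD(1)[OF F] and D = is_functorD(2)[OF F]
  note FO = is_functorD(3)[OF F] and FA = is_functorD(4)[OF F]
    and FI = is_functorD(5)[OF F] and FC = is_functorD(6)[OF F]
  obtain R \<epsilon> where R: "\<And>z. z \<in> Obj D \<Longrightarrow> R z \<in> Obj C"
    and eps: "\<And>z. z \<in> Obj D \<Longrightarrow> \<epsilon> z \<in> hom D (ob_map F (R z)) z"
    and ei: "\<And>z. z \<in> Obj D \<Longrightarrow> iso D (\<epsilon> z)"
    using es by metis
  have univ: "\<exists>!g. g \<in> hom C x (R y) \<and> Comp D (\<epsilon> y) (arr_map F g) = f"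
    if x: "x \<in> Obj C" and y: "y \<in> Obj D" and f: "f \<in> hom D (ob_map F x) y" for x y f
  proof -
    obtain k where k: "k \<in> hom D y (ob_map F (R y))" "Comp D k (\<epsilon> y) = Id D (ob_map F (R y))"
      "Comp D (\<epsilon> y) k = Id D y"
      by (rule isoE[OF ei[OF y] eps[OF y]])
    have eq: "Comp D (\<epsilon> y) (arr_map F g) = f \<longleftrightarrow> arr_map F g = Comp D k f"
      if g: "g \<in> hom C x (R y)" for g
    proof
      assume "Comp D (\<epsilon> y) (arr_map F g) = f"
      then have "Comp D k f = Comp D (Comp D k (\<epsilon> y)) (arr_map F g)"
        using Comp_assoc[OF D FA[OF g] eps[OF y] k(1)] by simp
      then show "arr_map F g = Comp D k f" using k(2) Comp_Id(2)[OF D FA[OF g]] by simp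
    next
      assume "arr_map F g = Comp D k f"
      then show "Comp D (\<epsilon> y) (arr_map F g) = f"
        using Comp_assoc[OF D f k(1) eps[OF y]] k(3) Comp_Id(2)[OF D f] by simp
    qed
    show ?thesis using ff[OF x R[OF y] Comp_hom[OF D f k(1)]] eq by metis
  qed
  obtain G \<eta> where G: "is_functor D C G" "nat_trans C C id_functor (comp_functor G F) \<eta>"
    "nat_trans D D (comp_functor F G) id_functor \<epsilon>"
    and tri: "\<And>x. x \<in> Obj C \<Longrightarrow> Comp D (\<epsilon> (ob_map F x)) (arr_map F (\<eta> x)) = Id D (ob_map F x)"
    by (rule universal_arrows_adjunction[OF F R eps univ]) auto
  have "iso C (\<eta> x)" if x: "x \<in> Obj C" for x
  proof -
    let ?y = "ob_map G (ob_map F x)"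
    note Fx = FO[OF x]
    have y: "?y \<in> Obj C" by (rule is_functorD(3)[OF G(1) Fx])
    have n: "\<eta> x \<in> hom C x ?y"
      using nat_transD(3)[OF G(2) x] by (simp add: id_functor_def comp_functor_def)
    have e: "\<epsilon> (ob_map F x) \<in> hom D (ob_map F ?y) (ob_map F x)"
      using nat_transD(3)[OF G(3) Fx] by (simp add: id_functor_def comp_functor_def)
    obtain k where k: "k \<in> hom D (ob_map F x) (ob_map F ?y)" "Comp D k (\<epsilon> (ob_map F x)) = Id D (ob_map F ?y)"
      by (rule isoE[OF ei[OF Fx] e])
    obtain h where h: "h \<in> hom C ?y x" "arr_map F h = \<epsilon> (ob_map F x)" using ff[OF y x e] by blast
    \<comment> \<open>The triangle identity makes \<open>arr_map F (\<eta> x)\<close> a right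
      inverse of the counit; cancelling with the inverse \<open>k\<close> identifies it with
      \<open>k\<close>.\<close>
    have "arr_map F (\<eta> x) = Comp D (Comp D k (\<epsilon> (ob_map F x))) (arr_map F (\<eta> x))"
      using Comp_Id(2)[OF D FA[OF n]] k(2) by simp
    also have "\<dots> = k"
      using Comp_assoc[OF D FA[OF n] e k(1)] tri[OF x] Comp_Id(1)[OF D k(1)] by simp
    finally have kn: "arr_map F (\<eta> x) = k" .
    have faith: "f = g" if "f \<in> hom C u v" "g \<in> hom C u v" "arr_map F f = arr_map F g" for f g u v
      using ff[OF hom_Obj[OF C that(1)] FA[OF that(1)]] that by metis
    have "Comp C h (\<eta> x) = Id C x"
      by (rule faith[OF Comp_hom[OF C n h(1)] Id_hom[OF C x]])
        (simp add: FC[OF n h(1)] h(2) tri[OF x] FI[OF x])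
    moreover have "Comp C (\<eta> x) h = Id C ?y"
      by (rule faith[OF Comp_hom[OF C h(1) n] Id_hom[OF C y]])
        (simp add: FC[OF h(1) n] h(2) kn k(2) FI[OF y])
    ultimately show ?thesis using isoI[OF n h(1)] by blast
  qed
  then show ?thesis
    unfolding equivalent_def nat_iso_def using F G ei by blast
qed

lemma cone_comp:
  assumes c: "cone J C D l \<pi>" and u: "u \<in> hom C x l" and J: "is_category J"
  shows "cone J C D x (\<lambda>j. Comp C (\<pi> j) u)"
proof -
  have D: "is_functor J C D" and p: "\<And>j. j \<in> Obj J \<Longrightarrow> \<pi> j \<in> hom C l (ob_map D j)"
    and n: "\<And>u. u \<in> Arr J \<Longrightarrow> Comp C (arr_map D u) (\<pi> (Dom J u)) = \<pi> (Cod J u)"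
    using c by (auto simp: cone_def)
  note C = is_functorD(2)[OF D]
  show ?thesis unfolding cone_def
  proof (intro conjI ballI D)
    show "x \<in> Obj C" using hom_Obj[OF C u] by blast
    fix j assume "j \<in> Obj J"
    then show "Comp C (\<pi> j) u \<in> hom C x (ob_map D j)" using Comp_hom[OF C u p] by blast
  next
    fix v assume v: "v \<in> Arr J"
    have d: "Dom J v \<in> Obj J" using J v by (auto simp: is_category_def)
    show "Comp C (arr_map D v) (Comp C (\<pi> (Dom J v)) u) = Comp C (\<pi> (Cod J v)) u"
      using Comp_assoc[OF C u p[OF d] is_functorD(4)[OF D Arr_hom[OF v]]] n[OF v] by simp
  qed
qed

section \<open>Opposite categories, full subcategories and functor categories\<close>

lemma is_category_op: "is_category C \<Longrightarrow> is_category (op_cat C)"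
  unfolding is_category_def op_cat_def hom_def by auto

lemma hom_op_cat: "hom (op_cat C) x y = hom C y x"
  by (auto simp: op_cat_def hom_def)

lemma hom_full_subcat: "hom (full_subcat C P) x y = (if x \<in> P \<and> y \<in> P then hom C x y else {})"
  by (auto simp: full_subcat_def hom_def)

lemma is_category_full_subcat:
  assumes "is_category C"
  shows "is_category (full_subcat C P)"
  using assms unfolding is_category_def full_subcat_def hom_def by auto

lemma iso_full_subcat:
  assumes "iso C f" "f \<in> hom C x y" "x \<in> P" "y \<in> P"
  shows "iso (full_subcat C P) f"
proof -
  obtain g where "g \<in> hom C y x" "Comp C g f = Id C x" "Comp C f g = Id C y"
    by (rule isoE[OF assms(1,2)])
  then show ?thesis using assms(2-4)
    by (intro isoI[of _ _ x y g]) (auto simp: hom_full_subcat, auto simp: full_subcat_def)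
qed

lemma hom_functor_cat:
  "hom (functor_cat C D) F G = {(F', \<eta>, G') | F' \<eta> G'. F' = F \<and> G' = G \<and>
     F \<in> Obj (functor_cat C D) \<and> G \<in> Obj (functor_cat C D) \<and>
     nat_trans C D F G \<eta> \<and> \<eta> \<in> extensional (Obj C)}"
  by (auto simp: hom_def functor_cat_def Let_def)

lemma Comp_functor_cat:
  "Comp (functor_cat C D) (G, \<theta>, H) (F, \<eta>, G') = (F, \<lambda>x\<in>Obj C. Comp D (\<theta> x) (\<eta> x), H)"
  "Id (functor_cat C D) F = (F, \<lambda>x\<in>Obj C. Id D (ob_map F x), F)"
  by (auto simp: functor_cat_def Let_def)

lemma Obj_functor_cat:
  "F \<in> Obj (functor_cat C D) \<longleftrightarrow> is_functor C D F \<and> ob_map F \<in> extensional (Obj C) \<and>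
                   arr_map F \<in> extensional (Arr C)"
  by (auto simp: functor_cat_def Let_def)

lemma nat_trans_Id:
  assumes F: "is_functor C D F"
  shows "nat_trans C D F F (\<lambda>x\<in>Obj C. Id D (ob_map F x))"
proof (rule nat_transI[OF F F])
  note C = is_functorD(1)[OF F] and D = is_functorD(2)[OF F]
  fix x assume "x \<in> Obj C"
  then show "(\<lambda>x\<in>Obj C. Id D (ob_map F x)) x \<in> hom D (ob_map F x) (ob_map F x)"
    using Id_hom[OF D] is_functorD(3)[OF F] by simp
next
  note C = is_functorD(1)[OF F] and D = is_functorD(2)[OF F]
  fix f x y assume f: "f \<in> hom C x y"
  show "Comp D ((\<lambda>x\<in>Obj C. Id D (ob_map F x)) y) (arr_map F f) =
    Comp D (arr_map F f) ((\<lambda>x\<in>Obj C. Id D (ob_map F x)) x)"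
    using hom_Obj[OF C f] Comp_Id[OF D is_functorD(4)[OF F f]] by simp
qed

lemma nat_trans_Comp:
  assumes n: "nat_trans C D F G \<eta>" and t: "nat_trans C D G H \<theta>"
  shows "nat_trans C D F H (\<lambda>x\<in>Obj C. Comp D (\<theta> x) (\<eta> x))"
proof (rule nat_transI[OF nat_transD(1)[OF n] nat_transD(2)[OF t]])
  note C = is_functorD(1)[OF nat_transD(1)[OF n]] and D = is_functorD(2)[OF nat_transD(1)[OF n]]
  {
    fix x assume "x \<in> Obj C"
    then show "(\<lambda>x\<in>Obj C. Comp D (\<theta> x) (\<eta> x)) x \<in> hom D (ob_map F x) (ob_map H x)"
      using Comp_hom[OF D nat_transD(3)[OF n] nat_transD(3)[OF t]] by simp
  }
  fix f x y assume f: "f \<in> hom C x y"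
  note xy = hom_Obj[OF C f]
  note Ff = is_functorD(4)[OF nat_transD(1)[OF n] f] and Gf = is_functorD(4)[OF nat_transD(1)[OF t] f]
    and Hf = is_functorD(4)[OF nat_transD(2)[OF t] f]
  note nx = nat_transD(3)[OF n xy(1)] and ny = nat_transD(3)[OF n xy(2)]
    and tx = nat_transD(3)[OF t xy(1)] and ty = nat_transD(3)[OF t xy(2)]
  have "Comp D (Comp D (\<theta> y) (\<eta> y)) (arr_map F f) = Comp D (\<theta> y) (Comp D (arr_map G f) (\<eta> x))"
    by (simp add: Comp_assoc[OF D Ff ny ty, symmetric] nat_transD(4)[OF n f])
  also have "\<dots> = Comp D (arr_map H f) (Comp D (\<theta> x) (\<eta> x))"
    by (simp add: Comp_assoc[OF D nx Gf ty] nat_transD(4)[OF t f] Comp_assoc[OF D nx tx Hf])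
  finally show "Comp D ((\<lambda>x\<in>Obj C. Comp D (\<theta> x) (\<eta> x)) y) (arr_map F f) =
      Comp D (arr_map H f) ((\<lambda>x\<in>Obj C. Comp D (\<theta> x) (\<eta> x)) x)"
    using xy by simp
qed

lemma is_category_functor_cat:
  assumes C: "is_category C" and D: "is_category D"
  shows "is_category (functor_cat C D)"
proof (rule is_categoryI)
  fix f assume "f \<in> Arr (functor_cat C D)"
  then show "Dom (functor_cat C D) f \<in> Obj (functor_cat C D) \<and>
      Cod (functor_cat C D) f \<in> Obj (functor_cat C D)"
    by (auto simp: functor_cat_def Let_def)
next
  fix F assume "F \<in> Obj (functor_cat C D)"
  then show "Id (functor_cat C D) F \<in> hom (functor_cat C D) F F"
    using nat_trans_Id[of C D F] by (auto simp: hom_functor_cat Comp_functor_cat Obj_functor_cat)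
next
  fix f g F G H assume "f \<in> hom (functor_cat C D) F G" "g \<in> hom (functor_cat C D) G H"
  then show "Comp (functor_cat C D) g f \<in> hom (functor_cat C D) F H"
    using nat_trans_Comp by (fastforce simp: hom_functor_cat Comp_functor_cat)
next
  fix f F G assume "f \<in> hom (functor_cat C D) F G"
  then obtain \<eta> where f: "f = (F, \<eta>, G)" and n: "nat_trans C D F G \<eta>" and x: "\<eta> \<in> extensional (Obj C)"
    by (auto simp: hom_functor_cat)
  have "Comp D (\<eta> x) (Id D (ob_map F x)) = \<eta> x" "Comp D (Id D (ob_map G x)) (\<eta> x) = \<eta> x"
    if "x \<in> Obj C" for x using Comp_Id[OF D nat_transD(3)[OF n that]] by auto
  then show "Comp (functor_cat C D) f (Id (functor_cat C D) F) = f \<and>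
    Comp (functor_cat C D) (Id (functor_cat C D) G) f = f"
    unfolding f Comp_functor_cat using extensional_arb[OF x]
    by (auto simp: fun_eq_iff restrict_def)
next
  fix f g h F G H K assume "f \<in> hom (functor_cat C D) F G" "g \<in> hom (functor_cat C D) G H"
    "h \<in> hom (functor_cat C D) H K"
  then obtain \<eta> \<theta> \<kappa> where e: "f = (F, \<eta>, G)" "g = (G, \<theta>, H)" "h = (H, \<kappa>, K)"
    and n: "nat_trans C D F G \<eta>" "nat_trans C D G H \<theta>" "nat_trans C D H K \<kappa>"
    by (auto simp: hom_functor_cat)
  show "Comp (functor_cat C D) h (Comp (functor_cat C D) g f) =
    Comp (functor_cat C D) (Comp (functor_cat C D) h g) f"
    unfolding e Comp_functor_cat
    using Comp_assoc[OF D nat_transD(3)[OF n(1)] nat_transD(3)[OF n(2)] nat_transD(3)[OF n(3)]]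
    by (auto intro!: restrict_ext)
qed

text \<open>Pointwise inverses of a natural transformation are natural: composing the naturality
  square with the inverses on both sides turns it around.\<close>

lemma iso_functor_cat:
  assumes h: "(F, \<eta>, G) \<in> hom (functor_cat C D) F G" and i: "\<And>x. x \<in> Obj C \<Longrightarrow> iso D (\<eta> x)"
  shows "iso (functor_cat C D) (F, \<eta>, G)"
proof -
  have n: "nat_trans C D F G \<eta>" and FG: "F \<in> Obj (functor_cat C D)" "G \<in> Obj (functor_cat C D)"
    using h by (auto simp: hom_functor_cat)
  note F = nat_transD(1)[OF n] and G = nat_transD(2)[OF n]
  note C = is_functorD(1)[OF F] and D = is_functorD(2)[OF F]
  have "\<exists>g. g \<in> hom D (ob_map G x) (ob_map F x) \<and> Comp D g (\<eta> x) = Id D (ob_map F x) \<and>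
      Comp D (\<eta> x) g = Id D (ob_map G x)" if x: "x \<in> Obj C" for x
    using isoE[OF i[OF x] nat_transD(3)[OF n x]] by blast
  then obtain \<theta> where t: "\<And>x. x \<in> Obj C \<Longrightarrow> \<theta> x \<in> hom D (ob_map G x) (ob_map F x)"
    "\<And>x. x \<in> Obj C \<Longrightarrow> Comp D (\<theta> x) (\<eta> x) = Id D (ob_map F x)"
    "\<And>x. x \<in> Obj C \<Longrightarrow> Comp D (\<eta> x) (\<theta> x) = Id D (ob_map G x)" by metis
  \<comment> \<open>The restriction is forced because arrows of a functor category are
    \<open>undefined\<close> off the objects of \<open>C\<close>.\<close>
  let ?t = "restrict \<theta> (Obj C)"
  have "nat_trans C D G F ?t"
  proof (rule nat_transI[OF G F])
    fix f x y assume f: "f \<in> hom C x y"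
    note xy = hom_Obj[OF C f]
    note Ff = is_functorD(4)[OF F f] and Gf = is_functorD(4)[OF G f]
    note nx = nat_transD(3)[OF n xy(1)] and ny = nat_transD(3)[OF n xy(2)]
    note tx = t(1)[OF xy(1)] and ty = t(1)[OF xy(2)]
    note Ft = Comp_hom[OF D tx Ff]
    have "Comp D (arr_map F f) (\<theta> x) = Comp D (Comp D (\<theta> y) (\<eta> y)) (Comp D (arr_map F f) (\<theta> x))"
      using t(2)[OF xy(2)] Comp_Id(2)[OF D Ft] by simp
    also have "\<dots> = Comp D (\<theta> y) (Comp D (Comp D (\<eta> y) (arr_map F f)) (\<theta> x))"
      by (simp add: Comp_assoc[OF D Ft ny ty, symmetric] Comp_assoc[OF D tx Ff ny])
    also have "\<dots> = Comp D (\<theta> y) (Comp D (arr_map G f) (Comp D (\<eta> x) (\<theta> x)))"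
      by (simp add: nat_transD(4)[OF n f] Comp_assoc[OF D tx nx Gf])
    also have "\<dots> = Comp D (\<theta> y) (arr_map G f)"
      by (simp add: t(3)[OF xy(1)] Comp_Id(1)[OF D Gf])
    finally show "Comp D (?t y) (arr_map G f) = Comp D (arr_map F f) (?t x)" using xy by simp
  qed (use t in auto)
  then have "(G, ?t, F) \<in> hom (functor_cat C D) G F"
    using FG by (simp add: hom_functor_cat)
  then show ?thesis
    by (rule isoI[OF h]) (auto simp: Comp_functor_cat t intro!: restrict_ext)
qed

section \<open>Concrete categories and the category of small sets\<close>

lemma hom_concrete_cat:
  "hom (concrete_cat Ob c H) A B = {(A', f, B') | A' f B'. A' = A \<and> B' = B \<and>
    A \<in> Ob \<and> B \<in> Ob \<and> f \<in> c A \<rightarrow>\<^sub>E c B \<and> f \<in> H A B}"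
  by (auto simp: hom_def concrete_cat_def)

lemma concrete_cat_simps:
  "Obj (concrete_cat Ob c H) = Ob"
  "Dom (concrete_cat Ob c H) (A, f, B) = A"
  "Cod (concrete_cat Ob c H) (A, f, B) = B"
  "Id (concrete_cat Ob c H) A = (A, \<lambda>x\<in>c A. x, A)"
  "Comp (concrete_cat Ob c H) (B, g, Z) (A, f, B') = (A, compose (c A) g f, Z)"
  by (auto simp: concrete_cat_def)

lemma is_category_concrete_cat:
  assumes "\<And>A. A \<in> Ob \<Longrightarrow> (\<lambda>x\<in>c A. x) \<in> H A A"
    and comp: "\<And>A B Z f g. A \<in> Ob \<Longrightarrow> B \<in> Ob \<Longrightarrow> Z \<in> Ob \<Longrightarrow> f \<in> c A \<rightarrow>\<^sub>E c B \<Longrightarrow> g \<in> c B \<rightarrow>\<^sub>E c Z \<Longrightarrow>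
      f \<in> H A B \<Longrightarrow> g \<in> H B Z \<Longrightarrow> compose (c A) g f \<in> H A Z"
  shows "is_category (concrete_cat Ob c H)"
proof (rule is_categoryI)
  fix f g A B Z assume "f \<in> hom (concrete_cat Ob c H) A B" "g \<in> hom (concrete_cat Ob c H) B Z"
  then show "Comp (concrete_cat Ob c H) g f \<in> hom (concrete_cat Ob c H) A Z"
    using comp by (auto simp: hom_concrete_cat concrete_cat_simps compose_def PiE_def Pi_def)
next
  fix f g h A B Z W assume "f \<in> hom (concrete_cat Ob c H) A B" "g \<in> hom (concrete_cat Ob c H) B Z"
    "h \<in> hom (concrete_cat Ob c H) Z W"
  then show "Comp (concrete_cat Ob c H) h (Comp (concrete_cat Ob c H) g f) =
      Comp (concrete_cat Ob c H) (Comp (concrete_cat Ob c H) h g) f"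
    by (auto simp: hom_concrete_cat concrete_cat_simps intro!: compose_assoc simp: PiE_def)
next
  fix f A B assume "f \<in> hom (concrete_cat Ob c H) A B"
  then show "Comp (concrete_cat Ob c H) f (Id (concrete_cat Ob c H) A) = f \<and>
    Comp (concrete_cat Ob c H) (Id (concrete_cat Ob c H) B) f = f"
    by (auto simp: hom_concrete_cat concrete_cat_simps PiE_def compose_Id Id_compose)
next
  fix A assume "A \<in> Obj (concrete_cat Ob c H)"
  then show "Id (concrete_cat Ob c H) A \<in> hom (concrete_cat Ob c H) A A"
    using assms(1) by (auto simp: hom_concrete_cat concrete_cat_simps)
qed (auto simp: concrete_cat_def)

lemma is_category_set_cat: "is_category (set_cat U)"
  unfolding set_cat_def by (rule is_category_concrete_cat) auto

lemma hom_set_cat: "(A', f, B') \<in> hom (set_cat U) A B \<longleftrightarrow> A' = A \<and> B' = B \<and> A \<in> U \<and> B \<in> U \<and> f \<in> A \<rightarrow>\<^sub>E B"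
  by (auto simp: set_cat_def hom_concrete_cat)

lemma hom_set_catE:
  assumes "g \<in> hom (set_cat U) A B"
  obtains f where "g = (A, f, B)" "A \<in> U" "B \<in> U" "f \<in> A \<rightarrow>\<^sub>E B"
  using assms by (auto simp: set_cat_def hom_concrete_cat)

lemma set_cat_simps:
  "Obj (set_cat U) = U"
  "Id (set_cat U) A = (A, \<lambda>x\<in>A. x, A)"
  "Comp (set_cat U) (B, g, Z) (A, f, B') = (A, compose A g f, Z)"
  by (simp_all add: set_cat_def concrete_cat_simps)

lemma iso_set_cat:
  assumes "A \<in> U" "B \<in> U" "f \<in> A \<rightarrow>\<^sub>E B"
  shows "iso (set_cat U) (A, f, B) \<longleftrightarrow> bij_betw f A B"
proof
  have hm: "(A, f, B) \<in> hom (set_cat U) A B"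
    using assms by (simp add: set_cat_def hom_concrete_cat)
  {
    assume "iso (set_cat U) (A, f, B)"
    then obtain k where "k \<in> hom (set_cat U) B A" "Comp (set_cat U) k (A, f, B) = Id (set_cat U) A"
      "Comp (set_cat U) (A, f, B) k = Id (set_cat U) B"
      by (rule isoE[OF _ hm])
    then obtain g where g: "g \<in> B \<rightarrow>\<^sub>E A" "compose A g f = (\<lambda>x\<in>A. x)" "compose B f g = (\<lambda>x\<in>B. x)"
      by (auto simp: set_cat_def hom_concrete_cat concrete_cat_simps)
    show "bij_betw f A B"
    proof (rule bij_betw_byWitness[where f' = g])
      show "\<forall>a\<in>A. g (f a) = a" using g(2) by (metis compose_eq restrict_apply')
      show "\<forall>b\<in>B. f (g b) = b" using g(3) by (metis compose_eq restrict_apply')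
    qed (use g assms in auto)
  next
    assume b: "bij_betw f A B"
    let ?g = "restrict (inv_into A f) B"
    have "(B, ?g, A) \<in> hom (set_cat U) B A"
      using assms bij_betw_imp_surj_on[OF b]
      by (auto simp: set_cat_def hom_concrete_cat intro!: inv_into_into)
    then show "iso (set_cat U) (A, f, B)"
      by (rule isoI[OF hm])
        (use compose_inv_into_id[OF b] compose_id_inv_into[of f A B] bij_betw_imp_surj_on[OF b] in
         \<open>auto simp: set_cat_def concrete_cat_simps\<close>)
  }
qed

section \<open>Small sets\<close>

text \<open>The set \<open>A\<close> may live on another type than the universe, so closure under
  \<open>\<lesssim>\<close> is applied to its image in a member of \<open>U\<close>.\<close>

lemma small_lepoll:
  assumes U: "regular_universe U" and AB: "A \<lesssim> B" and B: "small U B"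
  shows "small U A"
proof -
  obtain V where V: "V \<in> U" "B \<approx> V" using B unfolding small_def by blast
  obtain f where f: "inj_on f A" "f ` A \<subseteq> V"
    using lepoll_trans2[OF AB V(2)] unfolding lepoll_def by blast
  then have "f ` A \<lesssim> V" by (intro subset_imp_lepoll)
  then have "f ` A \<in> U" using U V(1) unfolding regular_universe_def by blast
  moreover have "A \<approx> f ` A" using f(1) inj_on_image_eqpoll_self eqpoll_sym by blast
  ultimately show ?thesis unfolding small_def by blast
qed

lemma small_in: "A \<in> U \<Longrightarrow> small U A"
  unfolding small_def by auto

lemma small_subset: "regular_universe U \<Longrightarrow> small U B \<Longrightarrow> A \<subseteq> B \<Longrightarrow> small U A"
  by (rule small_lepoll[OF _ subset_imp_lepoll])

lemma small_image: "regular_universe U \<Longrightarrow> small U A \<Longrightarrow> small U (f ` A)"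
  by (rule small_lepoll[OF _ image_lepoll])

lemma small_in_U:
  assumes "regular_universe U" "small U A"
  shows "A \<in> U"
  using assms eqpoll_imp_lepoll unfolding small_def regular_universe_def by blast

lemma smallE:
  assumes "small U A"
  obtains f where "inj_on f A" "f ` A \<in> U"
  using assms unfolding small_def eqpoll_def bij_betw_def by blast

text \<open>Regularity speaks only of members of \<open>U\<close>, so the index set and all fibres
  are first embedded in \<open>'u\<close>, and the sum is compared with the sum of the
  images.\<close>

lemma small_Sigma:
  assumes U: "regular_universe U" and I: "small U I" and X: "\<And>i. i \<in> I \<Longrightarrow> small U (X i)"
  shows "small U (SIGMA i:I. X i)"
proof -
  obtain f where f: "inj_on f I" "f ` I \<in> U" by (rule smallE[OF I])
  have "\<exists>g. inj_on g (X i) \<and> g ` X i \<in> U" if "i \<in> I" for i using smallE[OF X[OF that]] by blast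
  then obtain g where g: "\<And>i. i \<in> I \<Longrightarrow> inj_on (g i) (X i)" "\<And>i. i \<in> I \<Longrightarrow> g i ` X i \<in> U" by metis
  let ?Y = "\<lambda>j. g (inv_into I f j) ` X (inv_into I f j)"
  have "small U (SIGMA j:f ` I. ?Y j)"
    using U f g(2) unfolding regular_universe_def by (auto simp: inv_into_into)
  moreover have "(SIGMA i:I. X i) \<lesssim> (SIGMA j:f ` I. ?Y j)"
    unfolding lepoll_def
    by (rule exI[of _ "\<lambda>(i, x). (f i, g i x)"])
      (use f(1) g(1) in \<open>auto simp: inj_on_def inv_into_f_f\<close>)
  ultimately show ?thesis using small_lepoll[OF U] by blast
qed

lemma small_Times:
  "regular_universe U \<Longrightarrow> small U A \<Longrightarrow> small U B \<Longrightarrow> small U (A \<times> B)"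
  by (rule small_Sigma)

lemma small_finite:
  assumes U: "regular_universe U" and A: "finite A"
  shows "small U A"
proof -
  obtain B where B: "B \<in> U" "infinite B" using U unfolding regular_universe_def by blast
  have "A \<lesssim> B" by (rule finite_lepoll_infinite[OF B(2) A])
  then show ?thesis by (rule small_lepoll[OF U _ small_in[OF B(1)]])
qed

text \<open>The functions that single out one point of \<open>S\<close>, with values among two
  elements of an infinite member of \<open>U\<close>, embed \<open>S\<close> into an
  exponent.\<close>

lemma small_if_exponent:
  assumes U: "regular_universe U" and S: "closed_under_exponent U S"
  shows "small U S"
proof -
  obtain B where B: "B \<in> U" "infinite B" using U unfolding regular_universe_def by blast
  obtain a where a: "a \<in> B" using B(2) by (metis ex_in_conv finite.emptyI)
  obtain b where "b \<in> B - {a}" using B(2) by (metis ex_in_conv finite.emptyI infinite_remove)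
  with a have ab: "a \<in> B" "b \<in> B" "a \<noteq> b" by auto
  have "inj_on (\<lambda>m. \<lambda>n\<in>S. if n = m then a else b) S"
    using ab(3) by (auto simp: inj_on_def fun_eq_iff restrict_def split: if_splits)
  moreover have "(\<lambda>m. \<lambda>n\<in>S. if n = m then a else b) ` S \<subseteq> S \<rightarrow>\<^sub>E B" using ab by auto
  ultimately have "S \<lesssim> (S \<rightarrow>\<^sub>E B)" unfolding lepoll_def by blast
  then show ?thesis
    using small_lepoll[OF U] S B(1) unfolding closed_under_exponent_def by blast
qed


section \<open>Continuous actions\<close>

locale cont_monoid =
  fixes U :: "'u set set" and \<tau> :: "'m::monoid_mult topology"
  assumes space: "topspace \<tau> = UNIV"
    and U: "regular_universe U"
    and expU: "closed_under_exponent U (UNIV :: 'm set)"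
begin

abbreviation E where "E \<equiv> Cont U \<tau>"

text \<open>Since \<open>X\<close> is discrete, joint continuity of the action means that each orbit
  map \<open>n \<mapsto> a x n\<close> is locally constant. Only the attained values
  \<open>a x k\<close> have to be considered, the other fibres being empty.\<close>

lemma continuous_mset_iff:
  "continuous_mset \<tau> (X, a) \<longleftrightarrow> a \<in> extensional X \<and>
     (\<forall>x\<in>X. \<forall>m. a x m \<in> X) \<and> (\<forall>x\<in>X. a x 1 = x) \<and>
     (\<forall>x\<in>X. \<forall>m n. a x (m * n) = a (a x m) n) \<and>
     (\<forall>x\<in>X. \<forall>k. openin \<tau> {n. a x n = a x k})"
proof -
  have "continuous_map (prod_topology (discrete_topology X) \<tau>) (discrete_topology X) (\<lambda>(x, m). a x m)
    \<longleftrightarrow> (\<forall>x\<in>X. \<forall>k. openin \<tau> {n. a x n = a x k})" (is "?L \<longleftrightarrow> ?R")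
    if cl: "\<And>x m. x \<in> X \<Longrightarrow> a x m \<in> X"
  proof
    assume c: ?L
    show ?R
    proof (intro ballI allI)
      fix x k assume x: "x \<in> X"
      have "continuous_map \<tau> (prod_topology (discrete_topology X) \<tau>) (\<lambda>m. (x, m))"
        using x by (auto simp: continuous_map_pairwise o_def)
      from continuous_map_compose[OF this c]
      have "continuous_map \<tau> (discrete_topology X) (\<lambda>m. a x m)" by (simp add: o_def)
      from openin_continuous_map_preimage[OF this, of "{a x k}"]
      show "openin \<tau> {n. a x n = a x k}" using cl[OF x] by (simp add: space)
    qed
  next
    assume r: ?R
    show ?L
      unfolding continuous_map_def
    proof (intro conjI allI impI)
      fix V assume "openin (discrete_topology X) V"
      \<comment> \<open>The preimage is a union of rectangles, a point of \<open>X\<close> times a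
        fibre of its orbit map.\<close>
      have "{p \<in> X \<times> UNIV. (case p of (x, m) \<Rightarrow> a x m) \<in> V}
        = (\<Union>(x, k)\<in>{p \<in> X \<times> UNIV. (case p of (x, m) \<Rightarrow> a x m) \<in> V}. {x} \<times> {n. a x n = a x k})"
        by auto
      moreover have "openin (prod_topology (discrete_topology X) \<tau>) \<dots>"
        using r by (intro openin_Union) (auto simp: openin_prod_Times_iff)
      ultimately show "openin (prod_topology (discrete_topology X) \<tau>)
          {p \<in> topspace (prod_topology (discrete_topology X) \<tau>). (case p of (x, m) \<Rightarrow> a x m) \<in> V}"
        by (simp add: space)
    qed (use cl in auto)
  qed
  then show ?thesis unfolding continuous_mset_def right_mset_def by auto
qed

lemma Obj_Cont: "A \<in> Obj E \<longleftrightarrow> fst A \<in> U \<and> continuous_mset \<tau> A"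
  by (simp add: Cont_def concrete_cat_simps)

lemma Obj_ContD:
  assumes "A \<in> Obj E"
  shows "fst A \<in> U" "snd A \<in> extensional (fst A)"
    and "x \<in> fst A \<Longrightarrow> snd A x m \<in> fst A"
    and "x \<in> fst A \<Longrightarrow> snd A x 1 = x"
    and "x \<in> fst A \<Longrightarrow> snd A x (m * n) = snd A (snd A x m) n"
    and "x \<in> fst A \<Longrightarrow> openin \<tau> {n. snd A x n = snd A x k}"
  using assms continuous_mset_iff[of "fst A" "snd A"] unfolding Obj_Cont by auto

lemma hom_Cont_iff:
  "(A', f, B') \<in> hom E A B \<longleftrightarrow> A' = A \<and> B' = B \<and> A \<in> Obj E \<and> B \<in> Obj E \<and>
     f \<in> fst A \<rightarrow>\<^sub>E fst B \<and> (\<forall>x\<in>fst A. \<forall>m. f (snd A x m) = snd B (f x) m)"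
  unfolding Cont_def
  by (cases A; cases B) (auto simp: hom_concrete_cat concrete_cat_simps equivariant_def)

lemma hom_ContD:
  assumes "(A, f, B) \<in> hom E A B"
  shows "A \<in> Obj E" "B \<in> Obj E" "f \<in> extensional (fst A)"
    and "x \<in> fst A \<Longrightarrow> f x \<in> fst B"
    and "x \<in> fst A \<Longrightarrow> f (snd A x m) = snd B (f x) m"
  using assms by (auto simp: hom_Cont_iff PiE_def)

lemma hom_ContE:
  assumes "g \<in> hom E A B"
  obtains f where "g = (A, f, B)" "(A, f, B) \<in> hom E A B"
  using assms by (cases g) (auto simp: hom_Cont_iff)

lemma hom_Cont_eq:
  assumes "(A, f, B) \<in> hom E A B" "(A, g, B) \<in> hom E A B" "\<And>x. x \<in> fst A \<Longrightarrow> f x = g x"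
  shows "f = g"
  using assms by (intro extensionalityI[of f "fst A" g]) (auto dest: hom_ContD(3))

lemma Comp_Cont: "Comp E (B, g, Z) (A, f, B') = (A, compose (fst A) g f, Z)"
  by (simp add: Cont_def concrete_cat_simps)

lemma Id_Cont: "Id E A = (A, \<lambda>x\<in>fst A. x, A)"
  by (simp add: Cont_def concrete_cat_simps)

lemma is_category_Cont: "is_category E"
  unfolding Cont_def
proof (rule is_category_concrete_cat)
  fix A assume "A \<in> {A. fst A \<in> U \<and> continuous_mset \<tau> A}"
  then have "A \<in> Obj E" by (simp add: Obj_Cont)
  then show "(\<lambda>x\<in>fst A. x) \<in> {f. equivariant A A f}"
    using Obj_ContD(3) by (auto simp: equivariant_def case_prod_beta)
next
  fix A B Z f g
  assume "A \<in> {A. fst A \<in> U \<and> continuous_mset \<tau> A}" "f \<in> fst A \<rightarrow>\<^sub>E fst B" "g \<in> fst B \<rightarrow>\<^sub>E fst Z"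
    and eq: "f \<in> {f. equivariant A B f}" "g \<in> {f. equivariant B Z f}"
  then have A: "A \<in> Obj E" and f: "f \<in> fst A \<rightarrow> fst B" by (auto simp: Obj_Cont)
  show "compose (fst A) g f \<in> {f. equivariant A Z f}"
    using eq Obj_ContD(3)[OF A] f by (auto simp: equivariant_def case_prod_beta compose_def)
qed

lemma iso_Cont:
  assumes h: "(A, f, B) \<in> hom E A B"
  shows "iso E (A, f, B) \<longleftrightarrow> bij_betw f (fst A) (fst B)"
proof
  assume "iso E (A, f, B)"
  then obtain k where k: "k \<in> hom E B A" "Comp E k (A, f, B) = Id E A" "Comp E (A, f, B) k = Id E B"
    by (rule isoE[OF _ h])
  obtain g where kg: "k = (B, g, A)" and g1: "(B, g, A) \<in> hom E B A" by (rule hom_ContE[OF k(1)])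
  have g: "(B, g, A) \<in> hom E B A" "compose (fst A) g f = (\<lambda>x\<in>fst A. x)"
      "compose (fst B) f g = (\<lambda>x\<in>fst B. x)"
    using g1 k(2,3) by (auto simp: kg Comp_Cont Id_Cont)
  show "bij_betw f (fst A) (fst B)"
  proof (rule bij_betw_byWitness[where f' = g])
    show "\<forall>a\<in>fst A. g (f a) = a" using g(2) by (metis compose_eq restrict_apply')
    show "\<forall>b\<in>fst B. f (g b) = b" using g(3) by (metis compose_eq restrict_apply')
  qed (use hom_ContD(4)[OF h] hom_ContD(4)[OF g(1)] in auto)
next
  assume b: "bij_betw f (fst A) (fst B)"
  let ?g = "restrict (inv_into (fst A) f) (fst B)"
  have fg: "f (?g y) = y" "?g y \<in> fst A" if "y \<in> fst B" for y
    using that bij_betw_inv_into_right[OF b] bij_betw_imp_surj_on[OF b] by (auto intro: inv_into_into)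
  have gf: "?g (f x) = x" if "x \<in> fst A" for x
    using that bij_betw_inv_into_left[OF b] hom_ContD(4)[OF h] by simp
  note A = hom_ContD(1)[OF h] and B = hom_ContD(2)[OF h]
  have "?g (snd B y m) = snd A (?g y) m" if y: "y \<in> fst B" for y m
  proof -
    have "f (snd A (?g y) m) = snd B y m" using hom_ContD(5)[OF h fg(2)[OF y]] fg(1)[OF y] by simp
    then show ?thesis using gf[OF Obj_ContD(3)[OF A fg(2)[OF y]]] by metis
  qed
  then have "(B, ?g, A) \<in> hom E B A" using A B fg(2) by (auto simp: hom_Cont_iff)
  then show "iso E (A, f, B)"
    by (rule isoI[OF h])
      (use fg gf hom_ContD(4)[OF h] in \<open>auto simp: Comp_Cont Id_Cont compose_def intro!: restrict_ext\<close>)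
qed

text \<open>Objects of \<open>E\<close> have carriers in \<open>U\<close>, whereas quotients, glued
  copies and sets of functions live on other types. An injection into \<open>'u\<close> carries such
  an action to an isomorphic object.\<close>

lemma Obj_transport:
  assumes c: "continuous_mset \<tau> (Q, a)" and s: "small U Q"
  obtains A \<beta> where "A \<in> Obj E" "bij_betw \<beta> Q (fst A)"
    "\<And>q m. q \<in> Q \<Longrightarrow> snd A (\<beta> q) m = \<beta> (a q m)"
proof -
  obtain \<beta> where b: "inj_on \<beta> Q" "\<beta> ` Q \<in> U" by (rule smallE[OF s])
  note cc = c[unfolded continuous_mset_iff]
  let ?a = "\<lambda>y\<in>\<beta> ` Q. \<lambda>m. \<beta> (a (inv_into Q \<beta> y) m)"
  have act: "?a (\<beta> q) m = \<beta> (a q m)" if "q \<in> Q" for q m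
    using that b(1) by simp
  have "continuous_mset \<tau> (\<beta> ` Q, ?a)"
    unfolding continuous_mset_iff ball_simps
  proof (intro conjI ballI allI)
    fix q k assume q: "q \<in> Q"
    have "{n. ?a (\<beta> q) n = ?a (\<beta> q) k} = {n. a q n = a q k}"
      unfolding act[OF q] using q cc inj_on_eq_iff[OF b(1)] by metis
    then show "openin \<tau> {n. ?a (\<beta> q) n = ?a (\<beta> q) k}" using cc q by simp
  qed (use cc act in simp_all)
  then have "(\<beta> ` Q, ?a) \<in> Obj E" using b(2) by (simp add: Obj_Cont)
  then show ?thesis
    by (rule that[of _ \<beta>]) (use b(1) act in \<open>auto simp: bij_betw_def\<close>)
qed

text \<open>An open right congruence, encoded by a choice of one representative in each class. The
  first law says both that \<open>\<rho>\<close> is idempotent (take \<open>n = 1\<close>) and that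
  its kernel is stable under right multiplication. In the second, the set is a fibre of the orbit
  map of the class of \<open>k\<close>, so ranging over all \<open>k\<close> expresses continuity of
  the quotient action and not merely openness of the classes.\<close>

definition open_rep :: "('m \<Rightarrow> 'm) \<Rightarrow> bool" where
  "open_rep \<rho> \<longleftrightarrow> (\<forall>m n. \<rho> (m * n) = \<rho> (\<rho> m * n)) \<and> (\<forall>k p. openin \<tau> {n. \<rho> (k * n) = p})"

lemma open_repD:
  assumes "open_rep \<rho>"
  shows "\<rho> (\<rho> m * n) = \<rho> (m * n)" "\<rho> (\<rho> m) = \<rho> m" "openin \<tau> {n. \<rho> (k * n) = p}"
    "openin \<tau> {n. \<rho> n = p}"
proof -
  show 1: "\<rho> (\<rho> m * n) = \<rho> (m * n)" for m n using assms unfolding open_rep_def by simp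
  show "\<rho> (\<rho> m) = \<rho> m" using 1[of m 1] by simp
  show 2: "openin \<tau> {n. \<rho> (k * n) = p}" for k p using assms unfolding open_rep_def by blast
  show "openin \<tau> {n. \<rho> n = p}" using 2[of 1 p] by simp
qed

text \<open>Choosing representatives turns the kernel of any such \<open>\<phi>\<close> into an
  \<open>open_rep\<close>. With \<open>\<phi>\<close> an orbit map, or a tuple of orbit maps, this
  yields kernels of points and their finite intersections.\<close>

lemma ex_open_rep:
  fixes \<phi> :: "'m \<Rightarrow> 'x"
  assumes cong: "\<And>m n k. \<phi> m = \<phi> n \<Longrightarrow> \<phi> (m * k) = \<phi> (n * k)"
    and op: "\<And>k l. openin \<tau> {n. \<phi> (k * n) = \<phi> (k * l)}"
  obtains \<rho> where "open_rep \<rho>" "\<And>m n. \<rho> m = \<rho> n \<longleftrightarrow> \<phi> m = \<phi> n"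
proof -
  define \<rho> where "\<rho> m = (SOME n. \<phi> n = \<phi> m)" for m
  have r: "\<phi> (\<rho> m) = \<phi> m" for m unfolding \<rho>_def by (rule someI[of _ m]) simp
  have eq: "\<rho> m = \<rho> n \<longleftrightarrow> \<phi> m = \<phi> n" for m n
  proof
    assume "\<rho> m = \<rho> n"
    then show "\<phi> m = \<phi> n" using r by metis
  qed (simp add: \<rho>_def)
  \<comment> \<open>Openness is given at attained values; for any other \<open>p\<close> the set is
    empty.\<close>
  have "openin \<tau> {n. \<rho> (k * n) = p}" for k p
  proof (cases "\<exists>l. \<rho> (k * l) = p")
    case True
    then obtain l where l: "p = \<rho> (k * l)" by blast
    show ?thesis unfolding l eq by (rule op)
  next
    case False
    then show ?thesis by simp
  qed
  then have "open_rep \<rho>" unfolding open_rep_def eq using cong r by metis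
  then show ?thesis using that eq by blast
qed

lemma open_rep_element:
  assumes A: "A \<in> Obj E" and x: "x \<in> fst A"
  obtains \<rho> where "open_rep \<rho>" "\<And>m n. \<rho> m = \<rho> n \<longleftrightarrow> snd A x m = snd A x n"
  by (rule ex_open_rep[of "snd A x"]) 
    (use Obj_ContD[OF A] x in auto)

lemma small_M: "small U (UNIV :: 'm set)"
  by (rule small_if_exponent[OF U expU])

text \<open>The quotient by the congruence is carried by the representatives, \<open>m\<close>
  sending \<open>p\<close> to \<open>\<rho> (p * m)\<close>, and is generated by
  \<open>\<rho> 1\<close>, the class of the unit.\<close>

lemma cyclic_object:
  assumes r: "open_rep \<rho>"
  obtains Q q where "Q \<in> Obj E" "q \<in> fst Q" "\<And>x. x \<in> fst Q \<Longrightarrow> \<exists>m. x = snd Q q m"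
    "\<And>m n. snd Q q m = snd Q q n \<longleftrightarrow> \<rho> m = \<rho> n"
proof -
  let ?a = "\<lambda>p\<in>range \<rho>. \<lambda>m. \<rho> (p * m)"
  have "continuous_mset \<tau> (range \<rho>, ?a)"
    unfolding continuous_mset_iff
    by (auto simp: open_repD[OF r] mult.assoc)
  moreover have "small U (range \<rho>)" by (rule small_image[OF U small_M])
  ultimately obtain Q \<beta> where Q: "Q \<in> Obj E" "bij_betw \<beta> (range \<rho>) (fst Q)"
    "\<And>q m. q \<in> range \<rho> \<Longrightarrow> snd Q (\<beta> q) m = \<beta> (?a q m)"
    by (rule Obj_transport) blast
  have act: "snd Q (\<beta> (\<rho> 1)) m = \<beta> (\<rho> m)" for m
    using Q(3)[of "\<rho> 1" m] by (simp add: open_repD[OF r])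
  show ?thesis
    by (rule that[of Q "\<beta> (\<rho> 1)"])
      (use Q(1,2) in \<open>auto simp: act bij_betw_def inj_on_eq_iff\<close>)
qed

text \<open>The map sends \<open>snd Q q m\<close> to \<open>snd A x m\<close>; this is independent
  of \<open>m\<close> because the kernel of \<open>q\<close> is contained in that of
  \<open>x\<close>.\<close>

lemma cyclic_hom:
  assumes Q: "Q \<in> Obj E" "q \<in> fst Q" "\<And>x. x \<in> fst Q \<Longrightarrow> \<exists>m. x = snd Q q m"
    and A: "A \<in> Obj E" "x \<in> fst A" "\<And>m n. snd Q q m = snd Q q n \<Longrightarrow> snd A x m = snd A x n"
  obtains f where "(Q, f, A) \<in> hom E Q A" "f q = x"
proof -
  obtain k where k: "\<And>y. y \<in> fst Q \<Longrightarrow> y = snd Q q (k y)" using Q(3) by metis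
  let ?f = "\<lambda>y\<in>fst Q. snd A x (k y)"
  have f: "?f (snd Q q m) = snd A x m" for m
  proof -
    note mem = Obj_ContD(3)[OF Q(1,2), of m]
    have "snd A x (k (snd Q q m)) = snd A x m" by (rule A(3)) (rule k[OF mem, symmetric])
    then show ?thesis using mem by simp
  qed
  have "?f (snd Q y m) = snd A (?f y) m" if y: "y \<in> fst Q" for y m
  proof -
    have "snd Q y m = snd Q q (k y * m)"
      using k[OF y] Obj_ContD(5)[OF Q(1,2)] by metis
    then show ?thesis using f[of "k y * m"] y Obj_ContD(5)[OF A(1,2)] by simp
  qed
  moreover have "?f \<in> fst Q \<rightarrow>\<^sub>E fst A" using Obj_ContD(3)[OF A(1,2)] by auto
  ultimately have "(Q, ?f, A) \<in> hom E Q A"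
    unfolding hom_Cont_iff using Q(1) A(1) by blast
  moreover have "?f q = x" using f[of 1] Obj_ContD(4)[OF Q(1,2)] Obj_ContD(4)[OF A(1,2)] by simp
  ultimately show ?thesis by (rule that)
qed

lemma cyclic_hom_eq:
  assumes "(Q, f, A) \<in> hom E Q A" "(Q, g, A) \<in> hom E Q A" "q \<in> fst Q"
    "\<And>x. x \<in> fst Q \<Longrightarrow> \<exists>m. x = snd Q q m" "f q = g q"
  shows "f = g"
  by (rule hom_Cont_eq[OF assms(1,2)])
    (metis assms(3-5) hom_ContD(5)[OF assms(1)] hom_ContD(5)[OF assms(2)])


section \<open>Supercompact generation and two-valuedness\<close>

lemma surj_epi:
  assumes h: "(A, f, B) \<in> hom E A B" and s: "f ` fst A = fst B"
  shows "epi_arr E (A, f, B)"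
  unfolding epi_arr_def
proof (intro conjI ballI impI)
  show "(A, f, B) \<in> Arr E" by (rule homD(1)[OF h])
  fix g h' assume g: "g \<in> Arr E" and h': "h' \<in> Arr E"
    and eq: "Dom E g = Cod E (A, f, B) \<and> Dom E h' = Cod E (A, f, B) \<and> Cod E g = Cod E h' \<and>
      Comp E g (A, f, B) = Comp E h' (A, f, B)"
  have B: "Cod E (A, f, B) = B" by (rule homD(3)[OF h])
  have hg: "g \<in> hom E B (Cod E g)" "h' \<in> hom E B (Cod E g)"
    using Arr_hom[OF g] Arr_hom[OF h'] eq B by simp_all
  obtain u where u: "g = (B, u, Cod E g)" "(B, u, Cod E g) \<in> hom E B (Cod E g)"
    by (rule hom_ContE[OF hg(1)])
  obtain v where v: "h' = (B, v, Cod E g)" "(B, v, Cod E g) \<in> hom E B (Cod E g)"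
    by (rule hom_ContE[OF hg(2)])
  have "Comp E (B, u, Cod E g) (A, f, B) = Comp E (B, v, Cod E g) (A, f, B)"
    using eq u(1) v(1) by metis
  then have c: "compose (fst A) u f = compose (fst A) v f" by (simp add: Comp_Cont)
  have "u = v"
  proof (rule hom_Cont_eq[OF u(2) v(2)])
    fix y assume "y \<in> fst B"
    then obtain x where "x \<in> fst A" "y = f x" using s by blast
    then show "u y = v y" using fun_cong[OF c, of x] by (simp add: compose_def)
  qed
  then show "g = h'" using u(1) v(1) by metis
qed

text \<open>A point outside the union \<open>Z\<close> of the images would be separated by the two inclusions of
  the codomain into the object obtained by gluing two copies of it along \<open>Z\<close>.\<close>

lemma jointly_epic_surj:
  assumes S: "jointly_epic E A S" and A: "A \<in> Obj E" and x: "x \<in> fst A"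
  obtains B f b where "(B, f, A) \<in> S" "(B, f, A) \<in> hom E B A" "b \<in> fst B" "f b = x"
proof -
  have Sh: "\<exists>B f. g = (B, f, A) \<and> (B, f, A) \<in> hom E B A" if "g \<in> S" for g
  proof -
    have "g \<in> hom E (Dom E g) A" using S that unfolding jointly_epic_def hom_def by auto
    then show ?thesis by (metis hom_ContE)
  qed
  define Z where "Z = {f b |B f b. (B, f, A) \<in> S \<and> (B, f, A) \<in> hom E B A \<and> b \<in> fst B}"
  have Zm: "snd A z m \<in> Z" if zZ: "z \<in> Z" for z m
  proof -
    obtain B f b where b: "z = f b" "(B, f, A) \<in> S" "(B, f, A) \<in> hom E B A" "b \<in> fst B"
      using zZ unfolding Z_def by blast
    have "snd A z m = f (snd B b m)" using hom_ContD(5)[OF b(3,4)] b(1) by simp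
    moreover have "snd B b m \<in> fst B" by (rule Obj_ContD(3)[OF hom_ContD(1)[OF b(3)] b(4)])
    ultimately show ?thesis using b(2,3) unfolding Z_def by blast
  qed
  note AD = Obj_ContD[OF A]
  \<comment> \<open>Two copies of the carrier, told apart by a Boolean label; over \<open>Z\<close>
    only the label \<open>False\<close> is kept, which glues the copies there.\<close>
  define Q where "Q = {(z, b). z \<in> fst A \<and> (b \<longrightarrow> z \<notin> Z)}"
  \<comment> \<open>A point of the second copy drops to the label \<open>False\<close> once the
    action moves it into \<open>Z\<close>. Since \<open>Z\<close> is stable under the action, it
    never has to come back, and this gives associativity.\<close>
  define a where "a = (\<lambda>p\<in>Q. \<lambda>m. (snd A (fst p) m, snd p \<and> snd A (fst p) m \<notin> Z))"
  have a: "a (z, b) m = (snd A z m, b \<and> snd A z m \<notin> Z)" if "(z, b) \<in> Q" for z b m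
    using that by (simp add: a_def)
  have aQ: "a p m \<in> Q" if "p \<in> Q" for p m using that AD(3) by (cases p) (auto simp: a Q_def)
  have "continuous_mset \<tau> (Q, a)"
    unfolding continuous_mset_iff
  proof (intro conjI ballI allI)
    fix p m n k assume p: "p \<in> Q"
    obtain z b where zb: "p = (z, b)" "z \<in> fst A" "b \<longrightarrow> z \<notin> Z" using p by (auto simp: Q_def)
    show "a p 1 = p" using p zb AD(4) by (auto simp: a)
    have "(snd A z m, b \<and> snd A z m \<notin> Z) \<in> Q" using aQ[OF p, of m] p zb(1) by (simp add: a)
    then show "a p (m * n) = a (a p m) n" using p zb AD(5) Zm[of "snd A z m" n] by (auto simp: a)
    \<comment> \<open>For fixed \<open>b\<close> the new label is a function of the point reached,
      so the orbit map has the same fibres as the one in \<open>A\<close>.\<close>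
    have "{n. a p n = a p k} = {n. snd A z n = snd A z k}" using p by (auto simp: zb(1) a)
    then show "openin \<tau> {n. a p n = a p k}" using AD(6)[OF zb(2)] by simp
  qed (use aQ in \<open>auto simp: a_def\<close>)
  moreover have "small U Q"
    by (rule small_subset[OF U small_Times[OF U small_in[OF AD(1)] small_finite[OF U, of UNIV]]])
      (auto simp: Q_def)
  ultimately obtain B \<beta> where B: "B \<in> Obj E" "bij_betw \<beta> Q (fst B)"
    "\<And>q m. q \<in> Q \<Longrightarrow> snd B (\<beta> q) m = \<beta> (a q m)"
    by (rule Obj_transport) blast
  \<comment> \<open>The two inclusions \<open>g\<close> and \<open>h\<close>; they agree at
    \<open>z\<close> exactly when \<open>z\<close> lies in \<open>Z\<close>.\<close>
  define g where "g = (\<lambda>z\<in>fst A. \<beta> (z, False))"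
  define h where "h = (\<lambda>z\<in>fst A. \<beta> (z, z \<notin> Z))"
  have Qi: "(z, False) \<in> Q" "(z, z \<notin> Z) \<in> Q" if "z \<in> fst A" for z using that by (auto simp: Q_def)
  have bQ: "\<beta> p \<in> fst B" if "p \<in> Q" for p using B(2) that by (auto simp: bij_betw_def)
  have hg: "(A, g, B) \<in> hom E A B" "(A, h, B) \<in> hom E A B"
    unfolding hom_Cont_iff using A B(1) Zm
    by (auto simp: g_def h_def B(3) Qi a AD(3) intro!: bQ arg_cong[of _ _ \<beta>])
  have gh: "(A, g, B) = (A, h, B)" if "\<forall>f\<in>S. Comp E (A, g, B) f = Comp E (A, h, B) f"
  proof -
    have "\<forall>g\<in>Arr E. \<forall>h\<in>Arr E. Dom E g = A \<and> Dom E h = A \<and> Cod E g = Cod E h \<and>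
        (\<forall>f\<in>S. Comp E g f = Comp E h f) \<longrightarrow> g = h"
      using S unfolding jointly_epic_def by blast
    from this[rule_format, OF homD(1)[OF hg(1)] homD(1)[OF hg(2)]]
    show ?thesis using homD(2,3)[OF hg(1)] homD(2,3)[OF hg(2)] that by simp
  qed
  have "x \<in> Z"
  proof (rule ccontr)
    assume nx: "x \<notin> Z"
    have "Comp E (A, g, B) f = Comp E (A, h, B) f" if fS: "f \<in> S" for f
    proof -
      obtain D u where u: "f = (D, u, A)" "(D, u, A) \<in> hom E D A" using Sh[OF fS] by blast
      have "u d \<in> Z" if "d \<in> fst D" for d
        using that u \<open>f \<in> S\<close> unfolding Z_def by blast
      then show ?thesis
        using hom_ContD(4)[OF u(2)] by (auto simp: u(1) Comp_Cont compose_def g_def h_def intro!: restrict_ext)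
    qed
    then have "g x = h x" using gh by simp
    then have "\<beta> (x, False) = \<beta> (x, True)" using x nx by (simp add: g_def h_def)
    then show False using B(2) Qi[OF x] nx by (auto simp: bij_betw_def inj_on_def)
  qed
  then show ?thesis using that unfolding Z_def by blast
qed

lemma supercompact_cyclic:
  assumes Q: "Q \<in> Obj E" "q \<in> fst Q" "\<And>x. x \<in> fst Q \<Longrightarrow> \<exists>m. x = snd Q q m"
  shows "supercompact E Q"
  unfolding supercompact_def
proof (intro conjI allI impI)
  fix S assume S: "jointly_epic E Q S"
  obtain B f b where f: "(B, f, Q) \<in> S" "(B, f, Q) \<in> hom E B Q" "b \<in> fst B" "f b = q"
    by (rule jointly_epic_surj[OF S Q(1,2)])
  have "x \<in> f ` fst B" if x: "x \<in> fst Q" for x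
  proof -
    obtain m where "x = snd Q q m" using Q(3)[OF x] by blast
    then have "x = f (snd B b m)" using hom_ContD(5)[OF f(2,3)] f(4) by simp
    then show ?thesis using Obj_ContD(3)[OF hom_ContD(1)[OF f(2)] f(3)] by blast
  qed
  then have "f ` fst B = fst Q" using hom_ContD(4)[OF f(2)] by blast
  then show "\<exists>f\<in>S. epi_arr E f" using surj_epi[OF f(2)] f(1) by blast
qed (rule Q(1))

lemma supercompactly_generated_Cont: "supercompactly_generated E"
  unfolding supercompactly_generated_def separating_def
proof (intro conjI ballI impI)
  show "{x. supercompact E x} \<subseteq> Obj E" by (auto simp: supercompact_def)
  fix f g assume f: "f \<in> Arr E" and g: "g \<in> Arr E"
    and ne: "Dom E f = Dom E g \<and> Cod E f = Cod E g \<and> f \<noteq> g"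
  define A B where "A = Dom E f" and "B = Cod E f"
  have hf: "f \<in> hom E A B" and hg: "g \<in> hom E A B"
    using Arr_hom[OF f] Arr_hom[OF g] ne by (simp_all add: A_def B_def)
  obtain u where u: "f = (A, u, B)" "(A, u, B) \<in> hom E A B" by (rule hom_ContE[OF hf])
  obtain v where v: "g = (A, v, B)" "(A, v, B) \<in> hom E A B" by (rule hom_ContE[OF hg])
  have "u \<noteq> v" using ne u(1) v(1) by auto
  then obtain x where x: "x \<in> fst A" "u x \<noteq> v x" using hom_Cont_eq[OF u(2) v(2)] by blast
  note A = hom_ContD(1)[OF u(2)]
  obtain \<rho> where r: "open_rep \<rho>" "\<And>m n. \<rho> m = \<rho> n \<longleftrightarrow> snd A x m = snd A x n"
    using open_rep_element[OF A x(1)] by blast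
  obtain Q q where Q: "Q \<in> Obj E" "q \<in> fst Q" "\<And>x. x \<in> fst Q \<Longrightarrow> \<exists>m. x = snd Q q m"
    "\<And>m n. snd Q q m = snd Q q n \<longleftrightarrow> \<rho> m = \<rho> n"
    using cyclic_object[OF r(1)] by blast
  obtain h where h: "(Q, h, A) \<in> hom E Q A" "h q = x"
    by (rule cyclic_hom[OF Q(1-3) A x(1)]) (use Q(4) r(2) in auto)
  have "Comp E f (Q, h, A) \<noteq> Comp E g (Q, h, A)"
  proof
    assume "Comp E f (Q, h, A) = Comp E g (Q, h, A)"
    then have "compose (fst Q) u h = compose (fst Q) v h" by (simp add: u(1) v(1) Comp_Cont)
    from fun_cong[OF this, of q] show False using Q(2) h(2) x(2) by (simp add: compose_def)
  qed
  then show "\<exists>x\<in>{x. supercompact E x}. \<exists>h\<in>hom E x (Dom E f). Comp E f h \<noteq> Comp E g h"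
    using h(1) supercompact_cyclic[OF Q(1-3)] unfolding A_def[symmetric] by blast
qed

text \<open>The points \<open>x\<close> and \<open>y\<close> are the images of one generator under
  two maps from a principal action whose kernel is the intersection of theirs. From
  \<open>f x = f y\<close> the two composites with \<open>f\<close> agree on the generator, so a
  monomorphism identifies the two maps.\<close>

lemma mono_inj:
  assumes h: "(A, f, B) \<in> hom E A B" and m: "mono_arr E (A, f, B)"
    and xy: "x \<in> fst A" "y \<in> fst A" "f x = f y"
  shows "x = y"
proof -
  note A = hom_ContD(1)[OF h]
  note AD = Obj_ContD[OF A]
  define \<phi> where "\<phi> n = (snd A x n, snd A y n)" for n
  have "openin \<tau> {n. \<phi> (k * n) = \<phi> (k * l)}" for k l
  proof -
    have "{n. \<phi> (k * n) = \<phi> (k * l)} = {n. snd A (snd A x k) n = snd A (snd A x k) l} \<inter>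
      {n. snd A (snd A y k) n = snd A (snd A y k) l}"
      using xy AD(5) by (auto simp: \<phi>_def)
    then show ?thesis using AD(6) AD(3) xy by (simp add: openin_Int)
  qed
  then obtain \<rho> where r: "open_rep \<rho>" "\<And>m n. \<rho> m = \<rho> n \<longleftrightarrow> \<phi> m = \<phi> n"
    using ex_open_rep[of \<phi>] AD(5) xy by (auto simp: \<phi>_def)
  obtain Q q where Q: "Q \<in> Obj E" "q \<in> fst Q" "\<And>x. x \<in> fst Q \<Longrightarrow> \<exists>m. x = snd Q q m"
    "\<And>m n. snd Q q m = snd Q q n \<longleftrightarrow> \<rho> m = \<rho> n"
    using cyclic_object[OF r(1)] by blast
  obtain g where g: "(Q, g, A) \<in> hom E Q A" "g q = x"
    by (rule cyclic_hom[OF Q(1-3) A xy(1)]) (use Q(4) r(2) in \<open>auto simp: \<phi>_def\<close>)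
  obtain g' where g': "(Q, g', A) \<in> hom E Q A" "g' q = y"
    by (rule cyclic_hom[OF Q(1-3) A xy(2)]) (use Q(4) r(2) in \<open>auto simp: \<phi>_def\<close>)
  note C = is_category_Cont
  note c = Comp_hom[OF C g(1) h, unfolded Comp_Cont] and c' = Comp_hom[OF C g'(1) h, unfolded Comp_Cont]
  have "compose (fst Q) f g = compose (fst Q) f g'"
    by (rule cyclic_hom_eq[OF c c' Q(2,3)]) (simp_all add: Q(2) compose_def g(2) g'(2) xy(3))
  then have "Comp E (A, f, B) (Q, g, A) = Comp E (A, f, B) (Q, g', A)" by (simp add: Comp_Cont)
  then have "(Q, g, A) = (Q, g', A)"
    using m homD[OF g(1)] homD[OF g'(1)] homD[OF h] unfolding mono_arr_def by metis
  then show ?thesis using g(2) g'(2) by simp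
qed

section \<open>The terminal object and its subobjects\<close>

definition one :: "('u, 'm) mset" where
  "one = ({undefined}, \<lambda>x\<in>{undefined}. \<lambda>m. undefined)"

lemma one_Obj: "one \<in> Obj E"
proof -
  have "{undefined} \<in> U"
    by (rule small_in_U[OF U small_finite[OF U]]) simp
  moreover have "openin \<tau> UNIV" using openin_topspace[of \<tau>] space by simp
  ultimately show ?thesis by (simp add: Obj_Cont one_def continuous_mset_iff)
qed

lemma terminal_one: "terminal E one"
  unfolding terminal_def
proof (intro conjI ballI one_Obj)
  fix A assume A: "A \<in> Obj E"
  show "\<exists>!f. f \<in> hom E A one"
  proof (rule ex1I)
    show "(A, \<lambda>x\<in>fst A. undefined, one) \<in> hom E A one"
      unfolding hom_Cont_iff using A one_Obj Obj_ContD(3)[OF A] by (auto simp: one_def)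
    fix g assume "g \<in> hom E A one"
    then obtain f where f: "g = (A, f, one)" "(A, f, one) \<in> hom E A one" by (rule hom_ContE)
    have "f = (\<lambda>x\<in>fst A. undefined)"
      by (rule extensionalityI[OF hom_ContD(3)[OF f(2)]])
        (use hom_ContD(4)[OF f(2)] in \<open>auto simp: one_def\<close>)
    then show "g = (A, \<lambda>x\<in>fst A. undefined, one)" using f(1) by simp
  qed
qed

text \<open>A map from \<open>one\<close> gives a fixed point \<open>p\<close> of \<open>t\<close>.
  The constant map at \<open>p\<close> is then an endomorphism, and a terminal object has no
  endomorphism but the identity.\<close>

lemma terminal_singleton:
  assumes t: "terminal E t"
  obtains p where "fst t = {p}"
proof -
  have T: "t \<in> Obj E" and ex: "\<And>x. x \<in> Obj E \<Longrightarrow> \<exists>!f. f \<in> hom E x t" using t by (auto simp: terminal_def)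
  obtain g where "g \<in> hom E one t" using ex[OF one_Obj] by blast
  then obtain f where f: "(one, f, t) \<in> hom E one t" by (rule hom_ContE)
  define p where "p = f undefined"
  have p: "p \<in> fst t" using hom_ContD(4)[OF f] by (simp add: p_def one_def)
  have pm: "snd t p m = p" for m using hom_ContD(5)[OF f, of undefined m] by (simp add: p_def one_def)
  have c: "(t, \<lambda>x\<in>fst t. p, t) \<in> hom E t t"
    unfolding hom_Cont_iff using T p pm Obj_ContD(3)[OF T] by auto
  have "(t, \<lambda>x\<in>fst t. p, t) = Id E t" using ex[OF T] c Id_hom[OF is_category_Cont T] by blast
  then have "(\<lambda>x\<in>fst t. p) = (\<lambda>x\<in>fst t. x)" by (simp add: Id_Cont)
  then have "x = p" if "x \<in> fst t" for x using that by (metis restrict_apply')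
  then show ?thesis using p by (intro that[of p]) blast
qed

text \<open>Monomorphisms are injective, so over a singleton their domains have at most one element.
  Between two such domains that are both empty or both inhabited there is a bijection, and it is
  automatically equivariant.\<close>

lemma subobject_equiv_terminal:
  assumes t: "fst t = {p}"
    and m: "(A, f, t) \<in> hom E A t" "mono_arr E (A, f, t)"
    and n: "(B, g, t) \<in> hom E B t" "mono_arr E (B, g, t)"
  shows "((A, f, t), (B, g, t)) \<in> subobject_equiv E t \<longleftrightarrow> (fst A = {} \<longleftrightarrow> fst B = {})"
proof
  note hA = homD[OF m(1)] and hB = homD[OF n(1)]
  {
    assume "((A, f, t), (B, g, t)) \<in> subobject_equiv E t"
    then obtain i where i: "i \<in> hom E A B" "iso E i"
      unfolding subobject_equiv_def by (auto simp: hA hB)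
    obtain h where h: "i = (A, h, B)" "(A, h, B) \<in> hom E A B" by (rule hom_ContE[OF i(1)])
    have "bij_betw h (fst A) (fst B)" using i(2) iso_Cont[OF h(2)] h(1) by simp
    then show "fst A = {} \<longleftrightarrow> fst B = {}" by (auto simp: bij_betw_def)
  next
    assume e: "fst A = {} \<longleftrightarrow> fst B = {}"
    have fp: "f x = p" if "x \<in> fst A" for x using hom_ContD(4)[OF m(1) that] t by simp
    have gp: "g x = p" if "x \<in> fst B" for x using hom_ContD(4)[OF n(1) that] t by simp
    have sA: "x = y" if "x \<in> fst A" "y \<in> fst A" for x y
      by (rule mono_inj[OF m that]) (simp add: fp that)
    have sB: "x = y" if "x \<in> fst B" "y \<in> fst B" for x y
      by (rule mono_inj[OF n that]) (simp add: gp that)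
    \<comment> \<open>\<open>SOME\<close> picks the only element of \<open>fst B\<close>; it is
      called upon only when \<open>fst A\<close>, and hence \<open>fst B\<close>, is
      inhabited.\<close>
    define i where "i = (\<lambda>x\<in>fst A. SOME y. y \<in> fst B)"
    have iB: "i x \<in> fst B" if "x \<in> fst A" for x
    proof -
      have "\<exists>y. y \<in> fst B" using that e by blast
      then show ?thesis using that by (auto simp: i_def intro: someI)
    qed
    note A = hom_ContD(1)[OF m(1)] and B = hom_ContD(1)[OF n(1)]
    have "i (snd A x k) = snd B (i x) k" if "x \<in> fst A" for x k
      by (rule sB) (use that iB Obj_ContD(3)[OF A] Obj_ContD(3)[OF B] in auto)
    then have hi: "(A, i, B) \<in> hom E A B"
      unfolding hom_Cont_iff using A B iB by (auto simp: i_def)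
    have "inj_on i (fst A)" using sA by (auto intro: inj_onI)
    moreover have "i ` fst A = fst B"
    proof
      show "fst B \<subseteq> i ` fst A"
      proof
        fix y assume y: "y \<in> fst B"
        then obtain x where x: "x \<in> fst A" using e by blast
        have "y = i x" by (rule sB[OF y iB[OF x]])
        then show "y \<in> i ` fst A" using x by blast
      qed
    qed (use iB in blast)
    ultimately have iso: "iso E (A, i, B)" using iso_Cont[OF hi] by (simp add: bij_betw_def)
    have "compose (fst A) g i = f"
      by (rule extensionalityI[of _ "fst A"]) (use hom_ContD(3)[OF m(1)] in \<open>auto simp: compose_def fp gp iB\<close>)
    then have "(A, f, t) = Comp E (B, g, t) (A, i, B)" by (simp add: Comp_Cont)
    then show "((A, f, t), (B, g, t)) \<in> subobject_equiv E t"
      unfolding subobject_equiv_def using hA hB hi iso m(2) n(2) by auto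
  }
qed

lemma card_subobjects_terminal:
  assumes t: "terminal E t"
  shows "card (subobjects E t) = 2"
proof -
  obtain p where p: "fst t = {p}" by (rule terminal_singleton[OF t])
  have T: "t \<in> Obj E" using t by (simp add: terminal_def)
  define Mo where "Mo = {m. mono_arr E m \<and> Cod E m = t}"
  \<comment> \<open>A subobject of the terminal object is classified by whether its domain is
    empty.\<close>
  define em where "em m \<longleftrightarrow> fst (Dom E m) = {}" for m :: "('u, 'm) mset \<times> ('u \<Rightarrow> 'u) \<times> ('u, 'm) mset"
  have MoE: "\<exists>A f. m = (A, f, t) \<and> (A, f, t) \<in> hom E A t \<and> Dom E m = A" if "m \<in> Mo" for m
  proof -
    have "m \<in> hom E (Dom E m) t" using that by (simp add: Mo_def mono_arr_def hom_def)
    then show ?thesis by (metis hom_ContE)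
  qed
  have rel: "(m, n) \<in> subobject_equiv E t \<longleftrightarrow> (em m \<longleftrightarrow> em n)" if mn: "m \<in> Mo" "n \<in> Mo" for m n
  proof -
    obtain A f where A: "m = (A, f, t)" "(A, f, t) \<in> hom E A t" "Dom E m = A" using MoE[OF mn(1)] by blast
    obtain B g where B: "n = (B, g, t)" "(B, g, t) \<in> hom E B t" "Dom E n = B" using MoE[OF mn(2)] by blast
    show ?thesis
      using subobject_equiv_terminal[OF p A(2) _ B(2)] mn A B by (simp add: Mo_def em_def)
  qed
  have im: "subobject_equiv E t `` {m} = {n \<in> Mo. em n \<longleftrightarrow> em m}" if "m \<in> Mo" for m
  proof -
    have "n \<in> Mo" if "(m, n) \<in> subobject_equiv E t" for n
      using that unfolding subobject_equiv_def Mo_def by auto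
    then show ?thesis using rel[OF that] unfolding Image_singleton by blast
  qed
  have i1: "Id E t \<in> Mo" and ei: "\<not> em (Id E t)"
  proof -
    note C = is_category_Cont
    have h: "Id E t \<in> hom E t t" by (rule Id_hom[OF C T])
    have "mono_arr E (Id E t)"
      unfolding mono_arr_def
    proof (intro conjI ballI impI)
      fix g h' assume "g \<in> Arr E" "h' \<in> Arr E" and "Cod E g = Dom E (Id E t) \<and>
        Cod E h' = Dom E (Id E t) \<and> Dom E g = Dom E h' \<and> Comp E (Id E t) g = Comp E (Id E t) h'"
      then show "g = h'"
        using Comp_Id(2)[OF C Arr_hom[of g]] Comp_Id(2)[OF C Arr_hom[of h']] homD(2)[OF h] by simp
    qed (rule homD(1)[OF h])
    then show "Id E t \<in> Mo" using homD(3)[OF h] by (simp add: Mo_def)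
    show "\<not> em (Id E t)" using homD(2)[OF h] p by (simp add: em_def)
  qed
  \<comment> \<open>The inclusion of the empty action, whose only extensional function is
    \<open>undefined\<close> everywhere.\<close>
  define z where "z = (({}, \<lambda>_. undefined) :: ('u, 'm) mset, (\<lambda>_. undefined) :: 'u \<Rightarrow> 'u, t)"
  have z1: "z \<in> Mo" and ez: "em z"
  proof -
    have "{} \<in> U" by (rule small_in_U[OF U small_finite[OF U]]) simp
    then have O: "({}, \<lambda>_. undefined) \<in> Obj E" by (simp add: Obj_Cont continuous_mset_iff)
    then have h: "z \<in> hom E ({}, \<lambda>_. undefined) t" unfolding z_def hom_Cont_iff using T by simp
    have "mono_arr E z"
      unfolding mono_arr_def
    proof (intro conjI ballI impI)
      fix g h' assume gh: "g \<in> Arr E" "h' \<in> Arr E" and eq: "Cod E g = Dom E z \<and>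
        Cod E h' = Dom E z \<and> Dom E g = Dom E h' \<and> Comp E z g = Comp E z h'"
      define D where "D = Dom E g"
      have "g \<in> hom E D ({}, \<lambda>_. undefined)" "h' \<in> hom E D ({}, \<lambda>_. undefined)"
        using Arr_hom[OF gh(1)] Arr_hom[OF gh(2)] eq homD(2)[OF h] by (simp_all add: D_def)
      then obtain u v where u: "g = (D, u, ({}, \<lambda>_. undefined))" "(D, u, ({}, \<lambda>_. undefined)) \<in> hom E D ({}, \<lambda>_. undefined)"
        and v: "h' = (D, v, ({}, \<lambda>_. undefined))" "(D, v, ({}, \<lambda>_. undefined)) \<in> hom E D ({}, \<lambda>_. undefined)"
        by (metis hom_ContE)
      have "u = v" by (rule hom_Cont_eq[OF u(2) v(2)]) (use hom_ContD(4)[OF u(2)] in auto)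
      then show "g = h'" using u(1) v(1) by simp
    qed (rule homD(1)[OF h])
    then show "z \<in> Mo" using homD(3)[OF h] by (simp add: Mo_def)
    show "em z" using homD(2)[OF h] by (simp add: em_def)
  qed
  have "subobjects E t = {{n \<in> Mo. em n}, {n \<in> Mo. \<not> em n}}"
  proof -
    have "subobjects E t = (\<lambda>m. {n \<in> Mo. em n \<longleftrightarrow> em m}) ` Mo"
      unfolding subobjects_def quotient_def Mo_def[symmetric] using im by auto
    also have "\<dots> = {{n \<in> Mo. em n}, {n \<in> Mo. \<not> em n}}"
    proof
      show "(\<lambda>m. {n \<in> Mo. em n \<longleftrightarrow> em m}) ` Mo \<subseteq> {{n \<in> Mo. em n}, {n \<in> Mo. \<not> em n}}" by auto
      have "{n \<in> Mo. em n} = {n \<in> Mo. em n \<longleftrightarrow> em z}" "{n \<in> Mo. \<not> em n} = {n \<in> Mo. em n \<longleftrightarrow> em (Id E t)}"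
        using ez ei by simp_all
      then show "{{n \<in> Mo. em n}, {n \<in> Mo. \<not> em n}} \<subseteq> (\<lambda>m. {n \<in> Mo. em n \<longleftrightarrow> em m}) ` Mo"
        using z1 i1 by blast
    qed
    finally show ?thesis .
  qed
  moreover have "{n \<in> Mo. em n} \<noteq> {n \<in> Mo. \<not> em n}" using z1 ez by blast
  ultimately show ?thesis by simp
qed

lemma two_valued_Cont: "two_valued E"
  unfolding two_valued_def using terminal_one card_subobjects_terminal by blast


section \<open>The canonical point\<close>

definition forget :: "(('u, 'm) mset, ('u, 'm) mset \<times> ('u \<Rightarrow> 'u) \<times> ('u, 'm) mset, 'u set, 'u set_arrow) cfunctor"
  where "forget = \<lparr>ob_map = fst, arr_map = (\<lambda>(A, f, B). (fst A, f, fst B))\<rparr>"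

lemma forget_simps: "ob_map forget A = fst A" "arr_map forget (A, f, B) = (fst A, f, fst B)"
  by (simp_all add: forget_def)

lemma hom_Cont_set: "(A, f, B) \<in> hom E A B \<Longrightarrow> (fst A, f, fst B) \<in> hom (set_cat U) (fst A) (fst B)"
  using Obj_ContD(1) by (auto simp: hom_Cont_iff hom_set_cat)

lemma is_functor_forget: "is_functor E (set_cat U) forget"
proof (rule is_functorI[OF is_category_Cont is_category_set_cat])
  fix g A B assume "g \<in> hom E A B"
  then obtain f where f: "g = (A, f, B)" "(A, f, B) \<in> hom E A B" by (rule hom_ContE)
  show "arr_map forget g \<in> hom (set_cat U) (ob_map forget A) (ob_map forget B)"
    using hom_Cont_set[OF f(2)] by (simp add: f(1) forget_simps)
next
  fix g h A B Z assume g: "g \<in> hom E A B" and h: "h \<in> hom E B Z"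
  obtain u v where "g = (A, u, B)" "h = (B, v, Z)" using hom_ContE[OF g] hom_ContE[OF h] by metis
  then show "arr_map forget (Comp E h g) = Comp (set_cat U) (arr_map forget h) (arr_map forget g)"
    by (simp add: forget_simps Comp_Cont set_cat_simps)
qed (simp_all add: forget_simps Id_Cont set_cat_simps Obj_ContD(1))

text \<open>The right adjoint of the forgetful functor sends \<open>S\<close> to the largest continuous sub-action of
  \<open>(f \<cdot> m) n = f (m n)\<close> on the functions from the monoid to \<open>S\<close>.\<close>

lemma cofree_object:
  assumes S: "S \<in> U"
  obtains A e where "A \<in> Obj E" "e \<in> fst A \<rightarrow> S"
    "\<And>X f. X \<in> Obj E \<Longrightarrow> f \<in> fst X \<rightarrow>\<^sub>E S \<Longrightarrow>
      \<exists>!g. (X, g, A) \<in> hom E X A \<and> (\<forall>x\<in>fst X. e (g x) = f x)"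
proof -
  \<comment> \<open>The set required to be open is a fibre of the orbit map of the translate of
    \<open>f\<close> by \<open>k\<close>. Asking this for every \<open>k\<close>, and not just for
    \<open>f\<close> itself, makes \<open>Q\<close> stable under the action.\<close>
  define Q where "Q = {f \<in> UNIV \<rightarrow>\<^sub>E S. \<forall>k l. openin \<tau> {n. (\<lambda>j. f (k * (n * j))) = (\<lambda>j. f (k * (l * j)))}}"
  define a where "a = (\<lambda>f\<in>Q. \<lambda>m::'m. \<lambda>j. f (m * j))"
  have QS: "f j \<in> S" if "f \<in> Q" for f j using that by (auto simp: Q_def)
  have a: "a f m = (\<lambda>j. f (m * j))" if "f \<in> Q" for f m using that by (simp add: a_def)
  have aQ: "a f m \<in> Q" if f: "f \<in> Q" for f m
  proof -
    have "openin \<tau> {n. (\<lambda>j. f ((m * k) * (n * j))) = (\<lambda>j. f ((m * k) * (l * j)))}" for k l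
      using f unfolding Q_def by blast
    then show ?thesis using QS[OF f] unfolding a[OF f] by (simp add: Q_def mult.assoc PiE_UNIV_domain)
  qed
  have "continuous_mset \<tau> (Q, a)"
    unfolding continuous_mset_iff
  proof (intro conjI ballI allI)
    fix f m n k assume f: "f \<in> Q"
    show "a f 1 = f" using f by (simp add: a)
    show "a f (m * n) = a (a f m) n" by (simp only: a[OF f] a[OF aQ[OF f]] a[OF aQ[OF f], unfolded a[OF f]] mult.assoc)
    have "openin \<tau> {n. (\<lambda>j. f (1 * (n * j))) = (\<lambda>j. f (1 * (k * j)))}"
      using f unfolding Q_def by blast
    then show "openin \<tau> {n. a f n = a f k}" using f by (simp add: a)
  qed (use aQ in \<open>auto simp: a_def\<close>)
  moreover have "small U Q"
  proof (rule small_subset[OF U])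
    show "small U ((UNIV :: 'm set) \<rightarrow>\<^sub>E S)" using expU S unfolding closed_under_exponent_def by blast
  qed (auto simp: Q_def)
  ultimately obtain A \<beta> where A: "A \<in> Obj E" and b: "bij_betw \<beta> Q (fst A)"
    and act: "\<And>q m. q \<in> Q \<Longrightarrow> snd A (\<beta> q) m = \<beta> (a q m)"
    by (rule Obj_transport) blast
  \<comment> \<open>The counit evaluates a function at the unit of the monoid.\<close>
  define e where "e y = inv_into Q \<beta> y 1" for y
  have e: "e (\<beta> f) = f 1" if "f \<in> Q" for f
    using that bij_betw_inv_into_left[OF b] by (simp add: e_def)
  have bQ: "\<beta> f \<in> fst A" if "f \<in> Q" for f using that b by (auto simp: bij_betw_def)
  have bE: "\<exists>f\<in>Q. y = \<beta> f" if "y \<in> fst A" for y using that b by (auto simp: bij_betw_def)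
  show ?thesis
  proof (rule that[OF A])
    show "e \<in> fst A \<rightarrow> S"
    proof
      fix y assume "y \<in> fst A"
      then obtain f where "f \<in> Q" "y = \<beta> f" using bE by blast
      then show "e y \<in> S" using e QS by simp
    qed
    fix X and f :: "'u \<Rightarrow> 'u" assume X: "X \<in> Obj E" and f: "f \<in> fst X \<rightarrow>\<^sub>E S"
    note XD = Obj_ContD[OF X]
    have orb: "(\<lambda>n. f (snd X x n)) \<in> Q" if x: "x \<in> fst X" for x
    proof -
      have "openin \<tau> {n. (\<lambda>j. f (snd X x (k * (n * j)))) = (\<lambda>j. f (snd X x (k * (l * j))))}" for k l
      proof -
        let ?P = "\<lambda>n j. f (snd X x (k * (n * j)))"
        have xk: "snd X x k \<in> fst X" by (rule XD(3)[OF x])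
        have P: "?P n' = ?P n" if "snd X (snd X x k) n' = snd X (snd X x k) n" for n n'
          using that by (intro ext) (simp add: XD(5)[OF x] XD(5)[OF xk])
        \<comment> \<open>The function \<open>?P n\<close> depends only on the value of the orbit
          map of \<open>snd X x k\<close> at \<open>n\<close>, so this set is a union of open fibres
          of that orbit map.\<close>
        have "{n. ?P n = ?P l} = (\<Union>n\<in>{n. ?P n = ?P l}. {n'. snd X (snd X x k) n' = snd X (snd X x k) n})"
          (is "?A = ?B")
        proof
          show "?B \<subseteq> ?A" by (intro UN_least subsetI CollectI) (metis (mono_tags, lifting) P mem_Collect_eq)
        qed blast
        moreover have "openin \<tau> ?B" by (rule openin_Union) (use XD(6)[OF xk] in blast)
        ultimately show ?thesis by simp
      qed
      then show ?thesis using f XD(3)[OF x] by (auto simp: Q_def PiE_UNIV_domain)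
    qed
    let ?g = "\<lambda>x\<in>fst X. \<beta> (\<lambda>n. f (snd X x n))"
    show "\<exists>!g. (X, g, A) \<in> hom E X A \<and> (\<forall>x\<in>fst X. e (g x) = f x)"
    proof (rule ex1I[of _ ?g])
      have "?g (snd X x m) = snd A (?g x) m" if x: "x \<in> fst X" for x m
        using x XD(3)[OF x] by (simp add: act[OF orb[OF x]] a[OF orb[OF x]] XD(5)[OF x])
      moreover have "?g \<in> fst X \<rightarrow>\<^sub>E fst A" using bQ orb by auto
      ultimately show "(X, ?g, A) \<in> hom E X A \<and> (\<forall>x\<in>fst X. e (?g x) = f x)"
        unfolding hom_Cont_iff using A X e[OF orb] XD(4) by simp
      fix g assume g: "(X, g, A) \<in> hom E X A \<and> (\<forall>x\<in>fst X. e (g x) = f x)"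
      show "g = ?g"
      proof (rule extensionalityI[of _ "fst X"])
        fix x assume x: "x \<in> fst X"
        obtain h where h: "h \<in> Q" "g x = \<beta> h" using bE hom_ContD(4) g x by blast
        \<comment> \<open>Evaluation at \<open>1\<close> after acting by \<open>n\<close> reads off
          the value at \<open>n\<close>, so equivariance and the counit determine
          \<open>h\<close>.\<close>
        have "h n = f (snd X x n)" for n
        proof -
          have "f (snd X x n) = e (g (snd X x n))" using g XD(3)[OF x] by simp
          also have "\<dots> = e (\<beta> (a h n))" using hom_ContD(5)[of X g A x n] g x by (simp add: h(2) act[OF h(1)])
          also have "\<dots> = h n" by (subst e[OF aQ[OF h(1)]]) (simp add: a[OF h(1)])
          finally show ?thesis by simp
        qed
        then have "h = (\<lambda>n. f (snd X x n))" by (rule ext)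
        then show "g x = ?g x" using h(2) x by simp
      qed (use g in \<open>simp_all add: hom_ContD(3)[of X g A]\<close>)
    qed
  qed
qed

lemma forget_has_right_adjoint: "\<exists>d. adjoint E (set_cat U) forget d"
proof -
  \<comment> \<open>All properties of a cofree object are bundled in one predicate, so that the
    object and its counit can be chosen simultaneously for all \<open>S\<close>.\<close>
  define P where "P S A e \<longleftrightarrow> A \<in> Obj E \<and> e \<in> fst A \<rightarrow> S \<and> (\<forall>X f. X \<in> Obj E \<longrightarrow> f \<in> fst X \<rightarrow>\<^sub>E S \<longrightarrow>
      (\<exists>!g. (X, g, A) \<in> hom E X A \<and> (\<forall>x\<in>fst X. e (g x) = f x)))"
    for S :: "'u set" and A :: "('u, 'm) mset" and e :: "'u \<Rightarrow> 'u"
  have "\<exists>A e. P S A e" if "S \<in> U" for S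
    by (rule cofree_object[OF that]) (unfold P_def, blast)
  then obtain R e where Re: "\<And>S. S \<in> U \<Longrightarrow> P S (R S) (e S)" by metis
  have R: "R S \<in> Obj E" "e S \<in> fst (R S) \<rightarrow> S"
    "\<And>X f. X \<in> Obj E \<Longrightarrow> f \<in> fst X \<rightarrow>\<^sub>E S \<Longrightarrow>
      \<exists>!g. (X, g, R S) \<in> hom E X (R S) \<and> (\<forall>x\<in>fst X. e S (g x) = f x)" if "S \<in> U" for S
    using Re[OF that] unfolding P_def by blast+
  define \<epsilon> where "\<epsilon> S = (fst (R S), restrict (e S) (fst (R S)), S)" for S
  have eps: "\<epsilon> S \<in> hom (set_cat U) (ob_map forget (R S)) S" if "S \<in> Obj (set_cat U)" for S
    using that R(2)[of S] Obj_ContD(1)[OF R(1)[of S]]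
    by (auto simp: set_cat_simps \<epsilon>_def forget_simps hom_set_cat)
  have univ: "\<exists>!g. g \<in> hom E X (R S) \<and> Comp (set_cat U) (\<epsilon> S) (arr_map forget g) = f"
    if X: "X \<in> Obj E" and S: "S \<in> Obj (set_cat U)" and f: "f \<in> hom (set_cat U) (ob_map forget X) S"
    for X S f
  proof -
    have SU: "S \<in> U" using S by (simp add: set_cat_simps)
    obtain u where u: "f = (fst X, u, S)" "u \<in> fst X \<rightarrow>\<^sub>E S"
      using f by (auto simp: forget_simps elim: hom_set_catE)
    have eq: "Comp (set_cat U) (\<epsilon> S) (arr_map forget (X, g, R S)) = f \<longleftrightarrow> (\<forall>x\<in>fst X. e S (g x) = u x)"
      if g: "(X, g, R S) \<in> hom E X (R S)" for g
    proof -
      have "compose (fst X) (restrict (e S) (fst (R S))) g = u \<longleftrightarrow> (\<forall>x\<in>fst X. e S (g x) = u x)"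
        (is "?c = u \<longleftrightarrow> _")
      proof
        assume "?c = u"
        then show "\<forall>x\<in>fst X. e S (g x) = u x" using hom_ContD(4)[OF g] by (auto simp: compose_def)
      next
        assume "\<forall>x\<in>fst X. e S (g x) = u x"
        then show "?c = u"
          by (intro extensionalityI[of _ "fst X"])
            (use u(2) hom_ContD(4)[OF g] in \<open>auto simp: compose_def PiE_def\<close>)
      qed
      then show ?thesis by (simp add: forget_simps \<epsilon>_def set_cat_simps u(1))
    qed
    obtain g where g: "(X, g, R S) \<in> hom E X (R S)" "\<forall>x\<in>fst X. e S (g x) = u x"
      and un: "\<And>g'. (X, g', R S) \<in> hom E X (R S) \<Longrightarrow> \<forall>x\<in>fst X. e S (g' x) = u x \<Longrightarrow> g' = g"
      using R(3)[OF SU X u(2)] by blast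
    show ?thesis
    proof (rule ex1I[of _ "(X, g, R S)"])
      fix h assume h: "h \<in> hom E X (R S) \<and> Comp (set_cat U) (\<epsilon> S) (arr_map forget h) = f"
      then obtain v where v: "h = (X, v, R S)" "(X, v, R S) \<in> hom E X (R S)" by (metis hom_ContE)
      then show "h = (X, g, R S)" using un[OF v(2)] eq[OF v(2)] h by simp
    qed (use g eq in simp)
  qed
  obtain d \<eta> where "is_functor (set_cat U) E d" "nat_trans E E id_functor (comp_functor d forget) \<eta>"
    "nat_trans (set_cat U) (set_cat U) (comp_functor forget d) id_functor \<epsilon>"
    "\<And>x. x \<in> Obj E \<Longrightarrow> Comp (set_cat U) (\<epsilon> (ob_map forget x)) (arr_map forget (\<eta> x)) = Id (set_cat U) (ob_map forget x)"
    "\<And>y. y \<in> Obj (set_cat U) \<Longrightarrow> Comp E (arr_map d (\<epsilon> y)) (\<eta> (ob_map d y)) = Id E (ob_map d y)"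
    by (rule universal_arrows_adjunction[OF is_functor_forget _ eps univ])
      (use R(1) in \<open>auto simp: set_cat_simps\<close>)
  then show ?thesis unfolding adjoint_def using is_functor_forget by blast
qed

text \<open>Elements of a limit are tested by maps from principal actions. The principal action on
  the common kernel of the family maps to the diagram by sending its generator to the family, and
  the induced map into \<open>l\<close> sends the generator to the element sought. Uniqueness uses
  the common kernel of two candidates, whose maps into \<open>l\<close> induce the same
  cone.\<close>

lemma limit_elements:
  assumes J: "is_category J" "finite (Obj J)"
    and lim: "limit_cone J E T l \<pi>"
    and t: "\<And>j. j \<in> Obj J \<Longrightarrow> t j \<in> fst (ob_map T j)"
    and nat: "\<And>u. u \<in> Arr J \<Longrightarrow> fun_of (arr_map T u) (t (Dom J u)) = t (Cod J u)"
  shows "\<exists>!z. z \<in> fst l \<and> (\<forall>j\<in>Obj J. fun_of (\<pi> j) z = t j)"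
proof -
  note C = is_category_Cont
  have cn: "cone J E T l \<pi>" and univ: "\<And>x \<kappa>. cone J E T x \<kappa> \<Longrightarrow>
      \<exists>!u. u \<in> hom E x l \<and> (\<forall>j\<in>Obj J. Comp E (\<pi> j) u = \<kappa> j)"
    using lim unfolding limit_cone_def by blast+
  have T: "is_functor J E T" and l: "l \<in> Obj E" and ph: "\<And>j. j \<in> Obj J \<Longrightarrow> \<pi> j \<in> hom E l (ob_map T j)"
    using cn by (auto simp: cone_def)
  have TO: "ob_map T j \<in> Obj E" if "j \<in> Obj J" for j by (rule is_functorD(3)[OF T that])
  define p where "p j = fun_of (\<pi> j)" for j
  have p: "\<pi> j = (l, p j, ob_map T j)" "(l, p j, ob_map T j) \<in> hom E l (ob_map T j)" if jJ: "j \<in> Obj J" for j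
  proof -
    obtain f where f: "\<pi> j = (l, f, ob_map T j)" "(l, f, ob_map T j) \<in> hom E l (ob_map T j)"
      by (rule hom_ContE[OF ph[OF jJ]])
    then show "\<pi> j = (l, p j, ob_map T j)" "(l, p j, ob_map T j) \<in> hom E l (ob_map T j)"
      by (simp_all add: p_def fun_of_def)
  qed
  have ex: "\<exists>z. z \<in> fst l \<and> (\<forall>j\<in>Obj J. p j z = t j)"
  proof -
    define \<phi> where "\<phi> n = (\<lambda>j\<in>Obj J. snd (ob_map T j) (t j) n)" for n
    have feq: "\<phi> m = \<phi> n \<longleftrightarrow> (\<forall>j\<in>Obj J. snd (ob_map T j) (t j) m = snd (ob_map T j) (t j) n)" for m n
      by (auto simp: \<phi>_def fun_eq_iff restrict_def)
    have "openin \<tau> {n. \<phi> (k * n) = \<phi> (k * m)}" for k m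
    proof -
      have "{n. \<phi> (k * n) = \<phi> (k * m)} =
        (\<Inter>j\<in>Obj J. {n. snd (ob_map T j) (snd (ob_map T j) (t j) k) n = snd (ob_map T j) (snd (ob_map T j) (t j) k) m}) \<inter> topspace \<tau>"
        unfolding feq using Obj_ContD(5)[OF TO t] by (auto simp: space)
      \<comment> \<open>Finiteness of the diagram keeps this intersection of open sets open.\<close>
      moreover have "openin \<tau> \<dots>"
        by (rule openin_INT[OF J(2)]) (use Obj_ContD(6)[OF TO] Obj_ContD(3)[OF TO] t in auto)
      ultimately show ?thesis by simp
    qed
    moreover have "\<phi> (m * k) = \<phi> (n * k)" if "\<phi> m = \<phi> n" for m n k
      using that unfolding feq using Obj_ContD(5)[OF TO t] by simp
    ultimately obtain \<rho> where r: "open_rep \<rho>" "\<And>m n. \<rho> m = \<rho> n \<longleftrightarrow> \<phi> m = \<phi> n"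
      using ex_open_rep[of \<phi>] by blast
    obtain Q q where Q: "Q \<in> Obj E" "q \<in> fst Q" "\<And>x. x \<in> fst Q \<Longrightarrow> \<exists>m. x = snd Q q m"
      "\<And>m n. snd Q q m = snd Q q n \<longleftrightarrow> \<rho> m = \<rho> n"
      using cyclic_object[OF r(1)] by blast
    have "\<exists>f. (Q, f, ob_map T j) \<in> hom E Q (ob_map T j) \<and> f q = t j" if j: "j \<in> Obj J" for j
    proof -
      have "snd (ob_map T j) (t j) m = snd (ob_map T j) (t j) n" if "snd Q q m = snd Q q n" for m n
        using that j unfolding Q(4) r(2) feq by blast
      then show ?thesis using cyclic_hom[OF Q(1-3) TO[OF j] t[OF j]] by metis
    qed
    then obtain f where f: "\<And>j. j \<in> Obj J \<Longrightarrow> (Q, f j, ob_map T j) \<in> hom E Q (ob_map T j)"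
      "\<And>j. j \<in> Obj J \<Longrightarrow> f j q = t j" by metis
    have "cone J E T Q (\<lambda>j. (Q, f j, ob_map T j))"
      unfolding cone_def
    proof (intro conjI ballI T Q(1))
      fix v assume v: "v \<in> Arr J"
      have d: "Dom J v \<in> Obj J" "Cod J v \<in> Obj J" using J v by (auto simp: is_category_def)
      obtain w where w: "arr_map T v = (ob_map T (Dom J v), w, ob_map T (Cod J v))"
        "(ob_map T (Dom J v), w, ob_map T (Cod J v)) \<in> hom E (ob_map T (Dom J v)) (ob_map T (Cod J v))"
        by (rule hom_ContE[OF is_functorD(4)[OF T Arr_hom[OF v]]])
      have c: "(Q, compose (fst Q) w (f (Dom J v)), ob_map T (Cod J v)) \<in> hom E Q (ob_map T (Cod J v))"
        using Comp_hom[OF C f(1)[OF d(1)] w(2)] by (simp add: Comp_Cont)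
      have "compose (fst Q) w (f (Dom J v)) = f (Cod J v)"
        by (rule cyclic_hom_eq[OF c f(1)[OF d(2)] Q(2,3)])
          (use nat[OF v] Q(2) in \<open>simp_all add: compose_def f(2) d w(1) fun_of_def\<close>)
      then show "Comp E (arr_map T v) (Q, f (Dom J v), ob_map T (Dom J v)) = (Q, f (Cod J v), ob_map T (Cod J v))"
        by (simp add: w(1) Comp_Cont)
    qed (use f(1) in auto)
    then obtain u where u: "u \<in> hom E Q l" "\<forall>j\<in>Obj J. Comp E (\<pi> j) u = (Q, f j, ob_map T j)"
      using univ by blast
    obtain v where v: "u = (Q, v, l)" "(Q, v, l) \<in> hom E Q l" by (rule hom_ContE[OF u(1)])
    have "p j (v q) = t j" if "j \<in> Obj J" for j
    proof -
      have "compose (fst Q) (p j) v = f j" using bspec[OF u(2) that] by (simp add: p(1)[OF that] v(1) Comp_Cont)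
      then show ?thesis using fun_cong[of _ _ q] f(2)[OF that] Q(2) by (metis compose_eq)
    qed
    then show ?thesis using hom_ContD(4)[OF v(2) Q(2)] by blast
  qed
  have un: "z = z'" if z: "z \<in> fst l" "z' \<in> fst l" and eq: "\<And>j. j \<in> Obj J \<Longrightarrow> p j z = p j z'" for z z'
  proof -
    note LD = Obj_ContD[OF l]
    define \<phi> where "\<phi> n = (snd l z n, snd l z' n)" for n
    have "openin \<tau> {n. \<phi> (k * n) = \<phi> (k * m)}" for k m
    proof -
      have "{n. \<phi> (k * n) = \<phi> (k * m)} = {n. snd l (snd l z k) n = snd l (snd l z k) m} \<inter>
        {n. snd l (snd l z' k) n = snd l (snd l z' k) m}"
        using z LD(5) by (auto simp: \<phi>_def)
      then show ?thesis using LD(6) LD(3) z by (simp add: openin_Int)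
    qed
    then obtain \<rho> where r: "open_rep \<rho>" "\<And>m n. \<rho> m = \<rho> n \<longleftrightarrow> \<phi> m = \<phi> n"
      using ex_open_rep[of \<phi>] LD(5) z by (auto simp: \<phi>_def)
    obtain Q q where Q: "Q \<in> Obj E" "q \<in> fst Q" "\<And>x. x \<in> fst Q \<Longrightarrow> \<exists>m. x = snd Q q m"
      "\<And>m n. snd Q q m = snd Q q n \<longleftrightarrow> \<rho> m = \<rho> n"
      using cyclic_object[OF r(1)] by blast
    obtain g where g: "(Q, g, l) \<in> hom E Q l" "g q = z"
      by (rule cyclic_hom[OF Q(1-3) l z(1)]) (use Q(4) r(2) in \<open>auto simp: \<phi>_def\<close>)
    obtain g' where g': "(Q, g', l) \<in> hom E Q l" "g' q = z'"
      by (rule cyclic_hom[OF Q(1-3) l z(2)]) (use Q(4) r(2) in \<open>auto simp: \<phi>_def\<close>)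
    have eq': "Comp E (\<pi> j) (Q, g, l) = Comp E (\<pi> j) (Q, g', l)" if j: "j \<in> Obj J" for j
    proof -
      note c = Comp_hom[OF C g(1) p(2)[OF j], unfolded Comp_Cont] and c' = Comp_hom[OF C g'(1) p(2)[OF j], unfolded Comp_Cont]
      have "compose (fst Q) (p j) g = compose (fst Q) (p j) g'"
        by (rule cyclic_hom_eq[OF c c' Q(2,3)]) (simp_all add: Q(2) compose_def g(2) g'(2) eq[OF j])
      then show ?thesis by (simp add: p(1)[OF j] Comp_Cont)
    qed
    have "(Q, g, l) = (Q, g', l)"
      using univ[OF cone_comp[OF cn g(1) J(1)]] g(1) g'(1) eq' by metis
    then show ?thesis using g(2) g'(2) by simp
  qed
  show ?thesis unfolding p_def[symmetric] using ex un by metis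
qed

text \<open>A cone over the underlying sets with vertex \<open>x\<close> is a compatible family of
  points for each element of \<open>x\<close>, so \<open>limit_elements\<close> gives the mediating
  function pointwise.\<close>

lemma forget_preserves_finite_limits: "preserves_finite_limits E (set_cat U) forget"
  unfolding preserves_finite_limits_def
proof (intro allI impI, elim conjE)
  fix J :: "(nat, nat) category" and T l \<pi>
  assume J: "is_category J" "finite (Obj J)" and lim: "limit_cone J E T l \<pi>"
  have cn: "cone J E T l \<pi>" using lim by (auto simp: limit_cone_def)
  have T: "is_functor J E T" and l: "l \<in> Obj E" and ph: "\<And>j. j \<in> Obj J \<Longrightarrow> \<pi> j \<in> hom E l (ob_map T j)"
    and nat: "\<And>u. u \<in> Arr J \<Longrightarrow> Comp E (arr_map T u) (\<pi> (Dom J u)) = \<pi> (Cod J u)"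
    using cn by (auto simp: cone_def)
  note F = is_functor_forget
  let ?T = "comp_functor forget T"
  note FT = is_functor_comp[OF T F]
  note S = is_category_set_cat[of U]
  have Tob: "ob_map ?T j = fst (ob_map T j)" for j by (simp add: comp_functor_def forget_simps)
  have dc: "Dom J v \<in> Obj J" "Cod J v \<in> Obj J" if "v \<in> Arr J" for v
    using J(1) that by (auto simp: is_category_def)
  have Tar: "\<exists>w. arr_map T v = (ob_map T (Dom J v), w, ob_map T (Cod J v)) \<and>
      arr_map ?T v = (fst (ob_map T (Dom J v)), w, fst (ob_map T (Cod J v)))" if v: "v \<in> Arr J" for v
  proof -
    obtain w where "arr_map T v = (ob_map T (Dom J v), w, ob_map T (Cod J v))"
      using hom_ContE[OF is_functorD(4)[OF T Arr_hom[OF v]]] by blast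
    then show ?thesis by (simp add: comp_functor_def forget_simps)
  qed
  have par: "\<exists>w. \<pi> j = (l, w, ob_map T j) \<and> arr_map forget (\<pi> j) = (fst l, w, fst (ob_map T j)) \<and> w \<in> fst l \<rightarrow>\<^sub>E fst (ob_map T j)"
    if jJ: "j \<in> Obj J" for j
  proof -
    obtain w where "\<pi> j = (l, w, ob_map T j)" "(l, w, ob_map T j) \<in> hom E l (ob_map T j)"
      by (rule hom_ContE[OF ph[OF jJ]])
    then show ?thesis by (auto simp: forget_simps hom_Cont_iff)
  qed
  show "limit_cone J (set_cat U) ?T (ob_map forget l) (\<lambda>j. arr_map forget (\<pi> j))"
    unfolding limit_cone_def
  proof (intro conjI allI impI)
    show "cone J (set_cat U) ?T (ob_map forget l) (\<lambda>j. arr_map forget (\<pi> j))"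
      unfolding cone_def
    proof (intro conjI ballI FT)
      show "ob_map forget l \<in> Obj (set_cat U)" by (rule is_functorD(3)[OF F l])
      fix j assume j: "j \<in> Obj J"
      show "arr_map forget (\<pi> j) \<in> hom (set_cat U) (ob_map forget l) (ob_map ?T j)"
        using is_functorD(4)[OF F ph[OF j]] by (simp add: comp_functor_def)
    next
      fix v assume v: "v \<in> Arr J"
      show "Comp (set_cat U) (arr_map ?T v) (arr_map forget (\<pi> (Dom J v))) = arr_map forget (\<pi> (Cod J v))"
        using is_functorD(6)[OF F ph[OF dc(1)[OF v]] is_functorD(4)[OF T Arr_hom[OF v]]] nat[OF v]
        by (simp add: comp_functor_def)
    qed
    fix x \<kappa> assume k: "cone J (set_cat U) ?T x \<kappa>"
    have x: "x \<in> U" and kh: "\<And>j. j \<in> Obj J \<Longrightarrow> \<kappa> j \<in> hom (set_cat U) x (fst (ob_map T j))"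
      and kn: "\<And>v. v \<in> Arr J \<Longrightarrow> Comp (set_cat U) (arr_map ?T v) (\<kappa> (Dom J v)) = \<kappa> (Cod J v)"
      using k by (auto simp: cone_def set_cat_simps Tob)
    define t where "t j = fun_of (\<kappa> j)" for j
    have t: "\<kappa> j = (x, t j, fst (ob_map T j))" "t j \<in> x \<rightarrow>\<^sub>E fst (ob_map T j)" if jJ: "j \<in> Obj J" for j
    proof -
      obtain f where "\<kappa> j = (x, f, fst (ob_map T j))" "f \<in> x \<rightarrow>\<^sub>E fst (ob_map T j)"
        by (rule hom_set_catE[OF kh[OF jJ]])
      then show "\<kappa> j = (x, t j, fst (ob_map T j))" "t j \<in> x \<rightarrow>\<^sub>E fst (ob_map T j)"
        by (simp_all add: t_def fun_of_def)
    qed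
    have z1: "\<exists>!z. z \<in> fst l \<and> (\<forall>j\<in>Obj J. fun_of (\<pi> j) z = t j a)" if a: "a \<in> x" for a
    proof (rule limit_elements[OF J lim])
      fix j assume "j \<in> Obj J"
      then show "t j a \<in> fst (ob_map T j)" using t(2) a by auto
    next
      fix v assume v: "v \<in> Arr J"
      obtain w where w: "arr_map T v = (ob_map T (Dom J v), w, ob_map T (Cod J v))"
        "arr_map ?T v = (fst (ob_map T (Dom J v)), w, fst (ob_map T (Cod J v)))"
        using Tar[OF v] by blast
      have "compose x w (t (Dom J v)) = t (Cod J v)"
        using kn[OF v] by (simp add: w(2) t(1) dc[OF v] set_cat_simps)
      then show "fun_of (arr_map T v) (t (Dom J v) a) = t (Cod J v) a"
        using a by (metis compose_eq w(1) fun_of_def case_prod_conv)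
    qed
    define z where "z = (\<lambda>a\<in>x. THE z. z \<in> fst l \<and> (\<forall>j\<in>Obj J. fun_of (\<pi> j) z = t j a))"
    have z: "z a \<in> fst l" "\<And>j. j \<in> Obj J \<Longrightarrow> fun_of (\<pi> j) (z a) = t j a" if "a \<in> x" for a
      using theI'[OF z1[OF that]] that by (simp_all add: z_def)
    have eq: "Comp (set_cat U) (arr_map forget (\<pi> j)) (x, v, fst l) = \<kappa> j \<longleftrightarrow> (\<forall>a\<in>x. fun_of (\<pi> j) (v a) = t j a)"
      if j: "j \<in> Obj J" and v: "v \<in> x \<rightarrow>\<^sub>E fst l" for j v
    proof -
      obtain w where w: "\<pi> j = (l, w, ob_map T j)" "arr_map forget (\<pi> j) = (fst l, w, fst (ob_map T j))"
        using par[OF j] by blast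
      have "compose x w v = t j \<longleftrightarrow> (\<forall>a\<in>x. w (v a) = t j a)"
      proof
        assume "\<forall>a\<in>x. w (v a) = t j a"
        then show "compose x w v = t j"
          using t(2)[OF j] by (intro extensionalityI[of _ x]) (auto simp: compose_def PiE_def)
      qed (metis compose_eq)
      then show ?thesis by (simp add: w(1) t(1)[OF j] forget_simps set_cat_simps fun_of_def)
    qed
    show "\<exists>!u. u \<in> hom (set_cat U) x (ob_map forget l) \<and> (\<forall>j\<in>Obj J. Comp (set_cat U) (arr_map forget (\<pi> j)) u = \<kappa> j)"
    proof (rule ex1I[of _ "(x, z, fst l)"])
      have zP: "z \<in> x \<rightarrow>\<^sub>E fst l" using z(1) by (auto simp: z_def)
      then show "(x, z, fst l) \<in> hom (set_cat U) x (ob_map forget l) \<and>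
        (\<forall>j\<in>Obj J. Comp (set_cat U) (arr_map forget (\<pi> j)) (x, z, fst l) = \<kappa> j)"
        using x Obj_ContD(1)[OF l] eq z(2) by (simp add: hom_set_cat forget_simps)
      fix u assume u: "u \<in> hom (set_cat U) x (ob_map forget l) \<and> (\<forall>j\<in>Obj J. Comp (set_cat U) (arr_map forget (\<pi> j)) u = \<kappa> j)"
      then obtain v where v: "u = (x, v, fst l)" "v \<in> x \<rightarrow>\<^sub>E fst l"
        by (auto simp: forget_simps elim: hom_set_catE)
      have "v a = z a" if a: "a \<in> x" for a
      proof -
        have "v a \<in> fst l \<and> (\<forall>j\<in>Obj J. fun_of (\<pi> j) (v a) = t j a)"
          using v u eq[OF _ v(2)] a by auto
        then show ?thesis using z1[OF a] z[OF a] by blast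
      qed
      then have "v = z" using v(2) zP by (intro PiE_ext) auto
      then show "u = (x, z, fst l)" using v(1) by simp
    qed
  qed
qed

lemma has_enough_points_Cont: "has_enough_points U E"
  unfolding has_enough_points_def
proof (intro ballI impI)
  fix h assume h: "h \<in> Arr E"
    and p: "\<forall>d i. geometric_morphism (set_cat U) E d i \<longrightarrow> iso (set_cat U) (arr_map i h)"
  obtain d where "adjoint E (set_cat U) forget d" using forget_has_right_adjoint by blast
  then have i: "iso (set_cat U) (arr_map forget h)"
    using p forget_preserves_finite_limits unfolding geometric_morphism_def by blast
  obtain f where f: "h = (Dom E h, f, Cod E h)" "(Dom E h, f, Cod E h) \<in> hom E (Dom E h) (Cod E h)"
    by (rule hom_ContE[OF Arr_hom[OF h]])
  define A B where "A = Dom E h" and "B = Cod E h"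
  have hf: "h = (A, f, B)" "(A, f, B) \<in> hom E A B" using f by (simp_all add: A_def B_def)
  have "bij_betw f (fst A) (fst B)"
    using i iso_set_cat[of "fst A" U "fst B" f] hf Obj_ContD(1) by (auto simp: forget_simps hom_Cont_iff)
  then show "iso E h" using iso_Cont[OF hf(2)] hf(1) by simp
qed

end

section \<open>The site of principal actions\<close>

text \<open>A site with an object for each open right congruence, given by a map \<open>R c\<close> choosing
  representatives. An arrow from \<open>c\<close> to \<open>d\<close> is an equivariant map between the quotients of the
  monoid, encoded by the representative \<open>el f\<close> of the image of the class of \<open>1\<close>.\<close>

locale cont_site = cont_monoid U \<tau> for U :: "'u set set" and \<tau> :: "'m::monoid_mult topology" +
  fixes C :: "('c, 'd) category" and R :: "'c \<Rightarrow> 'm \<Rightarrow> 'm" and el :: "'d \<Rightarrow> 'm"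
  assumes C: "is_category C"
    and smallC: "small U (Obj C)"
    and R: "c \<in> Obj C \<Longrightarrow> open_rep (R c)"
    and R_ex: "open_rep \<rho> \<Longrightarrow> \<exists>c\<in>Obj C. R c = \<rho>"
    and el_rep: "f \<in> hom C c d \<Longrightarrow> R d (el f * R c n) = R d (el f * n)"
    and R_el: "f \<in> hom C c d \<Longrightarrow> R d (el f) = el f"
    and el_ex: "c \<in> Obj C \<Longrightarrow> d \<in> Obj C \<Longrightarrow> (\<And>n. R d (m * R c n) = R d (m * n)) \<Longrightarrow>
      \<exists>f\<in>hom C c d. el f = R d m"
    and el_inj: "f \<in> hom C c d \<Longrightarrow> g \<in> hom C c d \<Longrightarrow> el f = el g \<Longrightarrow> f = g"
    and el_Id: "c \<in> Obj C \<Longrightarrow> el (Id C c) = R c 1"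
    and el_Comp: "f \<in> hom C b c \<Longrightarrow> g \<in> hom C c d \<Longrightarrow> el (Comp C g f) = R d (el g * el f)"
begin

text \<open>The condition says that left multiplication by \<open>m\<close> descends to the
  quotients, giving the equivariant map from the principal action at \<open>c\<close> to that at
  \<open>d\<close> which sends the class of \<open>1\<close> to that of \<open>m\<close>.\<close>

definition valid :: "'c \<Rightarrow> 'm \<Rightarrow> 'c \<Rightarrow> bool" where
  "valid c m d \<longleftrightarrow> c \<in> Obj C \<and> d \<in> Obj C \<and> (\<forall>n. R d (m * R c n) = R d (m * n))"

text \<open>Arrows are named by any element \<open>m\<close> of the right class, so that equations
  between composites become equations \<open>R d m = R d m'\<close> in the monoid.\<close>

definition arr :: "'c \<Rightarrow> 'm \<Rightarrow> 'c \<Rightarrow> 'd" where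
  "arr c m d = (THE f. f \<in> hom C c d \<and> el f = R d m)"

lemma R_simps:
  assumes "c \<in> Obj C"
  shows "R c (R c m * n) = R c (m * n)" "R c (R c m) = R c m"
  using open_repD(1,2)[OF R[OF assms]] by auto

lemma validD: "valid c m d \<Longrightarrow> c \<in> Obj C" "valid c m d \<Longrightarrow> d \<in> Obj C"
  by (simp_all add: valid_def)

lemma validI:
  assumes "c \<in> Obj C" "d \<in> Obj C" "\<And>n n'. R c n = R c n' \<Longrightarrow> R d (m * n) = R d (m * n')"
  shows "valid c m d"
  unfolding valid_def using assms(1,2) by (auto intro!: assms(3) simp: R_simps)

lemma valid_cong:
  assumes v: "valid c m d" and eq: "R c n = R c n'"
  shows "R d (m * n) = R d (m * n')"
proof -
  have "R d (m * n) = R d (m * R c n)" using v by (simp add: valid_def)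
  also have "\<dots> = R d (m * n')" unfolding eq using v by (simp add: valid_def)
  finally show ?thesis .
qed

lemma arr:
  assumes "valid c m d"
  shows "arr c m d \<in> hom C c d" "el (arr c m d) = R d m"
proof -
  obtain f where f: "f \<in> hom C c d" "el f = R d m"
    using el_ex assms unfolding valid_def by blast
  have "arr c m d = f" unfolding arr_def using f el_inj by (intro the_equality) auto
  then show "arr c m d \<in> hom C c d" "el (arr c m d) = R d m" using f by simp_all
qed

lemma valid_el: "f \<in> hom C c d \<Longrightarrow> valid c (el f) d"
  unfolding valid_def using hom_Obj[OF C] el_rep by blast

lemma arr_el: "f \<in> hom C c d \<Longrightarrow> arr c (el f) d = f"
  using el_inj[OF arr(1)[OF valid_el]] arr(2)[OF valid_el] R_el by auto

lemma arr_eqI: "R d m = R d m' \<Longrightarrow> arr c m d = arr c m' d"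
  by (simp add: arr_def)

lemma valid_Id: "c \<in> Obj C \<Longrightarrow> valid c 1 c"
  by (simp add: valid_def R_simps)

lemma arr_Id: "c \<in> Obj C \<Longrightarrow> arr c 1 c = Id C c"
  using el_inj[OF arr(1)[OF valid_Id] Id_hom[OF C]] arr(2)[OF valid_Id] el_Id by auto

lemma valid_Comp:
  assumes "valid b m c" "valid c n d"
  shows "valid b (n * m) d"
proof (rule validI)
  fix k k' assume "R b k = R b k'"
  then have "R c (m * k) = R c (m * k')" by (rule valid_cong[OF assms(1)])
  then show "R d (n * m * k) = R d (n * m * k')" unfolding mult.assoc by (rule valid_cong[OF assms(2)])
qed (use assms validD in blast)+

lemma Comp_arr:
  assumes v: "valid b m c" "valid c n d"
  shows "Comp C (arr c n d) (arr b m c) = arr b (n * m) d"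
proof (rule el_inj[OF Comp_hom[OF C arr(1)[OF v(1)] arr(1)[OF v(2)]] arr(1)[OF valid_Comp[OF v]]])
  show "el (Comp C (arr c n d) (arr b m c)) = el (arr b (n * m) d)"
    using v(2) unfolding el_Comp[OF arr(1)[OF v(1)] arr(1)[OF v(2)]] arr(2)[OF v(1)] arr(2)[OF v(2)]
      arr(2)[OF valid_Comp[OF v]] R_simps(1)[OF validD(2)[OF v(2)]] by (simp add: valid_def)
qed

lemma ex_object:
  fixes \<phi> :: "'m \<Rightarrow> 'x"
  assumes "\<And>m n k. \<phi> m = \<phi> n \<Longrightarrow> \<phi> (m * k) = \<phi> (n * k)"
    and "\<And>k l. openin \<tau> {n. \<phi> (k * n) = \<phi> (k * l)}"
  obtains c where "c \<in> Obj C" "\<And>m n. R c m = R c n \<longleftrightarrow> \<phi> m = \<phi> n"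
proof -
  obtain \<rho> where "open_rep \<rho>" "\<And>m n. \<rho> m = \<rho> n \<longleftrightarrow> \<phi> m = \<phi> n"
    using ex_open_rep[of \<phi>, OF assms] by blast
  then show ?thesis using that R_ex by metis
qed

text \<open>The kernel of \<open>k \<mapsto> (R c (m * k), R d (n * k))\<close> is again an open
  congruence, and left multiplications by \<open>m\<close> and \<open>n\<close> descend to its
  quotient. For \<open>m = n = 1\<close> this is a common refinement of \<open>c\<close> and
  \<open>d\<close>; other values produce the spans that replace pullbacks.\<close>

lemma ex_object_pair:
  assumes c: "c \<in> Obj C" and d: "d \<in> Obj C"
  obtains e where "valid e m c" "valid e n d"
proof -
  have op: "openin \<tau> {j. (R c (m * (k * j)), R d (n * (k * j))) = (R c (m * (k * l)), R d (n * (k * l)))}" for k l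
  proof -
    have "{j. (R c (m * (k * j)), R d (n * (k * j))) = (R c (m * (k * l)), R d (n * (k * l)))} =
      {j. R c ((m * k) * j) = R c (m * (k * l))} \<inter> {j. R d ((n * k) * j) = R d (n * (k * l))}"
      by (auto simp: mult.assoc)
    also have "openin \<tau> \<dots>" by (rule openin_Int; rule open_repD(3)[OF R]; rule c d)
    finally show ?thesis .
  qed
  have cong: "(R c (m * (k * j)), R d (n * (k * j))) = (R c (m * (l * j)), R d (n * (l * j)))"
    if "(R c (m * k), R d (n * k)) = (R c (m * l), R d (n * l))" for k l j
    using that open_repD(1)[OF R[OF c], of "m * k" j] open_repD(1)[OF R[OF c], of "m * l" j]
      open_repD(1)[OF R[OF d], of "n * k" j] open_repD(1)[OF R[OF d], of "n * l" j]
    by (simp add: mult.assoc)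
  obtain e where e: "e \<in> Obj C" "\<And>k l. R e k = R e l \<longleftrightarrow> (R c (m * k), R d (n * k)) = (R c (m * l), R d (n * l))"
    using ex_object[of "\<lambda>k. (R c (m * k), R d (n * k))", OF cong op] by blast
  show ?thesis
    by (rule that[of e]) (use e c d in \<open>auto intro!: validI\<close>)
qed

text \<open>An equivariant map between principal actions is onto as soon as it reaches the
  generator, the class of \<open>1\<close>; the class of \<open>k\<close> is a point over
  it.\<close>

definition surj_arr :: "'d \<Rightarrow> bool" where
  "surj_arr f \<longleftrightarrow> (\<exists>k. R (Cod C f) (el f * k) = R (Cod C f) 1)"

definition J :: "'c \<Rightarrow> 'd set set" where
  "J c = {S. sieve C c S \<and> (\<exists>f\<in>S. surj_arr f)}"

lemma surj_arrE:
  assumes "f \<in> hom C b c" "surj_arr f"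
  obtains k where "\<And>n. R c (el f * (k * n)) = R c n"
proof -
  obtain k where k: "R c (el f * k) = R c 1" using assms by (auto simp: surj_arr_def hom_def)
  have c: "c \<in> Obj C" using hom_Obj[OF C assms(1)] by blast
  have "R c (el f * (k * n)) = R c n" for n
    using R_simps(1)[OF c, of "el f * k" n] R_simps(1)[OF c, of 1 n] k by (simp add: mult.assoc)
  then show ?thesis by (rule that)
qed

lemma surj_arrI:
  assumes "f \<in> hom C b c" "R c (el f * k) = R c 1"
  shows "surj_arr f"
  using assms by (auto simp: surj_arr_def hom_def)

lemma surj_Id: "c \<in> Obj C \<Longrightarrow> surj_arr (Id C c)"
  by (rule surj_arrI[OF Id_hom[OF C], of _ 1]) (simp_all add: el_Id R_simps)

lemma surj_Comp:
  assumes f: "f \<in> hom C b c" "surj_arr f" and g: "g \<in> hom C c d" "surj_arr g"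
  shows "surj_arr (Comp C g f)"
proof -
  have d: "d \<in> Obj C" using hom_Obj[OF C g(1)] by blast
  obtain k where k: "\<And>n. R c (el f * (k * n)) = R c n" by (rule surj_arrE[OF f]) blast
  obtain l where l: "\<And>n. R d (el g * (l * n)) = R d n" by (rule surj_arrE[OF g]) blast
  have "R d (el g * (el f * (k * l))) = R d (el g * l)"
    by (rule valid_cong[OF valid_el[OF g(1)] k])
  also have "\<dots> = R d 1" using l[of 1] by simp
  finally show ?thesis
    by (intro surj_arrI[OF Comp_hom[OF C f(1) g(1)], of "k * l"])
      (simp add: el_Comp[OF f(1) g(1)] R_simps d mult.assoc)
qed

lemma surj_arr_1:
  assumes v: "valid c 1 d"
  shows "surj_arr (arr c 1 d)"
  by (rule surj_arrI[OF arr(1)[OF v], of 1]) (simp add: arr(2)[OF v] R_simps validD[OF v])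

text \<open>The pullback of a surjection need not be principal, but one of its principal sub-actions still
  surjects onto \<open>d\<close>.\<close>

lemma cover_square:
  assumes f: "f \<in> hom C b c" "surj_arr f" and h: "h \<in> hom C d c"
  obtains e g g' where "g \<in> hom C e b" "g' \<in> hom C e d" "surj_arr g'" "Comp C f g = Comp C h g'"
proof -
  have O: "b \<in> Obj C" "c \<in> Obj C" "d \<in> Obj C" using hom_Obj[OF C f(1)] hom_Obj[OF C h] by auto
  obtain k where k: "\<And>n. R c (el f * (k * n)) = R c n" by (rule surj_arrE[OF f]) blast
  \<comment> \<open>\<open>k * el h\<close> lifts the element of \<open>h\<close> along
    \<open>f\<close>, while \<open>1\<close> makes the other arrow a quotient map, hence
    onto.\<close>
  obtain e where e: "valid e (k * el h) b" "valid e 1 d"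
    by (rule ex_object_pair[OF O(1,3), of "k * el h" 1])
  have "Comp C f (arr e (k * el h) b) = Comp C h (arr e 1 d)"
  proof -
    have "Comp C f (arr e (k * el h) b) = arr e (el f * (k * el h)) c"
      using Comp_arr[OF e(1) valid_el[OF f(1)]] arr_el[OF f(1)] by simp
    also have "\<dots> = arr e (el h * 1) c" by (rule arr_eqI) (simp add: k)
    also have "\<dots> = Comp C h (arr e 1 d)"
      using Comp_arr[OF e(2) valid_el[OF h]] arr_el[OF h] by simp
    finally show ?thesis .
  qed
  then show ?thesis
    using that[OF arr(1)[OF e(1)] arr(1)[OF e(2)] surj_arr_1[OF e(2)]] by blast
qed

text \<open>Stability is \<open>cover_square\<close>, which turns a surjection in \<open>S\<close>
  into one in the pulled back sieve. Local character holds because surjections compose: a surjection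
  \<open>f\<close> in \<open>S\<close> and one in the pullback of \<open>K\<close> along
  \<open>f\<close> give one in \<open>K\<close>.\<close>

lemma grothendieck_topology_J: "grothendieck_topology C J"
  unfolding grothendieck_topology_def
proof (intro conjI ballI allI impI)
  fix x S assume "x \<in> Obj C" "S \<in> J x"
  then show "sieve C x S" by (simp add: J_def)
next
  fix x assume x: "x \<in> Obj C"
  have "sieve C x {f \<in> Arr C. Cod C f = x}"
    unfolding sieve_def using C by (auto simp: is_category_def hom_def)
  moreover have "Id C x \<in> {f \<in> Arr C. Cod C f = x}" using homD[OF Id_hom[OF C x]] by simp
  ultimately show "{f \<in> Arr C. Cod C f = x} \<in> J x" using surj_Id[OF x] unfolding J_def by blast
next
  fix h S assume h: "h \<in> Arr C" and S: "S \<in> J (Cod C h)"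
  define c d where "c = Cod C h" and "d = Dom C h"
  have hh: "h \<in> hom C d c" using Arr_hom[OF h] by (simp add: c_def d_def)
  obtain f where f: "f \<in> S" "surj_arr f" and sv: "sieve C c S" using S by (auto simp: J_def c_def)
  have fh: "f \<in> hom C (Dom C f) c" using sv f(1) by (auto simp: sieve_def hom_def)
  obtain e g g' where g: "g \<in> hom C e (Dom C f)" "g' \<in> hom C e d" "surj_arr g'" "Comp C f g = Comp C h g'"
    by (rule cover_square[OF fh f(2) hh])
  have "Comp C f g \<in> S" using sv f(1) homD[OF g(1)] unfolding sieve_def by blast
  then have "g' \<in> pullback_sieve C h S"
    using g(4) homD[OF g(2)] by (simp add: pullback_sieve_def d_def)
  moreover have "sieve C d (pullback_sieve C h S)"
    unfolding sieve_def
  proof (intro conjI ballI impI)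
    fix f g assume f: "f \<in> pullback_sieve C h S" and g: "g \<in> Arr C" "Cod C g = Dom C f"
    have fh: "f \<in> hom C (Dom C f) d" and fS: "Comp C h f \<in> S"
      using f by (auto simp: pullback_sieve_def hom_def d_def)
    have gh: "g \<in> hom C (Dom C g) (Dom C f)" using g by (simp add: hom_def)
    have "Comp C h (Comp C f g) = Comp C (Comp C h f) g" by (rule Comp_assoc[OF C gh fh hh])
    moreover have "Comp C (Comp C h f) g \<in> S"
      using sv fS g homD(2)[OF Comp_hom[OF C fh hh]] unfolding sieve_def by auto
    ultimately show "Comp C f g \<in> pullback_sieve C h S"
      using homD[OF Comp_hom[OF C gh fh]] by (simp add: pullback_sieve_def d_def)
  qed (auto simp: pullback_sieve_def d_def)
  ultimately show "pullback_sieve C h S \<in> J (Dom C h)"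
    using g(3) unfolding J_def d_def by blast
next
  fix x S K assume x: "x \<in> Obj C" and S: "S \<in> J x"
    and K: "sieve C x K \<and> (\<forall>h\<in>S. pullback_sieve C h K \<in> J (Dom C h))"
  obtain f where f: "f \<in> S" "surj_arr f" and sv: "sieve C x S" using S by (auto simp: J_def)
  have fh: "f \<in> hom C (Dom C f) x" using sv f(1) by (auto simp: sieve_def hom_def)
  obtain g where g: "g \<in> pullback_sieve C f K" "surj_arr g" using K f(1) by (auto simp: J_def)
  have gh: "g \<in> hom C (Dom C g) (Dom C f)" and gK: "Comp C f g \<in> K"
    using g(1) by (auto simp: pullback_sieve_def hom_def)
  show "K \<in> J x" using K gK surj_Comp[OF gh g(2) fh f(2)] by (auto simp: J_def)
qed


section \<open>The sheaf of a continuous action\<close>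

text \<open>The hom set from the principal action at \<open>c\<close> to \<open>A\<close>, each map
  being replaced by its value at the generator. When the monoid is a group, these are the points
  fixed by an open subgroup.\<close>

definition fixset :: "'c \<Rightarrow> ('u, 'm) mset \<Rightarrow> 'u set" where
  "fixset c A = {x \<in> fst A. \<forall>n. snd A x (R c n) = snd A x n}"

text \<open>Restriction along \<open>f\<close> is precomposition with \<open>f\<close>, read off at
  the generator. All maps are cut down to their domains because functor categories require
  extensional data.\<close>

definition Phi_ob :: "('u, 'm) mset \<Rightarrow> ('c, 'd, 'u set, 'u set_arrow) cfunctor" where
  "Phi_ob A = \<lparr>ob_map = (\<lambda>c\<in>Obj C. fixset c A),
     arr_map = (\<lambda>f\<in>Arr C. (fixset (Cod C f) A, \<lambda>x\<in>fixset (Cod C f) A. snd A x (el f), fixset (Dom C f) A))\<rparr>"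

definition Phi where
  "Phi = \<lparr>ob_map = Phi_ob,
     arr_map = (\<lambda>(A, h, B). (Phi_ob A, \<lambda>c\<in>Obj C. (fixset c A, restrict h (fixset c A), fixset c B), Phi_ob B))\<rparr>"

abbreviation Sh where "Sh \<equiv> sheaf_cat U C J"

lemma fixset_U: "A \<in> Obj E \<Longrightarrow> fixset c A \<in> U"
  by (rule small_in_U[OF U small_subset[OF U small_in[OF Obj_ContD(1)]]]) (auto simp: fixset_def)

lemma fixsetD:
  assumes "x \<in> fixset c A"
  shows "x \<in> fst A" "snd A x (R c n) = snd A x n" "R c m = R c n \<Longrightarrow> snd A x m = snd A x n"
  using assms unfolding fixset_def by (simp, simp, metis (mono_tags, lifting) mem_Collect_eq)

lemma fixsetI:
  assumes "c \<in> Obj C" "x \<in> fst A" "\<And>m n. R c m = R c n \<Longrightarrow> snd A x m = snd A x n"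
  shows "x \<in> fixset c A"
  unfolding fixset_def using assms(2) by (auto intro!: assms(3) simp: R_simps[OF assms(1)])

lemma fixset_act:
  assumes A: "A \<in> Obj E" and v: "valid b m c" and x: "x \<in> fixset c A"
  shows "snd A x m \<in> fixset b A"
proof (rule fixsetI[OF validD(1)[OF v]])
  note x1 = fixsetD(1)[OF x]
  show "snd A x m \<in> fst A" by (rule Obj_ContD(3)[OF A x1])
  fix k l assume "R b k = R b l"
  then have "snd A x (m * k) = snd A x (m * l)" by (rule fixsetD(3)[OF x valid_cong[OF v]])
  then show "snd A (snd A x m) k = snd A (snd A x m) l" by (simp add: Obj_ContD(5)[OF A x1])
qed

lemma Phi_ob_simps:
  "c \<in> Obj C \<Longrightarrow> ob_map (Phi_ob A) c = fixset c A"
  "f \<in> hom C b c \<Longrightarrow> arr_map (Phi_ob A) f = (fixset c A, \<lambda>x\<in>fixset c A. snd A x (el f), fixset b A)"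
  by (simp_all add: Phi_ob_def hom_def)

lemma is_functor_Phi_ob:
  assumes A: "A \<in> Obj E"
  shows "is_functor (op_cat C) (set_cat U) (Phi_ob A)"
proof (rule is_functorI[OF is_category_op[OF C] is_category_set_cat])
  fix c assume "c \<in> Obj (op_cat C)"
  then have c: "c \<in> Obj C" by (simp add: op_cat_def)
  show "ob_map (Phi_ob A) c \<in> Obj (set_cat U)"
    using c fixset_U[OF A] by (simp add: Phi_ob_simps set_cat_simps)
  have "snd A x (R c 1) = x" if "x \<in> fixset c A" for x
    using fixsetD(1,2)[OF that] Obj_ContD(4)[OF A] by simp
  then show "arr_map (Phi_ob A) (Id (op_cat C) c) = Id (set_cat U) (ob_map (Phi_ob A) c)"
    using c Phi_ob_simps(2)[OF Id_hom[OF C c]]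
    by (auto simp: Phi_ob_simps set_cat_simps op_cat_def el_Id intro!: restrict_ext)
next
  fix f c b assume "f \<in> hom (op_cat C) c b"
  then have f: "f \<in> hom C b c" by (simp add: hom_op_cat)
  note bc = hom_Obj[OF C f]
  show "arr_map (Phi_ob A) f \<in> hom (set_cat U) (ob_map (Phi_ob A) c) (ob_map (Phi_ob A) b)"
    using fixset_U[OF A] fixset_act[OF A valid_el[OF f]]
    by (auto simp: Phi_ob_simps(1)[OF bc(1)] Phi_ob_simps(1)[OF bc(2)] Phi_ob_simps(2)[OF f] hom_set_cat)
next
  fix f g d c b assume "f \<in> hom (op_cat C) d c" "g \<in> hom (op_cat C) c b"
  then have f: "f \<in> hom C c d" and g: "g \<in> hom C b c" by (simp_all add: hom_op_cat)
  have "snd A x (el (Comp C f g)) = snd A (snd A x (el f)) (el g)" if x: "x \<in> fixset d A" for x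
    using fixsetD(2)[OF x] Obj_ContD(5)[OF A fixsetD(1)[OF x]] by (simp add: el_Comp[OF g f])
  then show "arr_map (Phi_ob A) (Comp (op_cat C) g f) =
      Comp (set_cat U) (arr_map (Phi_ob A) g) (arr_map (Phi_ob A) f)"
    using fixset_act[OF A valid_el[OF f]]
    by (auto simp: Phi_ob_simps(2)[OF f] Phi_ob_simps(2)[OF g] Phi_ob_simps(2)[OF Comp_hom[OF C g f]]
        op_cat_def set_cat_simps compose_def intro!: restrict_ext)
qed

text \<open>A covering sieve contains a surjection \<open>f\<close>; let the class of
  \<open>k\<close> lie over the generator. A section \<open>a\<close> that restricts to
  \<open>s f\<close> satisfies \<open>a = snd A a (el f * k) = snd A (s f) k\<close>, which gives
  uniqueness and the only candidate. The other requirements follow by comparing two arrows with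
  equal composites into \<open>c\<close> on a common domain, where the matching condition
  applies.\<close>

lemma is_sheaf_Phi_ob:
  assumes A: "A \<in> Obj E"
  shows "is_sheaf C J (Phi_ob A)"
  unfolding is_sheaf_def
proof (intro ballI allI impI)
  fix c S s assume c: "c \<in> Obj C" and S: "S \<in> J c" and s: "matching_family C (Phi_ob A) S s"
  note AD = Obj_ContD[OF A]
  have sv: "sieve C c S" using S by (simp add: J_def)
  have Sh: "f \<in> hom C (Dom C f) c" if "f \<in> S" for f using sv that by (auto simp: sieve_def hom_def)
  have sf: "s f \<in> fixset b A" if "f \<in> S" "f \<in> hom C b c" for f b
  proof -
    have "s f \<in> ob_map (Phi_ob A) (Dom C f)" using s that(1) unfolding matching_family_def by blast
    then show ?thesis using homD(2)[OF that(2)] hom_Obj(1)[OF C that(2)] by (simp add: Phi_ob_simps)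
  qed
  have match: "s (Comp C f g) = snd A (s f) (el g)" if f: "f \<in> S" "f \<in> hom C b c" and g: "g \<in> hom C e b" for f g b e
  proof -
    have "s (Comp C f g) = fun_of (arr_map (Phi_ob A) g) (s f)"
      using s f homD[OF g] homD[OF f(2)] unfolding matching_family_def by simp
    then show ?thesis using sf[OF f] by (simp add: Phi_ob_simps(2)[OF g] fun_of_def)
  qed
  obtain f where f: "f \<in> S" "surj_arr f" using S by (auto simp: J_def)
  define b where "b = Dom C f"
  have fh: "f \<in> hom C b c" using Sh[OF f(1)] by (simp add: b_def)
  have b: "b \<in> Obj C" using hom_Obj[OF C fh] by blast
  obtain k where k: "\<And>n. R c (el f * (k * n)) = R c n" by (rule surj_arrE[OF fh f(2)]) blast
  note sfb = sf[OF f(1) fh]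
  define a where "a = snd A (s f) k"
  have an: "snd A a n = snd A (s f) (k * n)" for n
    unfolding a_def using AD(5)[OF fixsetD(1)[OF sfb]] by simp
  have afix: "a \<in> fixset c A"
  proof (rule fixsetI[OF c])
    show "a \<in> fst A" unfolding a_def by (rule AD(3)[OF fixsetD(1)[OF sfb]])
    fix m n assume mn: "R c m = R c n"
    \<comment> \<open>Both \<open>k * m\<close> and \<open>k * n\<close> lift the same class along
      \<open>f\<close>, so the two arrows from \<open>e\<close> have equal composites with
      \<open>f\<close>, and \<open>s f\<close> restricts equally along them.\<close>
    obtain e where e: "valid e (k * m) b" "valid e (k * n) b"
      by (rule ex_object_pair[OF b b, of "k * m" "k * n"])
    have "Comp C f (arr e (k * m) b) = Comp C f (arr e (k * n) b)"
      using Comp_arr[OF e(1) valid_el[OF fh]] Comp_arr[OF e(2) valid_el[OF fh]] arr_el[OF fh]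
        arr_eqI[of c "el f * (k * m)" "el f * (k * n)" e] k mn by simp
    then have "snd A (s f) (R b (k * m)) = snd A (s f) (R b (k * n))"
      using match[OF f(1) fh arr(1)[OF e(1)]] match[OF f(1) fh arr(1)[OF e(2)]] by (simp add: arr(2) e)
    then show "snd A a m = snd A a n" unfolding an by (simp add: fixsetD(2)[OF sfb])
  qed
  have ar: "fun_of (arr_map (Phi_ob A) g) y = snd A y (el g)" if "y \<in> fixset c A" "g \<in> hom C d c" for y g d
    using that by (simp add: Phi_ob_simps(2)[OF that(2)] fun_of_def)
  have aS: "snd A a (el g) = s g" if g: "g \<in> S" for g
  proof -
    define d where "d = Dom C g"
    have gh: "g \<in> hom C d c" using Sh[OF g] by (simp add: d_def)
    have d: "d \<in> Obj C" using hom_Obj[OF C gh] by blast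
    note sgd = sf[OF g gh]
    \<comment> \<open>The same comparison between \<open>f\<close> and \<open>g\<close>: both
      composites from \<open>e\<close> to \<open>c\<close> are represented by
      \<open>el g\<close>.\<close>
    obtain e where e: "valid e (k * el g) b" "valid e 1 d"
      by (rule ex_object_pair[OF b d, of "k * el g" 1])
    have "Comp C f (arr e (k * el g) b) = Comp C g (arr e 1 d)"
      using Comp_arr[OF e(1) valid_el[OF fh]] Comp_arr[OF e(2) valid_el[OF gh]] arr_el[OF fh] arr_el[OF gh]
        arr_eqI[of c "el f * (k * el g)" "el g * 1" e] k by simp
    then have "snd A (s f) (R b (k * el g)) = snd A (s g) (R d 1)"
      using match[OF f(1) fh arr(1)[OF e(1)]] match[OF g gh arr(1)[OF e(2)]] by (simp add: arr(2) e)
    then show ?thesis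
      unfolding an by (simp add: fixsetD(2)[OF sfb] fixsetD(2)[OF sgd] AD(4)[OF fixsetD(1)[OF sgd]])
  qed
  show "\<exists>!a. a \<in> ob_map (Phi_ob A) c \<and> (\<forall>f\<in>S. fun_of (arr_map (Phi_ob A) f) a = s f)"
  proof (rule ex1I[of _ a])
    show "a \<in> ob_map (Phi_ob A) c \<and> (\<forall>f\<in>S. fun_of (arr_map (Phi_ob A) f) a = s f)"
      using afix ar[OF afix Sh] aS by (simp add: Phi_ob_simps c)
    fix y assume y: "y \<in> ob_map (Phi_ob A) c \<and> (\<forall>f\<in>S. fun_of (arr_map (Phi_ob A) f) y = s f)"
    then have yf: "y \<in> fixset c A" by (simp add: Phi_ob_simps c)
    have "snd A y (el f) = s f" using y ar[OF yf fh] f(1) by simp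
    then have "a = snd A y (el f * (k * 1))" using AD(5)[OF fixsetD(1)[OF yf]] by (simp add: a_def)
    also have "\<dots> = snd A y 1" by (rule fixsetD(3)[OF yf k])
    finally show "y = a" by (simp add: AD(4)[OF fixsetD(1)[OF yf]])
  qed
qed

section \<open>The functor from continuous actions to sheaves\<close>

lemma Obj_sheaf_cat: "P \<in> Obj Sh \<longleftrightarrow> P \<in> Obj (presheaf_cat U C) \<and> is_sheaf C J P"
  by (simp add: sheaf_cat_def full_subcat_def)

lemma hom_sheaf_cat: "hom Sh P Q = (if is_sheaf C J P \<and> is_sheaf C J Q then hom (presheaf_cat U C) P Q else {})"
  by (simp add: sheaf_cat_def hom_full_subcat)

lemma Id_Comp_sheaf_cat: "Id Sh = Id (presheaf_cat U C)" "Comp Sh = Comp (presheaf_cat U C)"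
  by (simp_all add: sheaf_cat_def full_subcat_def)

lemma is_category_presheaf_cat: "is_category (presheaf_cat U C)"
  by (rule is_category_functor_cat[OF is_category_op[OF C] is_category_set_cat])

lemma is_category_sheaf_cat: "is_category Sh"
  unfolding sheaf_cat_def by (rule is_category_full_subcat[OF is_category_presheaf_cat])

lemma Phi_ob_presheaf: "A \<in> Obj E \<Longrightarrow> Phi_ob A \<in> Obj (presheaf_cat U C)"
  unfolding Obj_functor_cat using is_functor_Phi_ob by (simp add: Phi_ob_def op_cat_def)

lemma Phi_ob_sheaf: "A \<in> Obj E \<Longrightarrow> Phi_ob A \<in> Obj Sh"
  by (simp add: Obj_sheaf_cat Phi_ob_presheaf is_sheaf_Phi_ob)

lemma Phi_simps: "ob_map Phi A = Phi_ob A"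
  "arr_map Phi (A, h, B) = (Phi_ob A, \<lambda>c\<in>Obj C. (fixset c A, restrict h (fixset c A), fixset c B), Phi_ob B)"
  by (simp_all add: Phi_def)

lemma fixset_hom:
  assumes h: "(A, h, B) \<in> hom E A B" and x: "x \<in> fixset c A"
  shows "h x \<in> fixset c B"
proof -
  note x1 = fixsetD(1)[OF x]
  have "h (snd A x (R c n)) = h (snd A x n)" for n by (simp only: fixsetD(2)[OF x])
  then have "snd B (h x) (R c n) = snd B (h x) n" for n by (simp only: hom_ContD(5)[OF h x1])
  then show ?thesis using hom_ContD(4)[OF h x1] by (simp add: fixset_def)
qed

lemma Phi_hom:
  assumes h: "(A, h, B) \<in> hom E A B"
  shows "arr_map Phi (A, h, B) \<in> hom Sh (Phi_ob A) (Phi_ob B)"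
proof -
  note A = hom_ContD(1)[OF h] and B = hom_ContD(2)[OF h]
  let ?n = "\<lambda>c\<in>Obj C. (fixset c A, restrict h (fixset c A), fixset c B)"
  have "nat_trans (op_cat C) (set_cat U) (Phi_ob A) (Phi_ob B) ?n"
  proof (rule nat_transI[OF is_functor_Phi_ob[OF A] is_functor_Phi_ob[OF B]])
    fix c assume "c \<in> Obj (op_cat C)"
    then have c: "c \<in> Obj C" by (simp add: op_cat_def)
    show "?n c \<in> hom (set_cat U) (ob_map (Phi_ob A) c) (ob_map (Phi_ob B) c)"
      using c fixset_U[OF A] fixset_U[OF B] fixset_hom[OF h] by (auto simp: Phi_ob_simps hom_set_cat)
  next
    fix f c b assume "f \<in> hom (op_cat C) c b"
    then have f: "f \<in> hom C b c" by (simp add: hom_op_cat)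
    note bc = hom_Obj[OF C f]
    show "Comp (set_cat U) (?n b) (arr_map (Phi_ob A) f) = Comp (set_cat U) (arr_map (Phi_ob B) f) (?n c)"
      using bc fixset_act[OF A valid_el[OF f]] fixset_hom[OF h] hom_ContD(5)[OF h fixsetD(1)]
      by (auto simp: Phi_ob_simps(2)[OF f] set_cat_simps compose_def intro!: restrict_ext)
  qed
  then show ?thesis
    using Phi_ob_presheaf[OF A] Phi_ob_presheaf[OF B] is_sheaf_Phi_ob[OF A] is_sheaf_Phi_ob[OF B]
    by (simp add: Phi_simps hom_sheaf_cat hom_functor_cat op_cat_def)
qed

lemma is_functor_Phi: "is_functor E Sh Phi"
proof (rule is_functorI[OF is_category_Cont is_category_sheaf_cat])
  fix A assume A: "A \<in> Obj E"
  show "ob_map Phi A \<in> Obj Sh" using Phi_ob_sheaf[OF A] by (simp add: Phi_simps)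
  have "restrict (\<lambda>x\<in>fst A. x) (fixset c A) = (\<lambda>x\<in>fixset c A. x)" for c
    by (auto simp: fixset_def intro!: restrict_ext)
  then show "arr_map Phi (Id E A) = Id Sh (ob_map Phi A)"
    by (auto simp: Id_Cont Phi_simps Id_Comp_sheaf_cat Comp_functor_cat op_cat_def set_cat_simps
        Phi_ob_simps intro!: restrict_ext)
next
  fix g A B assume "g \<in> hom E A B"
  then obtain h where h: "g = (A, h, B)" "(A, h, B) \<in> hom E A B" by (rule hom_ContE)
  show "arr_map Phi g \<in> hom Sh (ob_map Phi A) (ob_map Phi B)"
    using Phi_hom[OF h(2)] by (simp add: h(1) Phi_simps(1))
next
  fix g h A B Z assume g: "g \<in> hom E A B" and h: "h \<in> hom E B Z"
  obtain u where u: "g = (A, u, B)" "(A, u, B) \<in> hom E A B" by (rule hom_ContE[OF g])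
  obtain v where v: "h = (B, v, Z)" "(B, v, Z) \<in> hom E B Z" by (rule hom_ContE[OF h])
  have "restrict (compose (fst A) v u) (fixset c A) =
      compose (fixset c A) (restrict v (fixset c B)) (restrict u (fixset c A))" for c
    using fixset_hom[OF u(2)] fixsetD(1)[of _ c A] by (auto simp: compose_def intro!: restrict_ext)
  then show "arr_map Phi (Comp E h g) = Comp Sh (arr_map Phi h) (arr_map Phi g)"
    by (auto simp: u(1) v(1) Comp_Cont Phi_simps Id_Comp_sheaf_cat Comp_functor_cat op_cat_def set_cat_simps
        intro!: restrict_ext)
qed

section \<open>Kernels of points and full faithfulness\<close>

lemma ex_kernel:
  assumes A: "A \<in> Obj E" and x: "x \<in> fst A"
  obtains c where "c \<in> Obj C" "x \<in> fixset c A" "\<And>m n. R c m = R c n \<longleftrightarrow> snd A x m = snd A x n"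
proof -
  obtain c where c: "c \<in> Obj C" "\<And>m n. R c m = R c n \<longleftrightarrow> snd A x m = snd A x n"
    by (rule ex_object[of "snd A x"]) (use Obj_ContD[OF A] x in auto)
  show ?thesis by (rule that[OF c(1) fixsetI[OF c(1) x] c(2)]) (simp add: c(2))
qed

text \<open>The value at \<open>x\<close> is forced to be that of the component at the kernel of
  \<open>x\<close>. Naturality along quotient maps shows that the components at all congruences
  contained in this kernel agree there, and naturality along the arrow represented by
  \<open>m\<close> gives equivariance.\<close>

lemma Phi_fully_faithful:
  assumes A: "A \<in> Obj E" and B: "B \<in> Obj E" and g: "g \<in> hom Sh (Phi_ob A) (Phi_ob B)"
  shows "\<exists>!f. f \<in> hom E A B \<and> arr_map Phi f = g"
proof -
  obtain \<eta> where ge: "g = (Phi_ob A, \<eta>, Phi_ob B)" and n: "nat_trans (op_cat C) (set_cat U) (Phi_ob A) (Phi_ob B) \<eta>"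
    and ext: "\<eta> \<in> extensional (Obj C)"
    using g by (auto simp: hom_sheaf_cat hom_functor_cat op_cat_def split: if_splits)
  define u where "u c = fun_of (\<eta> c)" for c
  have u: "\<eta> c = (fixset c A, u c, fixset c B)" "u c \<in> fixset c A \<rightarrow>\<^sub>E fixset c B" if c: "c \<in> Obj C" for c
  proof -
    have "\<eta> c \<in> hom (set_cat U) (fixset c A) (fixset c B)"
      using nat_transD(3)[OF n, of c] c by (simp add: op_cat_def Phi_ob_simps)
    then obtain f where "\<eta> c = (fixset c A, f, fixset c B)" "f \<in> fixset c A \<rightarrow>\<^sub>E fixset c B"
      by (rule hom_set_catE)
    then show "\<eta> c = (fixset c A, u c, fixset c B)" "u c \<in> fixset c A \<rightarrow>\<^sub>E fixset c B"
      by (simp_all add: u_def fun_of_def)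
  qed
  have nat: "u b (snd A x m) = snd B (u c x) m" if v: "valid b m c" and x: "x \<in> fixset c A" for b m c x
  proof -
    let ?f = "arr b m c"
    note f = arr(1)[OF v]
    note bc = validD[OF v]
    have x': "u c x \<in> fixset c B" using u(2)[OF bc(2)] x by auto
    have "Comp (set_cat U) (\<eta> b) (arr_map (Phi_ob A) ?f) = Comp (set_cat U) (arr_map (Phi_ob B) ?f) (\<eta> c)"
      by (rule nat_transD(4)[OF n]) (simp add: hom_op_cat f)
    then have "compose (fixset c A) (u b) (\<lambda>x\<in>fixset c A. snd A x (el ?f)) =
        compose (fixset c A) (\<lambda>x\<in>fixset c B. snd B x (el ?f)) (u c)"
      by (simp add: u(1) bc Phi_ob_simps(2)[OF f] set_cat_simps)
    from fun_cong[OF this, of x] have "u b (snd A x (el ?f)) = snd B (u c x) (el ?f)"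
      using x x' by (simp add: compose_def)
    then show ?thesis unfolding arr(2)[OF v] fixsetD(2)[OF x] fixsetD(2)[OF x'] .
  qed
  define K where "K x c \<longleftrightarrow> c \<in> Obj C \<and> x \<in> fixset c A \<and> (\<forall>m n. R c m = R c n \<longleftrightarrow> snd A x m = snd A x n)" for x c
  have "\<exists>c. K x c" if "x \<in> fst A" for x
    by (rule ex_kernel[OF A that]) (unfold K_def, blast)
  then obtain kr where K: "\<And>x. x \<in> fst A \<Longrightarrow> K x (kr x)" by metis
  have kr: "kr x \<in> Obj C" "x \<in> fixset (kr x) A" "R (kr x) m = R (kr x) n \<longleftrightarrow> snd A x m = snd A x n"
    if "x \<in> fst A" for x m n
    using K[OF that] unfolding K_def by blast+
  define h where "h = (\<lambda>x\<in>fst A. u (kr x) x)"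
  have hu: "h x = u c x" if c: "c \<in> Obj C" and x: "x \<in> fixset c A" for c x
  proof -
    note x1 = fixsetD(1)[OF x]
    \<comment> \<open>The congruence at \<open>c\<close> is contained in the kernel of
      \<open>x\<close>, so \<open>1\<close> represents a quotient map.\<close>
    have "valid c 1 (kr x)"
    proof (rule validI[OF c kr(1)[OF x1]])
      fix n n' assume "R c n = R c n'"
      then have "snd A x n = snd A x n'" by (rule fixsetD(3)[OF x])
      then show "R (kr x) (1 * n) = R (kr x) (1 * n')" by (simp add: kr(3)[OF x1])
    qed
    from nat[OF this kr(2)[OF x1]] have "u c x = snd B (u (kr x) x) 1"
      by (simp add: Obj_ContD(4)[OF A x1])
    also have "\<dots> = u (kr x) x"
      using u(2)[OF kr(1)[OF x1]] kr(2)[OF x1] by (intro Obj_ContD(4)[OF B] fixsetD(1)[of _ "kr x"]) auto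
    finally show ?thesis using x1 by (simp add: h_def)
  qed
  have "h (snd A x m) = snd B (h x) m" if x: "x \<in> fst A" for x m
  proof -
    let ?y = "snd A x m"
    have y: "?y \<in> fst A" by (rule Obj_ContD(3)[OF A x])
    \<comment> \<open>The orbit of \<open>snd A x m\<close> sits inside that of \<open>x\<close>,
      and \<open>m\<close> represents the inclusion.\<close>
    have "valid (kr ?y) m (kr x)"
      by (rule validI[OF kr(1)[OF y] kr(1)[OF x]]) (simp add: kr(3)[OF x] kr(3)[OF y] Obj_ContD(5)[OF A x])
    from nat[OF this kr(2)[OF x]] show ?thesis using x y by (simp add: h_def)
  qed
  moreover have "h \<in> fst A \<rightarrow>\<^sub>E fst B"
    using u(2)[OF kr(1)] kr(2) fixsetD(1) by (fastforce simp: h_def)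
  ultimately have hh: "(A, h, B) \<in> hom E A B" unfolding hom_Cont_iff using A B by blast
  have res: "restrict v (fixset c A) = u c \<longleftrightarrow> (\<forall>x\<in>fixset c A. v x = u c x)" if c: "c \<in> Obj C" for c v
    using u(2)[OF c] by (auto simp: PiE_def extensional_def fun_eq_iff restrict_def)
  have iff: "arr_map Phi (A, v, B) = g \<longleftrightarrow> (\<forall>c\<in>Obj C. \<forall>x\<in>fixset c A. v x = u c x)" for v
  proof -
    have "arr_map Phi (A, v, B) = g \<longleftrightarrow> (\<lambda>c\<in>Obj C. (fixset c A, restrict v (fixset c A), fixset c B)) = \<eta>"
      by (simp add: Phi_simps ge)
    also have "\<dots> \<longleftrightarrow> (\<forall>c\<in>Obj C. (fixset c A, restrict v (fixset c A), fixset c B) = \<eta> c)"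
      using ext by (auto simp: extensional_def fun_eq_iff restrict_def)
    also have "\<dots> \<longleftrightarrow> (\<forall>c\<in>Obj C. \<forall>x\<in>fixset c A. v x = u c x)" using u(1) res by simp
    finally show ?thesis .
  qed
  show ?thesis
  proof (rule ex1I[of _ "(A, h, B)"])
    show "(A, h, B) \<in> hom E A B \<and> arr_map Phi (A, h, B) = g" using hh iff hu by blast
    fix f assume f: "f \<in> hom E A B \<and> arr_map Phi f = g"
    then obtain v where v: "f = (A, v, B)" "(A, v, B) \<in> hom E A B" by (metis hom_ContE)
    have "v = h"
    proof (rule hom_Cont_eq[OF v(2) hh])
      fix x assume x: "x \<in> fst A"
      have "\<forall>c\<in>Obj C. \<forall>x\<in>fixset c A. v x = u c x" using f iff v(1) by simp
      then show "v x = h x" using kr(1,2)[OF x] x by (simp add: h_def)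
    qed
    then show "f = (A, h, B)" using v(1) by simp
  qed
qed

end

section \<open>The continuous action of a sheaf\<close>

context cont_site
begin

context
  fixes P :: "('c, 'd, 'u set, 'u set_arrow) cfunctor"
  assumes P: "P \<in> Obj Sh"
begin

section \<open>Restriction maps of a sheaf and gluing along quotient maps\<close>

abbreviation (input) ob where "ob \<equiv> ob_map P"

text \<open>The arguments follow the arrow from \<open>b\<close> to \<open>c\<close>, while the
  restriction map goes from \<open>ob c\<close> to \<open>ob b\<close>. It is written like an action
  because for \<open>Phi_ob A\<close> it is \<open>x \<mapsto> snd A x m\<close>.\<close>

definition act :: "'c \<Rightarrow> 'm \<Rightarrow> 'c \<Rightarrow> 'u \<Rightarrow> 'u" where
  "act b m c x = fun_of (arr_map P (arr b m c)) x"

lemma P_functor: "is_functor (op_cat C) (set_cat U) P"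
  using P by (simp add: Obj_sheaf_cat Obj_functor_cat)

lemma P_ob: "c \<in> Obj C \<Longrightarrow> ob c \<in> U"
  using is_functorD(3)[OF P_functor, of c] by (simp add: op_cat_def set_cat_simps)

lemma P_arr:
  assumes f: "f \<in> hom C b c"
  shows "arr_map P f = (ob c, fun_of (arr_map P f), ob b)" "fun_of (arr_map P f) \<in> ob c \<rightarrow>\<^sub>E ob b"
proof -
  have "f \<in> hom (op_cat C) c b" using f by (simp add: hom_op_cat)
  from is_functorD(4)[OF P_functor this]
  obtain w where "arr_map P f = (ob c, w, ob b)" "w \<in> ob c \<rightarrow>\<^sub>E ob b" by (rule hom_set_catE)
  then show "arr_map P f = (ob c, fun_of (arr_map P f), ob b)" "fun_of (arr_map P f) \<in> ob c \<rightarrow>\<^sub>E ob b"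
    by (simp_all add: fun_of_def)
qed

lemma fun_of_act: "f \<in> hom C b c \<Longrightarrow> fun_of (arr_map P f) x = act b (el f) c x"
  by (simp add: act_def arr_el)

lemma act_in:
  assumes "valid b m c" "x \<in> ob c"
  shows "act b m c x \<in> ob b"
  using P_arr(2)[OF arr(1)[OF assms(1)]] assms(2) unfolding act_def by auto

lemma act_1:
  assumes "c \<in> Obj C" "x \<in> ob c"
  shows "act c 1 c x = x"
proof -
  have "arr_map P (Id C c) = (ob c, \<lambda>x\<in>ob c. x, ob c)"
    using is_functorD(5)[OF P_functor, of c] assms(1) by (simp add: op_cat_def set_cat_simps)
  then show ?thesis using assms by (simp add: act_def arr_Id fun_of_def)
qed

lemma act_act:
  assumes v: "valid b m c" "valid c n d" and x: "x \<in> ob d"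
  shows "act b m c (act c n d x) = act b (n * m) d x"
proof -
  note f = arr(1)[OF v(1)] and g = arr(1)[OF v(2)]
  have "arr_map P (Comp C (arr c n d) (arr b m c)) = Comp (set_cat U) (arr_map P (arr b m c)) (arr_map P (arr c n d))"
    using is_functorD(6)[OF P_functor, of "arr c n d" d c "arr b m c" b] f g
    by (simp add: hom_op_cat, simp add: op_cat_def)
  also have "\<dots> = Comp (set_cat U) (ob c, fun_of (arr_map P (arr b m c)), ob b) (ob d, fun_of (arr_map P (arr c n d)), ob c)"
    using P_arr(1)[OF f] P_arr(1)[OF g] by simp
  finally have "fun_of (arr_map P (arr b (n * m) d)) = compose (ob d) (fun_of (arr_map P (arr b m c))) (fun_of (arr_map P (arr c n d)))"
    unfolding Comp_arr[OF v] by (simp add: set_cat_simps fun_of_def)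
  from fun_cong[OF this, of x] show ?thesis using x by (simp add: act_def compose_def)
qed

lemma act_cong: "R c m = R c m' \<Longrightarrow> act b m c x = act b m' c x"
  unfolding act_def by (drule arr_eqI) (rule arg_cong)

text \<open>The sheaf condition for the sieve generated by the quotient map from \<open>e\<close> to
  \<open>c\<close>. Two arrows into \<open>e\<close> have the same composite with it exactly when
  their elements agree under \<open>R c\<close>, so the last hypothesis says that the restrictions
  of \<open>y\<close> form a well-defined matching family.\<close>

lemma act_glue:
  assumes v: "valid e 1 c" and y: "y \<in> ob e"
    and comp: "\<And>b m m'. valid b m e \<Longrightarrow> valid b m' e \<Longrightarrow> R c m = R c m' \<Longrightarrow> act b m e y = act b m' e y"
  shows "\<exists>!x. x \<in> ob c \<and> act e 1 c x = y"
proof -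
  note ec = validD[OF v]
  let ?g = "arr e 1 c"
  note g = arr(1)[OF v]
  define S where "S = {Comp C ?g f |b f. f \<in> hom C b e}"
  have sv: "sieve C c S"
    unfolding sieve_def
  proof (intro conjI ballI impI)
    show "S \<subseteq> {f \<in> Arr C. Cod C f = c}"
      using Comp_hom[OF C _ g] by (auto simp: S_def hom_def)
    fix k h assume k: "k \<in> S" and h: "h \<in> Arr C" "Cod C h = Dom C k"
    obtain b f where f: "k = Comp C ?g f" "f \<in> hom C b e" using k by (auto simp: S_def)
    have hb: "h \<in> hom C (Dom C h) b" using h homD(2)[OF Comp_hom[OF C f(2) g]] f(1) by (simp add: hom_def)
    then show "Comp C k h \<in> S"
      using Comp_assoc[OF C hb f(2) g] Comp_hom[OF C hb f(2)] unfolding f(1) S_def by force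
  qed
  have "Comp C ?g (Id C e) = ?g" by (rule Comp_Id(1)[OF C g])
  then have gS: "?g \<in> S" unfolding S_def using Id_hom[OF C ec(1)] by force
  have SJ: "S \<in> J c" using sv gS surj_arr_1[OF v] by (auto simp: J_def)
  \<comment> \<open>An arrow of the sieve may factor through the quotient map in several ways; one
    is chosen, and \<open>comp\<close> shows that the restriction of \<open>y\<close> does not
    depend on it.\<close>
  define s where "s k = fun_of (arr_map P (SOME f. f \<in> hom C (Dom C k) e \<and> Comp C ?g f = k)) y" for k
  have s: "s (Comp C ?g f) = act b (el f) e y" if f: "f \<in> hom C b e" for b f
  proof -
    let ?k = "Comp C ?g f"
    have dk: "Dom C ?k = b" using homD(2)[OF Comp_hom[OF C f g]] .
    define f' where "f' = (SOME f. f \<in> hom C b e \<and> Comp C ?g f = ?k)"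
    have f': "f' \<in> hom C b e \<and> Comp C ?g f' = ?k"
      unfolding f'_def by (rule someI[of _ f]) (simp add: f)
    have e: "el (Comp C ?g h) = R c (el h)" if "h \<in> hom C b e" for h
      using el_Comp[OF that g] R_simps(1)[OF ec(2), of 1 "el h"] by (simp add: arr(2)[OF v])
    have "R c (el f') = R c (el f)" using f' e[OF f] e[of f'] by simp
    then have "act b (el f') e y = act b (el f) e y"
      by (intro comp valid_el f) (use f' in auto)
    then show ?thesis unfolding s_def dk f'_def[symmetric] using fun_of_act f' by auto
  qed
  have mf: "matching_family C P S s"
    unfolding matching_family_def
  proof (intro conjI ballI impI)
    fix k assume "k \<in> S"
    then obtain b f where f: "k = Comp C ?g f" "f \<in> hom C b e" by (auto simp: S_def)
    have dk: "Dom C k = b" unfolding f(1) by (rule homD(2)[OF Comp_hom[OF C f(2) g]])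
    show "s k \<in> ob (Dom C k)" unfolding dk unfolding f(1) s[OF f(2)] by (rule act_in[OF valid_el[OF f(2)] y])
    fix h assume h: "h \<in> Arr C" "Cod C h = Dom C k"
    define a where "a = Dom C h"
    have hh: "h \<in> hom C a b" using h dk by (simp add: hom_def a_def)
    have "s (Comp C k h) = s (Comp C ?g (Comp C f h))"
      unfolding f(1) by (simp add: Comp_assoc[OF C hh f(2) g])
    also have "\<dots> = act a (el (Comp C f h)) e y" by (rule s[OF Comp_hom[OF C hh f(2)]])
    also have "\<dots> = act a (el f * el h) e y"
      by (rule act_cong) (simp add: el_Comp[OF hh f(2)] R_simps ec)
    also have "\<dots> = act a (el h) b (act b (el f) e y)"
      by (rule act_act[OF valid_el[OF hh] valid_el[OF f(2)] y, symmetric])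
    also have "\<dots> = fun_of (arr_map P h) (s k)"
      by (simp add: fun_of_act[OF hh] f(1) s[OF f(2)])
    finally show "s (Comp C k h) = fun_of (arr_map P h) (s k)" .
  qed
  have "\<exists>!a. a \<in> ob c \<and> (\<forall>f\<in>S. fun_of (arr_map P f) a = s f)"
    using P ec(2) SJ mf unfolding Obj_sheaf_cat is_sheaf_def by blast
  moreover have "(\<forall>f\<in>S. fun_of (arr_map P f) x = s f) \<longleftrightarrow> act e 1 c x = y" if x: "x \<in> ob c" for x
  proof
    assume "\<forall>f\<in>S. fun_of (arr_map P f) x = s f"
    then have "act e 1 c x = s ?g" using gS by (simp add: act_def)
    also have "\<dots> = act e (el (Id C e)) e y"
      using s[OF Id_hom[OF C ec(1)]] Comp_Id(1)[OF C g] by simp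
    also have "\<dots> = act e 1 e y" by (rule act_cong) (simp add: el_Id R_simps ec)
    finally show "act e 1 c x = y" by (simp add: act_1[OF ec(1) y])
  next
    assume xy: "act e 1 c x = y"
    show "\<forall>f\<in>S. fun_of (arr_map P f) x = s f"
    proof
      fix k assume "k \<in> S"
      then obtain b f where f: "k = Comp C ?g f" "f \<in> hom C b e" by (auto simp: S_def)
      have "k = arr b (1 * el f) c" unfolding f(1) using Comp_arr[OF valid_el[OF f(2)] v] arr_el[OF f(2)] by simp
      then have "fun_of (arr_map P k) x = act b (1 * el f) c x" by (simp add: act_def)
      also have "\<dots> = act b (el f) e y" using act_act[OF valid_el[OF f(2)] v x] xy by simp
      finally show "fun_of (arr_map P k) x = s k" by (simp add: f(1) s[OF f(2)])
    qed
  qed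
  ultimately show ?thesis by (metis (no_types, lifting))
qed

text \<open>This is the uniqueness part of \<open>act_glue\<close>, applied to the restriction of
  \<open>y\<close> itself, which certainly satisfies the gluing condition.\<close>

lemma act_inj:
  assumes v: "valid e 1 c" and xy: "x \<in> ob c" "y \<in> ob c" "act e 1 c x = act e 1 c y"
  shows "x = y"
proof -
  have "\<exists>!z. z \<in> ob c \<and> act e 1 c z = act e 1 c y"
  proof (rule act_glue[OF v act_in[OF v xy(2)]])
    fix b m m' assume "valid b m e" "valid b m' e" "R c m = R c m'"
    then show "act b m e (act e 1 c y) = act b m' e (act e 1 c y)"
      using act_act[OF _ v xy(2)] act_cong[of c m m'] by simp
  qed
  then show ?thesis using xy by blast
qed

section \<open>The filtered colimit of a sheaf and its action\<close>

definition elems :: "('c \<times> 'u) set" where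
  "elems = (SIGMA c:Obj C. ob c)"

text \<open>Equality in the colimit over quotient maps: the two sections agree on a common
  refinement of \<open>c\<close> and \<open>d\<close>.\<close>

definition germ_rel :: "(('c \<times> 'u) \<times> ('c \<times> 'u)) set" where
  "germ_rel = {((c, x), (d, y)) | c x d y. (c, x) \<in> elems \<and> (d, y) \<in> elems \<and>
     (\<exists>e. valid e 1 c \<and> valid e 1 d \<and> act e 1 c x = act e 1 d y)}"

lemma germ_relI:
  "valid e 1 c \<Longrightarrow> valid e 1 d \<Longrightarrow> x \<in> ob c \<Longrightarrow> y \<in> ob d \<Longrightarrow> act e 1 c x = act e 1 d y \<Longrightarrow>
    ((c, x), (d, y)) \<in> germ_rel"
  unfolding germ_rel_def elems_def using validD by blast

lemma germ_relE:
  assumes "((c, x), (d, y)) \<in> germ_rel"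
  obtains e where "valid e 1 c" "valid e 1 d" "act e 1 c x = act e 1 d y" "x \<in> ob c" "y \<in> ob d"
  using assms unfolding germ_rel_def elems_def by auto

text \<open>To act by \<open>m\<close> on a germ, a section is restricted along some arrow
  represented by \<open>m\<close>; the result must depend neither on the section nor on the source
  of the arrow.\<close>

lemma germ_rel_act:
  assumes r: "((c, x), (d, y)) \<in> germ_rel" and v: "valid e m c" "valid e' m d"
  shows "((e, act e m c x), (e', act e' m d y)) \<in> germ_rel"
proof -
  obtain g where g: "valid g 1 c" "valid g 1 d" "act g 1 c x = act g 1 d y" and xy: "x \<in> ob c" "y \<in> ob d"
    by (rule germ_relE[OF r])
  obtain h where h: "valid h 1 e" "valid h 1 e'"
    by (rule ex_object_pair[OF validD(1)[OF v(1)] validD(1)[OF v(2)], of 1 1])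
  \<comment> \<open>\<open>f\<close> refines \<open>e\<close> and \<open>e'\<close>, and
    \<open>m\<close> represents an arrow from it to \<open>g\<close>, where the two sections already
    agree.\<close>
  obtain f where f: "valid f 1 h" "valid f m g"
    by (rule ex_object_pair[OF validD(1)[OF h(1)] validD(1)[OF g(1)], of 1 m])
  have fe: "valid f 1 e" "valid f 1 e'" using valid_Comp[OF f(1) h(1)] valid_Comp[OF f(1) h(2)] by simp_all
  have "act f 1 e (act e m c x) = act f m g (act g 1 c x)"
    by (simp add: act_act[OF fe(1) v(1) xy(1)] act_act[OF f(2) g(1) xy(1)])
  also have "\<dots> = act f 1 e' (act e' m d y)"
    by (simp add: g(3) act_act[OF fe(2) v(2) xy(2)] act_act[OF f(2) g(2) xy(2)])
  finally show ?thesis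
    by (rule germ_relI[OF fe act_in[OF v(1) xy(1)] act_in[OF v(2) xy(2)]])
qed

text \<open>Sections over \<open>c\<close> inject into the colimit because restriction along
  quotient maps is injective.\<close>

lemma germ_rel_same:
  assumes "((c, x), (c, y)) \<in> germ_rel"
  shows "x = y"
  using assms by (elim germ_relE) (rule act_inj)

lemma equiv_germ_rel: "equiv elems germ_rel"
proof (rule equivI)
  show "germ_rel \<subseteq> elems \<times> elems" unfolding germ_rel_def by blast
  show "refl_on elems germ_rel"
    unfolding refl_on_def
    by (auto simp: elems_def intro!: germ_relI[OF valid_Id valid_Id])
  show "sym germ_rel" unfolding sym_def germ_rel_def by fastforce
  show "trans germ_rel"
  proof (rule transI)
    fix p q r assume "(p, q) \<in> germ_rel" "(q, r) \<in> germ_rel"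
    moreover obtain c x d y b z where pqr: "p = (c, x)" "q = (d, y)" "r = (b, z)" by (cases p; cases q; cases r)
    ultimately have pq: "((c, x), (d, y)) \<in> germ_rel" and qr: "((d, y), (b, z)) \<in> germ_rel" by simp_all
    obtain e where e: "valid e 1 c" "valid e 1 d" "act e 1 c x = act e 1 d y" "x \<in> ob c" "y \<in> ob d"
      by (rule germ_relE[OF pq])
    obtain e' where e': "valid e' 1 d" "valid e' 1 b" "act e' 1 d y = act e' 1 b z" "z \<in> ob b"
      by (rule germ_relE[OF qr])
    obtain f where f: "valid f 1 e" "valid f 1 e'"
      by (rule ex_object_pair[OF validD(1)[OF e(1)] validD(1)[OF e'(1)], of 1 1])
    have v: "valid f 1 c" "valid f 1 b" using valid_Comp[OF f(1) e(1)] valid_Comp[OF f(2) e'(2)] by simp_all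
    have "act f 1 c x = act f 1 e (act e 1 c x)" by (simp add: act_act[OF f(1) e(1) e(4)])
    also have "\<dots> = act f 1 e' (act e' 1 d y)"
      by (simp add: e(3) act_act[OF f(1) e(2) e(5)] act_act[OF f(2) e'(1) e(5)])
    also have "\<dots> = act f 1 b z" by (simp add: e'(3) act_act[OF f(2) e'(2) e'(4)])
    finally show "(p, r) \<in> germ_rel" unfolding pqr by (rule germ_relI[OF v e(4) e'(4)])
  qed
qed

definition germ :: "'c \<Rightarrow> 'u \<Rightarrow> ('c \<times> 'u) set" where
  "germ c x = germ_rel `` {(c, x)}"

lemma germ_eq_iff:
  assumes "c \<in> Obj C" "x \<in> ob c" "d \<in> Obj C" "y \<in> ob d"
  shows "germ c x = germ d y \<longleftrightarrow> ((c, x), (d, y)) \<in> germ_rel"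
  unfolding germ_def using eq_equiv_class_iff[OF equiv_germ_rel] assms by (simp add: elems_def)

text \<open>Any \<open>e\<close> from which \<open>m\<close> represents an arrow to \<open>c\<close>
  may be used, by \<open>germ_rel_act\<close>, and one exists by \<open>ex_object_pair\<close>. Off
  the quotient the action is \<open>undefined\<close>, as objects of \<open>E\<close>
  require.\<close>

definition germ_act :: "('c \<times> 'u) set \<Rightarrow> 'm \<Rightarrow> ('c \<times> 'u) set" where
  "germ_act = (\<lambda>q\<in>elems // germ_rel. \<lambda>m. SOME q'. \<exists>c x e. c \<in> Obj C \<and> x \<in> ob c \<and> q = germ c x \<and>
     valid e m c \<and> q' = germ e (act e m c x))"

lemma germ_cases:
  assumes "q \<in> elems // germ_rel"
  obtains c x where "c \<in> Obj C" "x \<in> ob c" "q = germ c x"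
  using assms by (auto simp: quotient_def elems_def germ_def)

lemma germ_in: "c \<in> Obj C \<Longrightarrow> x \<in> ob c \<Longrightarrow> germ c x \<in> elems // germ_rel"
  unfolding germ_def by (rule quotientI) (simp add: elems_def)

lemma germ_act:
  assumes v: "valid e m c" and x: "x \<in> ob c"
  shows "germ_act (germ c x) m = germ e (act e m c x)"
proof -
  note c = validD(2)[OF v]
  have "(SOME q'. \<exists>d y e. d \<in> Obj C \<and> y \<in> ob d \<and> germ c x = germ d y \<and>
     valid e m d \<and> q' = germ e (act e m d y)) = germ e (act e m c x)"
  proof (rule some_equality)
    show "\<exists>d y e'. d \<in> Obj C \<and> y \<in> ob d \<and> germ c x = germ d y \<and>
     valid e' m d \<and> germ e (act e m c x) = germ e' (act e' m d y)" using c x v by blast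
    fix q' assume "\<exists>d y e. d \<in> Obj C \<and> y \<in> ob d \<and> germ c x = germ d y \<and>
     valid e m d \<and> q' = germ e (act e m d y)"
    then obtain d y e' where d: "d \<in> Obj C" "y \<in> ob d" "germ c x = germ d y" "valid e' m d"
      "q' = germ e' (act e' m d y)" by blast
    have "((d, y), (c, x)) \<in> germ_rel" using germ_eq_iff[OF d(1,2) c x] d(3) by simp
    from germ_rel_act[OF this d(4) v] show "q' = germ e (act e m c x)"
      unfolding d(5) using germ_eq_iff act_in[OF d(4,2)] act_in[OF v x] validD(1)[OF d(4)] validD(1)[OF v] by blast
  qed
  then show ?thesis unfolding germ_act_def using germ_in[OF c x] by simp
qed

text \<open>Restriction along \<open>m\<close> sees only the class \<open>R c m\<close>, so the
  kernel of a germ from \<open>c\<close> contains the congruence at \<open>c\<close>. This yields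
  continuity of the action and places the germs of sections over \<open>c\<close> in the fixed set
  at \<open>c\<close>.\<close>

lemma germ_act_cong:
  assumes c: "c \<in> Obj C" and x: "x \<in> ob c" and eq: "R c m = R c n"
  shows "germ_act (germ c x) m = germ_act (germ c x) n"
proof -
  obtain e where e: "valid e m c" "valid e n c" by (rule ex_object_pair[OF c c, of m n])
  show ?thesis unfolding germ_act[OF e(1) x] germ_act[OF e(2) x] using act_cong[OF eq] by simp
qed

lemma continuous_germ_act: "continuous_mset \<tau> (elems // germ_rel, germ_act)"
  unfolding continuous_mset_iff
proof (intro conjI ballI allI)
  show "germ_act \<in> extensional (elems // germ_rel)" by (simp add: germ_act_def)
  fix q m n k assume "q \<in> elems // germ_rel"
  then obtain c x where c: "c \<in> Obj C" and x: "x \<in> ob c" and q: "q = germ c x" by (rule germ_cases)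
  obtain e where e: "valid e m c" by (rule ex_object_pair[OF c c, of m m])
  obtain f where f: "valid f n e" by (rule ex_object_pair[OF validD(1)[OF e] validD(1)[OF e], of n n])
  show "germ_act q m \<in> elems // germ_rel"
    unfolding q germ_act[OF e x] by (rule germ_in[OF validD(1)[OF e] act_in[OF e x]])
  show "germ_act q 1 = q"
    unfolding q germ_act[OF valid_Id[OF c] x] act_1[OF c x] ..
  show "germ_act q (m * n) = germ_act (germ_act q m) n"
    unfolding q germ_act[OF e x] germ_act[OF f act_in[OF e x]] germ_act[OF valid_Comp[OF f e] x]
      act_act[OF f e x] ..
  \<comment> \<open>A fibre of the orbit map is a union of classes of the open congruence at
    \<open>c\<close>.\<close>
  have "{n. germ_act q n = germ_act q k} = (\<Union>l\<in>{n. germ_act q n = germ_act q k}. {n. R c n = R c l})"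
    (is "?A = ?B")
  proof
    show "?B \<subseteq> ?A"
      by (intro UN_least subsetI CollectI) (metis (mono_tags, lifting) q germ_act_cong[OF c x] mem_Collect_eq)
  qed blast
  moreover have "openin \<tau> ?B" by (rule openin_Union) (use open_repD(4)[OF R[OF c]] in blast)
  ultimately show "openin \<tau> {n. germ_act q n = germ_act q k}" by simp
qed

lemma small_germs: "small U (elems // germ_rel)"
proof -
  have "small U elems"
    unfolding elems_def by (rule small_Sigma[OF U smallC small_in[OF P_ob]])
  moreover have "elems // germ_rel = (\<lambda>p. germ_rel `` {p}) ` elems" by (auto simp: quotient_def)
  ultimately show ?thesis using small_image[OF U] by metis
qed

text \<open>Taking germs maps \<open>ob c\<close> to the points of the colimit whose kernel contains
  the congruence at \<open>c\<close>, injectively by \<open>germ_rel_same\<close>. For surjectivity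
  such a point is represented over some \<open>d\<close> and restricted to a common refinement of
  \<open>c\<close> and \<open>d\<close>, from where it descends to \<open>c\<close>.\<close>

lemma Phi_ess_surj: "\<exists>A\<in>Obj E. \<exists>i\<in>hom Sh (Phi_ob A) P. iso Sh i"
proof -
  obtain A \<beta> where A: "A \<in> Obj E" and b: "bij_betw \<beta> (elems // germ_rel) (fst A)"
    and ba: "\<And>q m. q \<in> elems // germ_rel \<Longrightarrow> snd A (\<beta> q) m = \<beta> (germ_act q m)"
    using Obj_transport[OF continuous_germ_act small_germs] by metis
  have binj: "q = q'" if "\<beta> q = \<beta> q'" "q \<in> elems // germ_rel" "q' \<in> elems // germ_rel" for q q'
    using b that by (auto simp: bij_betw_def inj_on_def)
  define h where "h c = (\<lambda>x\<in>ob c. \<beta> (germ c x))" for c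
  define \<eta> where "\<eta> = (\<lambda>c\<in>Obj C. (ob c, h c, fixset c A))"
  have actA: "snd A (\<beta> (germ c x)) m = \<beta> (germ_act (germ c x) m)" if "c \<in> Obj C" "x \<in> ob c" for c x m
    by (rule ba[OF germ_in[OF that]])
  have hfix: "h c x \<in> fixset c A" if c: "c \<in> Obj C" and x: "x \<in> ob c" for c x
  proof (rule fixsetI[OF c])
    show "h c x \<in> fst A" using b germ_in[OF c x] x by (auto simp: h_def bij_betw_def)
    fix m n assume "R c m = R c n"
    then have "germ_act (germ c x) m = germ_act (germ c x) n" by (rule germ_act_cong[OF c x])
    then show "snd A (h c x) m = snd A (h c x) n" using x by (simp add: h_def actA[OF c x])
  qed
  have hext: "h c \<in> ob c \<rightarrow>\<^sub>E fixset c A" if "c \<in> Obj C" for c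
    using hfix[OF that] by (auto simp: h_def)
  have bij: "bij_betw (h c) (ob c) (fixset c A)" if c: "c \<in> Obj C" for c
    unfolding bij_betw_def
  proof
    show "inj_on (h c) (ob c)"
    proof (rule inj_onI)
      fix x y assume xy: "x \<in> ob c" "y \<in> ob c" "h c x = h c y"
      then have "germ c x = germ c y" by (intro binj germ_in c) (simp_all add: h_def)
      then show "x = y" using germ_eq_iff[OF c xy(1) c xy(2)] germ_rel_same by blast
    qed
    show "h c ` ob c = fixset c A"
    proof
      show "fixset c A \<subseteq> h c ` ob c"
      proof
        fix a assume a: "a \<in> fixset c A"
        then obtain q where q: "q \<in> elems // germ_rel" "a = \<beta> q"
          using fixsetD(1)[OF a] b by (auto simp: bij_betw_def)
        obtain d y where d: "d \<in> Obj C" and y: "y \<in> ob d" and qd: "q = germ d y" by (rule germ_cases[OF q(1)])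
        obtain e where e: "valid e 1 c" "valid e 1 d" by (rule ex_object_pair[OF c d, of 1 1])
        \<comment> \<open>Descent from \<open>e\<close> to \<open>c\<close>: elements congruent at
          \<open>c\<close> act equally on the point \<open>a\<close>, and injectivity of germs over
          \<open>k\<close> turns this into equality of the two restrictions.\<close>
        have "\<exists>!x. x \<in> ob c \<and> act e 1 c x = act e 1 d y"
        proof (rule act_glue[OF e(1) act_in[OF e(2) y]])
          fix k m m' assume v: "valid k m e" "valid k m' e" and mm: "R c m = R c m'"
          have w: "valid k m d" "valid k m' d" using valid_Comp[OF v(1) e(2)] valid_Comp[OF v(2) e(2)] by simp_all
          note kO = validD(1)[OF v(1)]
          have "\<beta> (germ_act (germ d y) m) = \<beta> (germ_act (germ d y) m')"
            using fixsetD(3)[OF a mm] by (simp add: q(2) qd actA[OF d y])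
          then have "\<beta> (germ k (act k m d y)) = \<beta> (germ k (act k m' d y))"
            by (simp add: germ_act[OF w(1) y] germ_act[OF w(2) y])
          then have "germ k (act k m d y) = germ k (act k m' d y)"
            by (rule binj) (intro germ_in kO act_in[OF w(1) y] act_in[OF w(2) y])+
          then have "act k m d y = act k m' d y"
            using germ_eq_iff[OF kO act_in[OF w(1) y] kO act_in[OF w(2) y]] germ_rel_same by blast
          then show "act k m e (act e 1 d y) = act k m' e (act e 1 d y)"
            by (simp add: act_act[OF v(1) e(2) y] act_act[OF v(2) e(2) y])
        qed
        then obtain x where x: "x \<in> ob c" "act e 1 c x = act e 1 d y" by blast
        have "germ c x = germ d y"
          using germ_eq_iff[OF c x(1) d y] germ_relI[OF e x(1) y x(2)] by blast
        then have "a = h c x" using x(1) by (simp add: q(2) qd h_def)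
        then show "a \<in> h c ` ob c" using x(1) by blast
      qed
    qed (use hfix[OF c] in blast)
  qed
  have n: "nat_trans (op_cat C) (set_cat U) P (Phi_ob A) \<eta>"
  proof (rule nat_transI[OF P_functor is_functor_Phi_ob[OF A]])
    fix c assume "c \<in> Obj (op_cat C)"
    then have c: "c \<in> Obj C" by (simp add: op_cat_def)
    show "\<eta> c \<in> hom (set_cat U) (ob c) (ob_map (Phi_ob A) c)"
      using c P_ob[OF c] fixset_U[OF A] hext[OF c] by (simp add: \<eta>_def Phi_ob_simps hom_set_cat)
  next
    fix f c k assume "f \<in> hom (op_cat C) c k"
    then have f: "f \<in> hom C k c" by (simp add: hom_op_cat)
    note kc = hom_Obj[OF C f]
    have "h k (fun_of (arr_map P f) x) = snd A (h c x) (el f)" if x: "x \<in> ob c" for x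
      using x act_in[OF valid_el[OF f] x] germ_act[OF valid_el[OF f] x]
      by (simp add: fun_of_act[OF f] h_def actA[OF kc(2) x])
    then have "compose (ob c) (h k) (fun_of (arr_map P f)) = compose (ob c) (\<lambda>x\<in>fixset c A. snd A x (el f)) (h c)"
      using hfix[OF kc(2)] by (auto simp: compose_def intro!: restrict_ext)
    then have "Comp (set_cat U) (\<eta> k) (ob c, fun_of (arr_map P f), ob k) = Comp (set_cat U) (arr_map (Phi_ob A) f) (\<eta> c)"
      using kc by (simp add: \<eta>_def Phi_ob_simps(2)[OF f] set_cat_simps)
    then show "Comp (set_cat U) (\<eta> k) (arr_map P f) = Comp (set_cat U) (arr_map (Phi_ob A) f) (\<eta> c)"
      using P_arr(1)[OF f] by simp
  qed
  have Pp: "P \<in> Obj (presheaf_cat U C)" "is_sheaf C J P" using P by (simp_all add: Obj_sheaf_cat)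
  have ph: "(P, \<eta>, Phi_ob A) \<in> hom (presheaf_cat U C) P (Phi_ob A)"
    using n Pp(1) Phi_ob_presheaf[OF A] by (simp add: hom_functor_cat \<eta>_def op_cat_def)
  have "iso (presheaf_cat U C) (P, \<eta>, Phi_ob A)"
  proof (rule iso_functor_cat[OF ph])
    fix c assume "c \<in> Obj (op_cat C)"
    then have c: "c \<in> Obj C" by (simp add: op_cat_def)
    show "iso (set_cat U) (\<eta> c)"
      using c bij[OF c] iso_set_cat[OF P_ob[OF c] fixset_U[OF A] hext[OF c]] by (simp add: \<eta>_def)
  qed
  then have isS: "iso Sh (P, \<eta>, Phi_ob A)"
    unfolding sheaf_cat_def
    by (rule iso_full_subcat[OF _ ph]) (use Pp(2) is_sheaf_Phi_ob[OF A] in simp_all)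
  have sh: "(P, \<eta>, Phi_ob A) \<in> hom Sh P (Phi_ob A)"
    using ph Pp(2) is_sheaf_Phi_ob[OF A] by (simp add: hom_sheaf_cat)
  \<comment> \<open>The germ map runs from \<open>P\<close> to \<open>Phi_ob A\<close>; its inverse
    has the required direction.\<close>
  obtain g where g: "g \<in> hom Sh (Phi_ob A) P" "Comp Sh g (P, \<eta>, Phi_ob A) = Id Sh P"
    "Comp Sh (P, \<eta>, Phi_ob A) g = Id Sh (Phi_ob A)" by (rule isoE[OF isS sh])
  have "iso Sh g" by (rule isoI[OF g(1) sh g(3,2)])
  then show ?thesis using A g(1) by blast
qed

end

lemma equivalent_Cont_sheaves: "equivalent E (sheaf_cat U C J)"
  by (rule equivalentI[OF is_functor_Phi])
    (use Phi_fully_faithful Phi_ess_surj in \<open>simp_all add: Phi_simps(1)\<close>)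

end


section \<open>A small copy of the site\<close>

context cont_monoid
begin

definition reps :: "('m \<Rightarrow> 'm) set" where
  "reps = {\<rho>. open_rep \<rho>}"

text \<open>The condition \<open>\<sigma> m = m\<close> makes \<open>m\<close> the chosen
  representative of its class, so that each equivariant map between two quotients occurs exactly
  once.\<close>

definition rep_arrs :: "(('m \<Rightarrow> 'm) \<times> 'm \<times> ('m \<Rightarrow> 'm)) set" where
  "rep_arrs = {(\<rho>, m, \<sigma>). \<rho> \<in> reps \<and> \<sigma> \<in> reps \<and> \<sigma> m = m \<and> (\<forall>n. \<sigma> (m * \<rho> n) = \<sigma> (m * n))}"

text \<open>Congruences are among the functions from the monoid to itself; once the monoid is
  embedded in a member of \<open>U\<close>, closure under exponentiation bounds all of
  these.\<close>

lemma small_reps: "small U reps"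
proof -
  obtain f :: "'m \<Rightarrow> 'u" where f: "inj f" "range f \<in> U" by (rule smallE[OF small_M])
  have "inj (\<lambda>\<rho>::'m \<Rightarrow> 'm. f \<circ> \<rho>)" using f(1) by (intro injI) (metis fun.inj_map injD)
  moreover have "range (\<lambda>\<rho>::'m \<Rightarrow> 'm. f \<circ> \<rho>) \<subseteq> UNIV \<rightarrow>\<^sub>E range f" by auto
  ultimately have "(UNIV :: ('m \<Rightarrow> 'm) set) \<lesssim> ((UNIV :: 'm set) \<rightarrow>\<^sub>E range f)"
    unfolding lepoll_def by blast
  then have "small U (UNIV :: ('m \<Rightarrow> 'm) set)"
    by (rule small_lepoll[OF U]) (use expU f(2) in \<open>simp add: closed_under_exponent_def\<close>)
  then show ?thesis by (rule small_subset[OF U]) simp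
qed

lemma small_rep_arrs: "small U rep_arrs"
  by (rule small_subset[OF U small_Times[OF U small_reps small_Times[OF U small_M small_reps]]])
    (auto simp: rep_arrs_def)

lemma rep_arrs_Id: "\<rho> \<in> reps \<Longrightarrow> (\<rho>, \<rho> 1, \<rho>) \<in> rep_arrs"
  by (simp add: rep_arrs_def reps_def open_repD)

lemma rep_arrs_Comp:
  assumes f: "(\<rho>, m, \<sigma>) \<in> rep_arrs" and g: "(\<sigma>, n, \<upsilon>) \<in> rep_arrs"
  shows "(\<rho>, \<upsilon> (n * m), \<upsilon>) \<in> rep_arrs"
proof -
  have u: "open_rep \<upsilon>" using g by (simp add: rep_arrs_def reps_def)
  have m: "\<sigma> (m * \<rho> k) = \<sigma> (m * k)" for k using f by (simp add: rep_arrs_def)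
  have n: "\<upsilon> (n * \<sigma> k) = \<upsilon> (n * k)" for k using g by (simp add: rep_arrs_def)
  have "\<upsilon> (n * (m * \<rho> k)) = \<upsilon> (n * (m * k))" for k
    using n[of "m * \<rho> k"] n[of "m * k"] m[of k] by simp
  then show ?thesis
    using f g by (simp add: rep_arrs_def open_repD[OF u] mult.assoc)
qed

text \<open>A Grothendieck topos must be presented by a category whose sets of objects and arrows
  belong to \<open>U\<close>, so congruences and the maps between quotients are replaced by codes
  under injections \<open>i\<close> and \<open>j\<close>. Each law is verified after decoding with
  \<open>r\<close> and \<open>t\<close>.\<close>

lemma ex_small_site:
  obtains S :: "('u, 'u) category" and R el
  where "cont_site U \<tau> S R el" "Obj S \<in> U" "Arr S \<in> U"
proof -
  obtain i where i: "inj_on i reps" "i ` reps \<in> U" by (rule smallE[OF small_reps])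
  obtain j where j: "inj_on j rep_arrs" "j ` rep_arrs \<in> U" by (rule smallE[OF small_rep_arrs])
  define r where "r = inv_into reps i"
  define t where "t = inv_into rep_arrs j"
  have r: "r (i \<rho>) = \<rho>" if "\<rho> \<in> reps" for \<rho> using i(1) that by (simp add: r_def)
  have t: "t (j a) = a" if "a \<in> rep_arrs" for a using j(1) that by (simp add: t_def)
  define el where "el f = fst (snd (t f))" for f
  define S where "S = \<lparr>Obj = i ` reps, Arr = j ` rep_arrs, Dom = (\<lambda>f. i (fst (t f))),
    Cod = (\<lambda>f. i (snd (snd (t f)))), Id = (\<lambda>c. j (r c, r c 1, r c)),
    Comp = (\<lambda>g f. j (fst (t f), snd (snd (t g)) (el g * el f), snd (snd (t g))))\<rparr>"
  have Obj: "Obj S = i ` reps" and Id: "Id S c = j (r c, r c 1, r c)" for c by (simp_all add: S_def)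
  have mem: "\<rho> \<in> reps" "\<sigma> \<in> reps" if "(\<rho>, m, \<sigma>) \<in> rep_arrs" for \<rho> m \<sigma>
    using that by (simp_all add: rep_arrs_def)
  have homI: "j (\<rho>, m, \<sigma>) \<in> hom S (i \<rho>) (i \<sigma>)" if "(\<rho>, m, \<sigma>) \<in> rep_arrs" for \<rho> m \<sigma>
    using that t[OF that] by (simp add: hom_def S_def)
  have homE: "\<exists>\<rho> m \<sigma>. (\<rho>, m, \<sigma>) \<in> rep_arrs \<and> f = j (\<rho>, m, \<sigma>) \<and> c = i \<rho> \<and> d = i \<sigma>"
    if f: "f \<in> hom S c d" for f c d
  proof -
    obtain \<rho> m \<sigma> where a: "(\<rho>, m, \<sigma>) \<in> rep_arrs" "f = j (\<rho>, m, \<sigma>)"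
      using f by (auto simp: hom_def S_def)
    then show ?thesis using f t[OF a(1)] by (auto simp: hom_def S_def)
  qed
  have el: "el (j (\<rho>, m, \<sigma>)) = m" if "(\<rho>, m, \<sigma>) \<in> rep_arrs" for \<rho> m \<sigma>
    using t[OF that] by (simp add: el_def)
  have Comp: "Comp S (j (\<sigma>, n, \<upsilon>)) (j (\<rho>, m, \<sigma>)) = j (\<rho>, \<upsilon> (n * m), \<upsilon>)"
    if "(\<rho>, m, \<sigma>) \<in> rep_arrs" "(\<sigma>, n, \<upsilon>) \<in> rep_arrs" for \<rho> m \<sigma> n \<upsilon>
    using t[OF that(1)] t[OF that(2)] by (simp add: S_def el_def)
  have ieq: "\<rho> = \<sigma>" if "i \<rho> = i \<sigma>" "\<rho> \<in> reps" "\<sigma> \<in> reps" for \<rho> \<sigma>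
    using i(1) that by (auto dest: inj_onD)
  \<comment> \<open>Injectivity of \<open>i\<close> makes the middle congruence of a composable pair
    the same for both arrows.\<close>
  have two: "\<exists>\<rho> m \<sigma> n \<upsilon>. (\<rho>, m, \<sigma>) \<in> rep_arrs \<and> (\<sigma>, n, \<upsilon>) \<in> rep_arrs \<and> f = j (\<rho>, m, \<sigma>) \<and>
      g = j (\<sigma>, n, \<upsilon>) \<and> b = i \<rho> \<and> c = i \<sigma> \<and> d = i \<upsilon>"
    if "f \<in> hom S b c" "g \<in> hom S c d" for f g b c d
    using homE[OF that(1)] homE[OF that(2)] ieq mem by metis
  have cat: "is_category S"
  proof (rule is_categoryI)
    fix f assume f: "f \<in> Arr S"
    show "Dom S f \<in> Obj S \<and> Cod S f \<in> Obj S"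
      using homE[OF Arr_hom[OF f]] mem unfolding Obj by blast
  next
    fix c assume "c \<in> Obj S"
    then obtain \<rho> where p: "\<rho> \<in> reps" "c = i \<rho>" unfolding Obj by blast
    show "Id S c \<in> hom S c c" using homI[OF rep_arrs_Id[OF p(1)]] by (simp add: Id p(2) r[OF p(1)])
  next
    fix f g b c d assume "f \<in> hom S b c" "g \<in> hom S c d"
    from two[OF this] obtain \<rho> m \<sigma> n \<upsilon> where a: "(\<rho>, m, \<sigma>) \<in> rep_arrs" "(\<sigma>, n, \<upsilon>) \<in> rep_arrs"
      "f = j (\<rho>, m, \<sigma>)" "g = j (\<sigma>, n, \<upsilon>)" "b = i \<rho>" "d = i \<upsilon>" by blast
    show "Comp S g f \<in> hom S b d"
      unfolding a(3-6) Comp[OF a(1,2)] by (rule homI[OF rep_arrs_Comp[OF a(1,2)]])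
  next
    fix f c d assume f: "f \<in> hom S c d"
    obtain \<rho> m \<sigma> where a: "(\<rho>, m, \<sigma>) \<in> rep_arrs" "f = j (\<rho>, m, \<sigma>)" "c = i \<rho>" "d = i \<sigma>"
      using homE[OF f] by blast
    note rs = mem[OF a(1)]
    have "\<sigma> (m * \<rho> 1) = m" "\<sigma> (\<sigma> 1 * m) = m"
      using a(1) open_repD(1)[of \<sigma> 1 m] by (simp_all add: rep_arrs_def reps_def)
    then show "Comp S f (Id S c) = f \<and> Comp S (Id S d) f = f"
      unfolding a(2-4) Id r[OF rs(1)] r[OF rs(2)] Comp[OF rep_arrs_Id[OF rs(1)] a(1)]
        Comp[OF a(1) rep_arrs_Id[OF rs(2)]] by simp
  next
    fix f g h b c d e assume f: "f \<in> hom S b c" and g: "g \<in> hom S c d" and h: "h \<in> hom S d e"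
    obtain \<rho> m \<sigma> n \<upsilon> where a: "(\<rho>, m, \<sigma>) \<in> rep_arrs" "(\<sigma>, n, \<upsilon>) \<in> rep_arrs"
      "f = j (\<rho>, m, \<sigma>)" "g = j (\<sigma>, n, \<upsilon>)" "d = i \<upsilon>" using two[OF f g] by blast
    obtain \<upsilon>' l \<phi> where b: "(\<upsilon>', l, \<phi>) \<in> rep_arrs" "h = j (\<upsilon>', l, \<phi>)" "d = i \<upsilon>'"
      using homE[OF h] by blast
    have "\<upsilon>' = \<upsilon>" by (rule ieq) (use a(5) b(3) mem[OF a(2)] mem[OF b(1)] in auto)
    with b have b: "(\<upsilon>, l, \<phi>) \<in> rep_arrs" "h = j (\<upsilon>, l, \<phi>)" by simp_all
    have "open_rep \<phi>" using b(1) by (simp add: rep_arrs_def reps_def)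
    \<comment> \<open>Associativity up to normalisation: validity of \<open>l\<close> removes the
      inner \<open>\<upsilon>\<close>, and the congruence law of \<open>\<phi>\<close> removes the
      inner \<open>\<phi>\<close>.\<close>
    then have "\<phi> (l * \<upsilon> (n * m)) = \<phi> (\<phi> (l * n) * m)"
      using b(1) by (simp add: open_repD(1) rep_arrs_def mult.assoc)
    then show "Comp S h (Comp S g f) = Comp S (Comp S h g) f"
      unfolding a(3,4) b(2) Comp[OF a(1,2)] Comp[OF a(2) b(1)]
        Comp[OF rep_arrs_Comp[OF a(1,2)] b(1)] Comp[OF a(1) rep_arrs_Comp[OF a(2) b(1)]] by simp
  qed
  have "cont_site U \<tau> S r el"
  proof (unfold_locales, rule cat)
    show "small U (Obj S)" unfolding Obj by (rule small_in[OF i(2)])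
    show "open_rep (r c)" if "c \<in> Obj S" for c
      using that r unfolding Obj reps_def by auto
    show "\<exists>c\<in>Obj S. r c = \<rho>" if "open_rep \<rho>" for \<rho>
      using that r unfolding Obj reps_def by auto
    show "r d (el f * r c n) = r d (el f * n)" "r d (el f) = el f" if f: "f \<in> hom S c d" for f c d n
    proof -
      obtain \<rho> m \<sigma> where a: "(\<rho>, m, \<sigma>) \<in> rep_arrs" "f = j (\<rho>, m, \<sigma>)" "c = i \<rho>" "d = i \<sigma>"
        using homE[OF f] by blast
      show "r d (el f * r c n) = r d (el f * n)" "r d (el f) = el f"
        using a(1) unfolding a(2-4) el[OF a(1)] r[OF mem(1)[OF a(1)]] r[OF mem(2)[OF a(1)]]
        by (simp_all add: rep_arrs_def)
    qed
    show "\<exists>f\<in>hom S c d. el f = r d m"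
      if c: "c \<in> Obj S" and d: "d \<in> Obj S" and m: "\<And>n. r d (m * r c n) = r d (m * n)" for c d m
    proof -
      obtain \<rho> where p: "\<rho> \<in> reps" "c = i \<rho>" using c unfolding Obj by blast
      obtain \<sigma> where s: "\<sigma> \<in> reps" "d = i \<sigma>" using d unfolding Obj by blast
      have "(\<rho>, \<sigma> m, \<sigma>) \<in> rep_arrs"
        using p(1) s(1) m unfolding p(2) s(2) r[OF p(1)] r[OF s(1)]
        by (simp add: rep_arrs_def reps_def open_repD(1,2))
      then show ?thesis using homI el unfolding p(2) s(2) r[OF s(1)] by blast
    qed
    show "f = g" if f: "f \<in> hom S c d" and g: "g \<in> hom S c d" and fg: "el f = el g" for f g c d
    proof -
      obtain \<rho> m \<sigma> where a: "(\<rho>, m, \<sigma>) \<in> rep_arrs" "f = j (\<rho>, m, \<sigma>)" "c = i \<rho>" "d = i \<sigma>"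
        using homE[OF f] by blast
      obtain \<rho>' m' \<sigma>' where b: "(\<rho>', m', \<sigma>') \<in> rep_arrs" "g = j (\<rho>', m', \<sigma>')" "c = i \<rho>'" "d = i \<sigma>'"
        using homE[OF g] by blast
      have "\<rho>' = \<rho>" "\<sigma>' = \<sigma>"
        by (rule ieq; use a b mem[OF a(1)] mem[OF b(1)] in simp)+
      moreover have "m = m'" using fg a(2) b(2) el[OF a(1)] el[OF b(1)] by simp
      ultimately show ?thesis using a(2) b(2) by simp
    qed
    show "el (Id S c) = r c 1" if "c \<in> Obj S" for c
    proof -
      have "r c \<in> reps" using that r unfolding Obj by auto
      from el[OF rep_arrs_Id[OF this]] show ?thesis by (simp add: Id)
    qed
    show "el (Comp S g f) = r d (el g * el f)" if f: "f \<in> hom S b c" and g: "g \<in> hom S c d" for f g b c d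
    proof -
      obtain \<rho> m \<sigma> n \<upsilon> where a: "(\<rho>, m, \<sigma>) \<in> rep_arrs" "(\<sigma>, n, \<upsilon>) \<in> rep_arrs"
        "f = j (\<rho>, m, \<sigma>)" "g = j (\<sigma>, n, \<upsilon>)" "d = i \<upsilon>" using two[OF f g] by blast
      show ?thesis
        unfolding a(3-5) Comp[OF a(1,2)] el[OF rep_arrs_Comp[OF a(1,2)]] el[OF a(1)] el[OF a(2)]
          r[OF mem(2)[OF a(2)]] ..
    qed
  qed
  then show ?thesis by (rule that) (simp_all add: S_def i(2) j(2))
qed

lemma grothendieck_topos_Cont: "grothendieck_topos U E"
proof -
  obtain S :: "('u, 'u) category" and R el
    where S: "cont_site U \<tau> S R el" "Obj S \<in> U" "Arr S \<in> U" by (rule ex_small_site)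
  interpret S: cont_site U \<tau> S R el by (rule S(1))
  show ?thesis
    unfolding grothendieck_topos_def
    using is_category_Cont S.C S(2,3) S.grothendieck_topology_J S.equivalent_Cont_sheaves by blast
qed

end

theorem corollary1p19:
  fixes U :: "'u set set" and \<tau> :: "'m::monoid_mult topology"
  assumes "topspace \<tau> = UNIV"
    and "regular_universe U" and "closed_under_exponent U (UNIV :: 'm set)"
  shows "grothendieck_topos U (Cont U \<tau>) \<and> supercompactly_generated (Cont U \<tau>) \<and>
    two_valued (Cont U \<tau>) \<and> has_enough_points U (Cont U \<tau>)"
proof -
  interpret cont_monoid U \<tau> by unfold_locales (fact assms)+
  show ?thesis
    using grothendieck_topos_Cont supercompactly_generated_Cont two_valued_Cont has_enough_points_Cont
    by blast
qed

end
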